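(* There are groups with nontrivial partitions in $\mathcal{H}$, namely the groups in the following list. (i) The symmetric group $S_4$ on four elements belongs to $\mathcal{H}$. (ii) There is a constant $c\ge 2\sqrt{2}$ such that, whenever $q=3^n$ with $n\ge 2$ or $q$ is a prime power with $q\ge 5$, $$|\mathrm{PSL}(2,q)| \le c\ \mathbf{B}(\mathrm{PSL}(2,q))\ \sqrt{\mathbf{B}(\mathrm{PSL}(2,q))}.$$ In particular, $\mathrm{PSL}(2,q)\in\mathcal{H}$ for all prime powers $q\ge 4$. (iii) There is a constant $c\ge 2\sqrt{2}$ such that, whenever $q=2^{2n+1}$ with $n\ge 1$, $$|\mathrm{Sz}(q)| \le c\ \mathbf{B}(\mathrm{Sz}(q))\ \sqrt{\mathbf{B}(\mathrm{Sz}(q))},$$ and $\mathrm{Sz}(q)\in\mathcal{H}$ for all such $q\ge 8$. (iv) There is a constant $c\ge 2\sqrt{2}$ such that, whenever $q$ is a prime power with $q\ge 4$, $$|\mathrm{PGL}(2,q)| \le c\ \mathbf{B}(\mathrm{PGL}(2,q))\ \sqrt{\mathbf{B}(\mathrm{PGL}(2,q))},$$ and $\mathrm{PGL}(2,q)\in\mathcal{H}$ for all prime powers $q\ge 4$.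
   Context: All groups are finite. For a finite group $G$ and a positive divisor $k$ of $|G|$, let $L_k(G)=\{x\in G \mid x^k=1\}$. The local breadth of $G$ at $k$ is $\mathbf{b}_k(G)=|L_k(G)|/k$, and the global breadth of $G$ is $\mathbf{B}(G)=\max\{\mathbf{b}_k(G) \mid k \text{ a positive divisor of } |G|\}$. The class $\mathcal{H}$ consists of all finite groups $G$ satisfying $|G|\le \mathbf{B}(G)(\mathbf{B}(G)+1)$. A partition of a nontrivial group $G$ is a collection $\mathrm{P}(G)$ of nontrivial subgroups of $G$ such that every nontrivial element of $G$ belongs to a unique subgroup in $\mathrm{P}(G)$; it is trivial if $|\mathrm{P}(G)|=1$ and nontrivial otherwise. $\mathrm{PSL}(2,q)$ and $\mathrm{PGL}(2,q)$ are the two-dimensional projective special linear group and projective general linear group over the field $\mathbb{F}_q$ with $q$ elements, and $\mathrm{Sz}(q)$, for $q=2^{2n+1}$, is the Suzuki group over $\mathbb{F}_q$, of order $q^2(q^2+1)(q-1)$. *)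

theory Defs
  imports
    Complex_Main
    "HOL-Algebra.Sym_Groups"
    "HOL-Algebra.Generated_Groups"
    "HOL-Algebra.Ring"
    "HOL-Number_Theory.Prime_Powers"
begin

definition root_set :: "nat \<Rightarrow> ('a, 'b) monoid_scheme \<Rightarrow> 'a set" where
  "root_set k G = {x \<in> carrier G. x [^]\<^bsub>G\<^esub> k = \<one>\<^bsub>G\<^esub>}"

definition local_breadth :: "nat \<Rightarrow> ('a, 'b) monoid_scheme \<Rightarrow> real" where
  "local_breadth k G = real (card (root_set k G)) / real k"

text \<open>The maximum is over a finite nonempty set only for finite groups, so these
  are the only ones for which the value is meaningful.\<close>

definition global_breadth :: "('a, 'b) monoid_scheme \<Rightarrow> real" where
  "global_breadth G = Max {local_breadth k G | k. 0 < k \<and> k dvd order G}"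

definition in_class_H :: "('a, 'b) monoid_scheme \<Rightarrow> bool" where
  "in_class_H G \<longleftrightarrow> group G \<and> finite (carrier G) \<and>
     real (order G) \<le> global_breadth G * (global_breadth G + 1)"

definition group_partition :: "('a, 'b) monoid_scheme \<Rightarrow> 'a set set \<Rightarrow> bool" where
  "group_partition G P \<longleftrightarrow>
     carrier G \<noteq> {\<one>\<^bsub>G\<^esub>} \<and>
     (\<forall>H\<in>P. subgroup H G \<and> H \<noteq> {\<one>\<^bsub>G\<^esub>}) \<and>
     (\<forall>x\<in>carrier G - {\<one>\<^bsub>G\<^esub>}. \<exists>!H. H \<in> P \<and> x \<in> H)"

definition has_nontrivial_partition :: "('a, 'b) monoid_scheme \<Rightarrow> bool" where
  "has_nontrivial_partition G \<longleftrightarrow>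
     group G \<and> finite (carrier G) \<and> (\<exists>P. group_partition G P \<and> card P \<noteq> 1)"

text \<open>\<open>F\<close> is a model of the field with \<open>q\<close> elements.  Every finite field has an
  isomorphic copy with carrier in \<^typ>\<open>nat\<close>, so quantifying over all such models of type
  \<^typ>\<open>nat ring\<close> covers every finite field up to isomorphism; with the type fixed, a
  bound can be stated uniformly in \<open>q\<close>.\<close>

definition is_GF :: "nat \<Rightarrow> ('a, 'b) ring_scheme \<Rightarrow> bool" where
  "is_GF q F \<longleftrightarrow> field F \<and> finite (carrier F) \<and> order F = q"

text \<open>An n by n matrix over a ring is an extensional function on pairs of indices
  (row, column) below n, so that equality of matrices is equality of their entries.\<close>

definition mat_of_rows ::
    "nat \<Rightarrow> 'a list list \<Rightarrow> nat \<times> nat \<Rightarrow> 'a" where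
  "mat_of_rows n rows = (\<lambda>(i, j) \<in> {..<n} \<times> {..<n}. rows ! i ! j)"

definition scalar_mat ::
    "nat \<Rightarrow> ('a, 'b) ring_scheme \<Rightarrow> 'a \<Rightarrow> nat \<times> nat \<Rightarrow> 'a" where
  "scalar_mat n R c = (\<lambda>(i, j) \<in> {..<n} \<times> {..<n}. if i = j then c else \<zero>\<^bsub>R\<^esub>)"

definition mat_monoid ::
    "nat \<Rightarrow> ('a, 'b) ring_scheme \<Rightarrow> (nat \<times> nat \<Rightarrow> 'a) monoid" where
  "mat_monoid n R =
     \<lparr>carrier = ({..<n} \<times> {..<n}) \<rightarrow>\<^sub>E carrier R,
      mult = (\<lambda>A B. \<lambda>(i, j) \<in> {..<n} \<times> {..<n}.
                \<Oplus>\<^bsub>R\<^esub>k\<in>{..<n}. A (i, k) \<otimes>\<^bsub>R\<^esub> B (k, j)),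
      one = scalar_mat n R \<one>\<^bsub>R\<^esub>\<rparr>"

definition GL :: "nat \<Rightarrow> ('a, 'b) ring_scheme \<Rightarrow> (nat \<times> nat \<Rightarrow> 'a) monoid" where
  "GL n R = units_of (mat_monoid n R)"

definition det2 :: "('a, 'b) ring_scheme \<Rightarrow> (nat \<times> nat \<Rightarrow> 'a) \<Rightarrow> 'a" where
  "det2 R A = A (0, 0) \<otimes>\<^bsub>R\<^esub> A (1, 1) \<ominus>\<^bsub>R\<^esub> A (0, 1) \<otimes>\<^bsub>R\<^esub> A (1, 0)"

definition SL2 :: "('a, 'b) ring_scheme \<Rightarrow> (nat \<times> nat \<Rightarrow> 'a) monoid" where
  "SL2 R = (GL 2 R)\<lparr>carrier := {A \<in> carrier (GL 2 R). det2 R A = \<one>\<^bsub>R\<^esub>}\<rparr>"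

definition scalars2 :: "('a, 'b) ring_scheme \<Rightarrow> (nat \<times> nat \<Rightarrow> 'a) set" where
  "scalars2 R = scalar_mat 2 R ` carrier R"

definition PGL2 :: "('a, 'b) ring_scheme \<Rightarrow> (nat \<times> nat \<Rightarrow> 'a) set monoid" where
  "PGL2 R = GL 2 R Mod (carrier (GL 2 R) \<inter> scalars2 R)"

definition PSL2 :: "('a, 'b) ring_scheme \<Rightarrow> (nat \<times> nat \<Rightarrow> 'a) set monoid" where
  "PSL2 R = SL2 R Mod (carrier (SL2 R) \<inter> scalars2 R)"

text \<open>The Suzuki group over a field with \<open>2 ^ (2 * n + 1)\<close> elements, as the subgroup of
  the general linear group of degree 4 given by Suzuki's generators (see Huppert and
  Blackburn, Finite Groups III, Chapter XI, Section 3).  The automorphism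
  \<open>\<theta> x = x ^ (2 ^ (n + 1))\<close> satisfies \<open>\<theta> (\<theta> x) = x\<^sup>2\<close>, and
  \<open>x ^ (2 ^ n)\<close> is the preimage of \<open>x\<close> under \<open>\<theta>\<close>.\<close>

definition suz_aut :: "nat \<Rightarrow> ('a, 'b) ring_scheme \<Rightarrow> 'a \<Rightarrow> 'a" where
  "suz_aut n F x = x [^]\<^bsub>F\<^esub> ((2::nat) ^ (n + 1))"

definition suz_unipotent ::
    "nat \<Rightarrow> ('a, 'b) ring_scheme \<Rightarrow> 'a \<Rightarrow> 'a \<Rightarrow> nat \<times> nat \<Rightarrow> 'a" where
  "suz_unipotent n F a b = mat_of_rows 4
     [[\<one>\<^bsub>F\<^esub>, \<zero>\<^bsub>F\<^esub>, \<zero>\<^bsub>F\<^esub>, \<zero>\<^bsub>F\<^esub>],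
      [a, \<one>\<^bsub>F\<^esub>, \<zero>\<^bsub>F\<^esub>, \<zero>\<^bsub>F\<^esub>],
      [b, suz_aut n F a, \<one>\<^bsub>F\<^esub>, \<zero>\<^bsub>F\<^esub>],
      [a [^]\<^bsub>F\<^esub> (2::nat) \<otimes>\<^bsub>F\<^esub> suz_aut n F a \<oplus>\<^bsub>F\<^esub> a \<otimes>\<^bsub>F\<^esub> b \<oplus>\<^bsub>F\<^esub> suz_aut n F b,
       a \<otimes>\<^bsub>F\<^esub> suz_aut n F a \<oplus>\<^bsub>F\<^esub> b, a, \<one>\<^bsub>F\<^esub>]]"

definition suz_torus ::
    "nat \<Rightarrow> ('a, 'b) ring_scheme \<Rightarrow> 'a \<Rightarrow> nat \<times> nat \<Rightarrow> 'a" where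
  "suz_torus n F c = mat_of_rows 4
     [[c [^]\<^bsub>F\<^esub> ((2::nat) ^ n + 1), \<zero>\<^bsub>F\<^esub>, \<zero>\<^bsub>F\<^esub>, \<zero>\<^bsub>F\<^esub>],
      [\<zero>\<^bsub>F\<^esub>, c [^]\<^bsub>F\<^esub> ((2::nat) ^ n), \<zero>\<^bsub>F\<^esub>, \<zero>\<^bsub>F\<^esub>],
      [\<zero>\<^bsub>F\<^esub>, \<zero>\<^bsub>F\<^esub>, inv\<^bsub>F\<^esub> (c [^]\<^bsub>F\<^esub> ((2::nat) ^ n)), \<zero>\<^bsub>F\<^esub>],
      [\<zero>\<^bsub>F\<^esub>, \<zero>\<^bsub>F\<^esub>, \<zero>\<^bsub>F\<^esub>, inv\<^bsub>F\<^esub> (c [^]\<^bsub>F\<^esub> ((2::nat) ^ n + 1))]]"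

definition suz_flip :: "('a, 'b) ring_scheme \<Rightarrow> nat \<times> nat \<Rightarrow> 'a" where
  "suz_flip F = mat_of_rows 4
     [[\<zero>\<^bsub>F\<^esub>, \<zero>\<^bsub>F\<^esub>, \<zero>\<^bsub>F\<^esub>, \<one>\<^bsub>F\<^esub>],
      [\<zero>\<^bsub>F\<^esub>, \<zero>\<^bsub>F\<^esub>, \<one>\<^bsub>F\<^esub>, \<zero>\<^bsub>F\<^esub>],
      [\<zero>\<^bsub>F\<^esub>, \<one>\<^bsub>F\<^esub>, \<zero>\<^bsub>F\<^esub>, \<zero>\<^bsub>F\<^esub>],
      [\<one>\<^bsub>F\<^esub>, \<zero>\<^bsub>F\<^esub>, \<zero>\<^bsub>F\<^esub>, \<zero>\<^bsub>F\<^esub>]]"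

definition Sz :: "nat \<Rightarrow> ('a, 'b) ring_scheme \<Rightarrow> (nat \<times> nat \<Rightarrow> 'a) monoid" where
  "Sz n F = (GL 4 F)\<lparr>carrier := generate (GL 4 F)
     ({suz_unipotent n F a b | a b. a \<in> carrier F \<and> b \<in> carrier F} \<union>
      {suz_torus n F c | c. c \<in> carrier F - {\<zero>\<^bsub>F\<^esub>}} \<union>
      {suz_flip F})\<rparr>"

end

theory Submission
  imports Defs "HOL-Algebra.Multiplicative_Group" "HOL-Decision_Procs.Commutative_Ring"
begin

text \<open>Two different things have to be shown for each group \<open>G\<close> of the list: that it has many
  solutions of a single equation \<open>x ^ k = 1\<close>, and that it has a nontrivial partition.

  One small divisor \<open>k\<close> suffices every time, because \<open>|L\<^sub>k(G)| / k\<close> is a lower bound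
  for the global breadth. In \<open>PGL(2,q)\<close> a matrix of trace zero has a scalar square by the
  Cayley-Hamilton theorem, and modulo scalars there are \<open>q\<^sup>2\<close> invertible ones; so \<open>k = 2\<close> gives
  breadth at least \<open>q\<^sup>2 / 2\<close>, while the order is less than \<open>q ^ 3\<close>. The same matrices, with determinant
  one, serve \<open>PSL(2,q)\<close>; there the bound \<open>(q (q - 1) + 2) / 4\<close> for odd \<open>q\<close> is too weak for the class
  \<open>H\<close> when \<open>q\<close> is 5 or 7. For \<open>q = 5\<close> the element \<open>-1\<close> is a square, which yields more matrices of
  trace zero, and for \<open>q = 7\<close> the exponent \<open>k = 3\<close> works. In \<open>Sz(q)\<close>, of order below \<open>q ^ 5\<close>, the
  conjugates of the Sylow 2-subgroup \<open>Q\<close> of order \<open>q\<^sup>2\<close> meet trivially, their elements satisfy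
  \<open>x ^ 4 = 1\<close>, and they contain at least \<open>q ^ 4\<close> elements (\<open>card_conj_to_Q\<close>). A bound
  \<open>B \<ge> r\<^sup>2 / c\<^sup>2\<close> together with \<open>|G| \<le> r ^ 3\<close> gives \<open>|G| \<le> c ^ 3 B \<surd>B\<close>; this is where the constants
  come from. In \<open>S\<^sub>4\<close> there are ten solutions of \<open>x ^ 2 = 1\<close>, and \<open>24 \<le> 5 * 6\<close>.

  The partitions of the projective groups come from commuting matrices. Two \<open>2 \<times> 2\<close> matrices with
  rows \<open>(a, b)\<close>, \<open>(c, d)\<close> and \<open>(a', b')\<close>, \<open>(c', d')\<close> commute iff the vectors \<open>(b, c, a - d)\<close> and
  \<open>(b', c', a' - d')\<close> are parallel. Hence commuting is transitive on nonscalar matrices (\<open>commute_trans\<close>), distinct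
  centralizers of nonscalar matrices meet in scalars only, and their images partition the
  quotient by the scalars (\<open>central_quotient_partition\<close>).

  The Suzuki group \<open>Sz(q)\<close> acts doubly transitively on \<open>q\<^sup>2 + 1\<close> points, the cosets
  of \<open>B = QK\<close> with \<open>K\<close> a torus; this is read off from a Bruhat decomposition, for which the only
  hard input is the matrix identity \<open>flip_unip_flip\<close>. The components of the partition are the
  conjugates of \<open>Q\<close>, the conjugates of \<open>K\<close> (they are the centralizers of their nontrivial elements),
  and the centralizers of the elements without fixed points. For this to be a partition the
  centralizer of an element \<open>x\<close> without fixed points has to be abelian (\<open>nontrivial_partition\<close>). It
  acts freely on the \<open>q\<^sup>2 + 1\<close> points, so \<open>x ^ (q\<^sup>2 + 1) = 1\<close>. After conjugation \<open>x\<close> lies in the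
  big cell \<open>Q K t\<close>. Either the last basis vector \<open>e\<close> is cyclic for \<open>x\<close>, or \<open>x\<close> has
  an eigenvalue in the field; the latter contradicts \<open>x ^ (q\<^sup>2 + 1) = 1\<close> (\<open>degenerate_order\<close>). If \<open>e\<close>
  is cyclic and \<open>y, z\<close> commute with \<open>x\<close>, then \<open>y e\<close> and \<open>z e\<close> are polynomials in \<open>x\<close> applied to \<open>e\<close>, so
  \<open>y z e = z y e\<close> (\<open>cyclic_commute\<close>). The commutator of \<open>y\<close> and \<open>z\<close> therefore fixes \<open>e\<close>, which means
  that it lies in \<open>B\<close>; as it also centralizes \<open>x\<close>, it is trivial.

  The partition of \<open>S\<^sub>4\<close> consists of its thirteen maximal cyclic subgroups.\<close>

section \<open>Lower bounds for the global breadth\<close>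

lemma local_breadth_le_global_breadth:
  assumes "order G > 0" "k dvd order G"
  shows "local_breadth k G \<le> global_breadth G"
proof -
  have "{local_breadth k G | k. 0 < k \<and> k dvd order G}
      = (\<lambda>k. local_breadth k G) ` {k. 0 < k \<and> k dvd order G}"
    by auto
  moreover have "finite {k. 0 < k \<and> k dvd order G}"
    using assms(1) by simp
  moreover have "0 < k"
    using assms by (auto intro: Nat.gr0I)
  ultimately show ?thesis
    unfolding global_breadth_def using assms(2) by (intro Max_ge) auto
qed

lemma global_breadth_ge_card:
  assumes "group G" "finite (carrier G)" "k dvd order G"
    and "S \<subseteq> root_set k G" "n \<le> card S"
  shows "real n / real k \<le> global_breadth G"
proof -
  have "finite (root_set k G)"
    using assms(2) unfolding root_set_def by simp
  hence "n \<le> card (root_set k G)"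
    using assms(4,5) card_mono le_trans by blast
  hence "real n / real k \<le> local_breadth k G"
    unfolding local_breadth_def by (intro divide_right_mono) auto
  moreover have "order G > 0"
    using assms(1,2) by (simp add: group.is_monoid monoid.order_gt_0_iff_finite)
  ultimately show ?thesis
    using local_breadth_le_global_breadth[OF _ assms(3)] by linarith
qed

lemma in_class_HI:
  assumes "group G" "finite (carrier G)" "0 \<le> b" "b \<le> global_breadth G"
    and "real (order G) \<le> b * (b + 1)"
  shows "in_class_H G"
proof -
  have "b * (b + 1) \<le> global_breadth G * (global_breadth G + 1)"
    using assms(3,4) by (intro mult_mono) auto
  thus ?thesis using assms unfolding in_class_H_def by linarith
qed

text \<open>Applied with \<open>N\<close> the order of a group of Lie type and \<open>b\<close> its breadth; all constants of the final
  bounds arise here as \<open>c ^ 3\<close>.\<close>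

lemma order_le_power_three_halves:
  fixes b c q N :: real
  assumes "0 < c" "0 \<le> q" "q\<^sup>2 / c\<^sup>2 \<le> b" "N \<le> q ^ 3"
  shows "N \<le> c ^ 3 * b * sqrt b"
proof -
  have 1: "q / c \<le> sqrt b"
    using assms by (intro real_le_rsqrt) (simp add: power_divide)
  have "0 \<le> q / c" using assms by simp
  have b0: "0 \<le> b" using assms(3) by (smt (verit) zero_le_divide_iff zero_le_power2)
  have "(q / c) ^ 3 \<le> sqrt b ^ 3"
    using 1 \<open>0 \<le> q / c\<close> by (intro power_mono)
  also have "\<dots> = b * sqrt b" using b0 by (simp add: power3_eq_cube)
  finally have "q ^ 3 \<le> c ^ 3 * (b * sqrt b)"
    using assms(1) by (simp add: field_simps)
  thus ?thesis using assms(4) by (simp add: mult.assoc)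
qed

lemma cube_minus_le_half_square:
  fixes q :: real
  assumes "q \<ge> 4"
  shows "q ^ 3 - q \<le> q\<^sup>2 / 2 * (q\<^sup>2 / 2 + 1)"
proof -
  have "4 * q ^ 3 \<le> q * q ^ 3" using assms by (intro mult_right_mono) auto
  hence "4 * q ^ 3 \<le> q ^ 4" by (simp add: eval_nat_numeral)
  moreover have "q\<^sup>2 / 2 * (q\<^sup>2 / 2 + 1) = q ^ 4 / 4 + q\<^sup>2 / 2"
    by (simp add: eval_nat_numeral field_simps)
  ultimately show ?thesis using assms zero_le_power2[of q] by linarith
qed

section \<open>Conjugation and centralizers\<close>

context group begin

definition conjugate :: "'a \<Rightarrow> 'a \<Rightarrow> 'a" where
  "conjugate g x = g \<otimes> x \<otimes> inv g"

definition centralizer_of :: "'a \<Rightarrow> 'a set" where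
  "centralizer_of x = {y \<in> carrier G. x \<otimes> y = y \<otimes> x}"

lemma inv_cancel_left [simp]:
  "x \<in> carrier G \<Longrightarrow> y \<in> carrier G \<Longrightarrow> inv x \<otimes> (x \<otimes> y) = y"
  "x \<in> carrier G \<Longrightarrow> y \<in> carrier G \<Longrightarrow> x \<otimes> (inv x \<otimes> y) = y"
  by (simp_all add: m_assoc [symmetric])

text \<open>Rewriting to right-associated words decides most identities between conjugates below.\<close>

lemmas word_simps = conjugate_def m_assoc inv_mult_group

lemma conjugate_closed [simp]:
  "g \<in> carrier G \<Longrightarrow> x \<in> carrier G \<Longrightarrow> conjugate g x \<in> carrier G"
  by (simp add: conjugate_def)

lemma conjugate_mult:
  "g \<in> carrier G \<Longrightarrow> x \<in> carrier G \<Longrightarrow> y \<in> carrier G \<Longrightarrow>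
    conjugate g x \<otimes> conjugate g y = conjugate g (x \<otimes> y)"
  by (simp add: word_simps)

lemma conjugate_conjugate:
  "g \<in> carrier G \<Longrightarrow> h \<in> carrier G \<Longrightarrow> x \<in> carrier G \<Longrightarrow>
    conjugate g (conjugate h x) = conjugate (g \<otimes> h) x"
  by (simp add: word_simps)

lemma conjugate_one [simp]: "g \<in> carrier G \<Longrightarrow> conjugate g \<one> = \<one>"
  by (simp add: word_simps)

lemma conjugate_by_one [simp]: "x \<in> carrier G \<Longrightarrow> conjugate \<one> x = x"
  by (simp add: word_simps)

lemma conjugate_inv:
  "g \<in> carrier G \<Longrightarrow> x \<in> carrier G \<Longrightarrow> inv (conjugate g x) = conjugate g (inv x)"
  by (simp add: word_simps)

lemma conjugate_pow:
  "g \<in> carrier G \<Longrightarrow> x \<in> carrier G \<Longrightarrow> conjugate g x [^] (n::nat) = conjugate g (x [^] n)"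
  by (induction n) (simp_all add: conjugate_mult)

lemma conjugate_inv_cancel [simp]:
  "g \<in> carrier G \<Longrightarrow> x \<in> carrier G \<Longrightarrow> conjugate g (conjugate (inv g) x) = x"
  "g \<in> carrier G \<Longrightarrow> x \<in> carrier G \<Longrightarrow> conjugate (inv g) (conjugate g x) = x"
  by (simp_all add: conjugate_conjugate)

lemma conjugate_inj:
  "g \<in> carrier G \<Longrightarrow> x \<in> carrier G \<Longrightarrow> y \<in> carrier G \<Longrightarrow>
    conjugate g x = conjugate g y \<longleftrightarrow> x = y"
  by (metis conjugate_inv_cancel(2))

lemma conjugate_eq_iff:
  "g \<in> carrier G \<Longrightarrow> x \<in> carrier G \<Longrightarrow> y \<in> carrier G \<Longrightarrow>
    conjugate g x = y \<longleftrightarrow> g \<otimes> x = y \<otimes> g"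
  by (metis conjugate_def inv_solve_right m_closed)

lemma commute_conjugate:
  "g \<in> carrier G \<Longrightarrow> x \<in> carrier G \<Longrightarrow> y \<in> carrier G \<Longrightarrow> x \<otimes> y = y \<otimes> x \<Longrightarrow>
    conjugate g x \<otimes> conjugate g y = conjugate g y \<otimes> conjugate g x"
  by (simp add: conjugate_mult)

lemma subgroup_conjugate:
  assumes "subgroup H G" "g \<in> carrier G"
  shows "subgroup (conjugate g ` H) G"
proof (rule subgroupI)
  show "conjugate g ` H \<subseteq> carrier G"
    using assms subgroup.mem_carrier by fastforce
  show "conjugate g ` H \<noteq> {}"
    using assms(1) subgroup.one_closed by blast
  show "inv a \<in> conjugate g ` H" if "a \<in> conjugate g ` H" for a
    using that assms conjugate_inv subgroup.m_inv_closed subgroup.mem_carrier by fastforce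
  show "a \<otimes> b \<in> conjugate g ` H" if "a \<in> conjugate g ` H" "b \<in> conjugate g ` H" for a b
    using that assms conjugate_mult subgroup.m_closed subgroup.mem_carrier
    by (smt (verit, best) imageE imageI)
qed

lemma subgroup_centralizer_of:
  assumes "x \<in> carrier G"
  shows "subgroup (centralizer_of x) G"
proof (rule subgroupI)
  show "inv a \<in> centralizer_of x" if "a \<in> centralizer_of x" for a
    using that assms unfolding centralizer_of_def
    by simp (metis inv_closed inv_cancel_left(2) inv_solve_right' m_assoc m_closed)
  show "a \<otimes> b \<in> centralizer_of x" if "a \<in> centralizer_of x" "b \<in> centralizer_of x" for a b
    using that assms unfolding centralizer_of_def
    by simp (metis m_assoc)
qed (use assms in \<open>auto simp: centralizer_of_def\<close>)

end

section \<open>Groups with a split BN-pair of rank one\<close>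

text \<open>The structure shared by rank one groups of Lie type: a unipotent group \<open>Q\<close>, a torus \<open>K\<close> normalizing
  it, and an involution \<open>t\<close> representing the nontrivial Weyl group element. The assumption on
  \<open>t u t\<close> is the BN-pair axiom: it makes \<open>B \<union> B t Q\<close> closed under multiplication, and then the group
  acts doubly transitively on the cosets of \<open>B = Q K\<close>. Stabilizers of two points are conjugates of
  \<open>K\<close>; freeness of \<open>K\<close> on \<open>Q\<close> says that no nontrivial element fixes three points, so this is a Zassenhaus
  group. That \<open>K\<close> has no involutions is the extra feature of the Suzuki groups that keeps the
  centralizer of an element of \<open>K\<close> inside \<open>K\<close>.\<close>

locale split_bn_group = group G for G (structure) +
  fixes Q K :: "'a set" and t :: 'a
  assumes finite_carrier: "finite (carrier G)"
    and subgroup_Q: "subgroup Q G" and subgroup_K: "subgroup K G"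
    and Q_nontrivial: "Q \<noteq> {\<one>}"
    and Q_Int_K: "Q \<inter> K = {\<one>}"
    and K_commute: "k \<in> K \<Longrightarrow> l \<in> K \<Longrightarrow> k \<otimes> l = l \<otimes> k"
    and K_normalizes_Q: "k \<in> K \<Longrightarrow> u \<in> Q \<Longrightarrow> conjugate k u \<in> Q"
    and K_acts_freely_on_Q: "k \<in> K \<Longrightarrow> u \<in> Q \<Longrightarrow> conjugate k u = u \<Longrightarrow> k = \<one> \<or> u = \<one>"
    and K_no_involution: "k \<in> K \<Longrightarrow> k \<otimes> k = \<one> \<Longrightarrow> k = \<one>"
    and t_closed [simp]: "t \<in> carrier G" and t_involution [simp]: "t \<otimes> t = \<one>"
    and t_inverts_K: "k \<in> K \<Longrightarrow> t \<otimes> k \<otimes> t = inv k"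
    and t_notin_QK: "u \<in> Q \<Longrightarrow> k \<in> K \<Longrightarrow> t \<noteq> u \<otimes> k"
    and t_Q_t: "u \<in> Q \<Longrightarrow> u \<noteq> \<one> \<Longrightarrow> \<exists>v\<in>Q. \<exists>k\<in>K. \<exists>w\<in>Q. t \<otimes> u \<otimes> t = v \<otimes> k \<otimes> t \<otimes> w"
    and carrier_generated: "carrier G = generate G (Q \<union> K \<union> {t})"
begin

definition B :: "'a set" where "B = {u \<otimes> k | u k. u \<in> Q \<and> k \<in> K}"

lemma Q_closed [simp]: "u \<in> Q \<Longrightarrow> u \<in> carrier G"
  and K_closed [simp]: "k \<in> K \<Longrightarrow> k \<in> carrier G"
  and Q_ops [simp]: "\<one> \<in> Q" "u \<in> Q \<Longrightarrow> inv u \<in> Q" "u \<in> Q \<Longrightarrow> v \<in> Q \<Longrightarrow> u \<otimes> v \<in> Q"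
  and K_ops [simp]: "\<one> \<in> K" "k \<in> K \<Longrightarrow> inv k \<in> K" "k \<in> K \<Longrightarrow> l \<in> K \<Longrightarrow> k \<otimes> l \<in> K"
  using subgroup_Q subgroup_K subgroup.mem_carrier subgroup.one_closed subgroup.m_inv_closed
    subgroup.m_closed by metis+

lemma inv_t [simp]: "inv t = t"
  by (simp add: inv_equality)

lemma t_cancel [simp]: "x \<in> carrier G \<Longrightarrow> t \<otimes> (t \<otimes> x) = x"
  by (simp add: m_assoc [symmetric])

lemma t_K: "k \<in> K \<Longrightarrow> t \<otimes> k = inv k \<otimes> t"
  using t_inverts_K by (metis K_closed inv_closed inv_t inv_solve_right m_closed t_closed)

lemma subgroup_B: "subgroup B G"
proof (rule subgroupI)
  show "B \<subseteq> carrier G" unfolding B_def by auto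
  show "B \<noteq> {}" unfolding B_def using Q_ops(1) K_ops(1) by blast
  fix a assume "a \<in> B"
  then obtain u k where a: "a = u \<otimes> k" "u \<in> Q" "k \<in> K" unfolding B_def by auto
  have "inv a = conjugate (inv k) (inv u) \<otimes> inv k"
    using a by (simp add: word_simps)
  thus "inv a \<in> B" unfolding B_def using a K_normalizes_Q by force
  fix b assume "b \<in> B"
  then obtain v l where b: "b = v \<otimes> l" "v \<in> Q" "l \<in> K" unfolding B_def by auto
  have "a \<otimes> b = (u \<otimes> conjugate k v) \<otimes> (k \<otimes> l)"
    using a b by (simp add: word_simps)
  thus "a \<otimes> b \<in> B" unfolding B_def using a b K_normalizes_Q by force
qed

lemma B_ops [simp]: "\<one> \<in> B" "b \<in> B \<Longrightarrow> inv b \<in> B" "b \<in> B \<Longrightarrow> c \<in> B \<Longrightarrow> b \<otimes> c \<in> B"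
  and B_closed [simp]: "b \<in> B \<Longrightarrow> b \<in> carrier G"
  using subgroup_B subgroup.mem_carrier subgroup.one_closed subgroup.m_inv_closed
    subgroup.m_closed by metis+

lemma Q_in_B [simp]: "u \<in> Q \<Longrightarrow> u \<in> B" and K_in_B [simp]: "k \<in> K \<Longrightarrow> k \<in> B"
proof -
  show "u \<in> B" if "u \<in> Q"
    unfolding B_def using that K_ops(1) by (intro CollectI exI[of _ u] exI[of _ "\<one>"]) simp
  show "k \<in> B" if "k \<in> K"
    unfolding B_def using that Q_ops(1) by (intro CollectI exI[of _ k] exI[of _ "\<one>"]) simp
qed

lemma t_notin_B: "t \<notin> B"
  unfolding B_def using t_notin_QK by auto

lemma B_conj_iff:
  "b \<in> B \<Longrightarrow> x \<in> carrier G \<Longrightarrow> conjugate b x \<in> B \<longleftrightarrow> x \<in> B"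
  by (metis B_closed B_ops(2,3) conjugate_def conjugate_inv_cancel(2))

lemma B_mult_iff:
  "b \<in> B \<Longrightarrow> x \<in> carrier G \<Longrightarrow> b \<otimes> x \<in> B \<longleftrightarrow> x \<in> B"
  "b \<in> B \<Longrightarrow> x \<in> carrier G \<Longrightarrow> x \<otimes> b \<in> B \<longleftrightarrow> x \<in> B"
  by (metis B_closed B_ops(2,3) inv_cancel_left(1))
     (metis B_closed B_ops(2,3) inv_solve_right m_closed)

lemma t_Q_t_notin_B:
  assumes "u \<in> Q" "t \<otimes> u \<otimes> t \<in> B"
  shows "u = \<one>"
proof (rule ccontr)
  assume "u \<noteq> \<one>"
  then obtain v k w where "v \<in> Q" "k \<in> K" "w \<in> Q" "t \<otimes> u \<otimes> t = v \<otimes> k \<otimes> t \<otimes> w"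
    using t_Q_t assms by blast
  thus False
    using assms t_notin_B by (simp add: B_mult_iff)
qed

lemma t_B_t: "b \<in> B \<Longrightarrow> t \<otimes> b \<otimes> t \<in> B \<Longrightarrow> b \<in> K"
proof -
  assume b: "b \<in> B" "t \<otimes> b \<otimes> t \<in> B"
  then obtain u k where a: "b = u \<otimes> k" "u \<in> Q" "k \<in> K" unfolding B_def by auto
  have "t \<otimes> b \<otimes> t = (t \<otimes> u \<otimes> t) \<otimes> (t \<otimes> k \<otimes> t)"
    using a by (simp add: m_assoc)
  also have "\<dots> = (t \<otimes> u \<otimes> t) \<otimes> inv k" using a t_inverts_K by simp
  finally have "t \<otimes> u \<otimes> t \<in> B" using b a B_mult_iff by simp
  hence "u = \<one>" using t_Q_t_notin_B a by simp
  thus ?thesis using a by simp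
qed

definition big_cell :: "'a set" where
  "big_cell = {u \<otimes> k \<otimes> t \<otimes> v | u k v. u \<in> Q \<and> k \<in> K \<and> v \<in> Q}"

lemma big_cellI:
  "x = u \<otimes> k \<otimes> t \<otimes> v \<Longrightarrow> u \<in> Q \<Longrightarrow> k \<in> K \<Longrightarrow> v \<in> Q \<Longrightarrow> x \<in> B \<union> big_cell"
  unfolding big_cell_def by blast

lemma Q_mult_cells:
  assumes "u \<in> Q" "x \<in> B \<union> big_cell"
  shows "u \<otimes> x \<in> B \<union> big_cell"
proof (cases "x \<in> B")
  case False
  then obtain v k w where "x = v \<otimes> k \<otimes> t \<otimes> w" "v \<in> Q" "k \<in> K" "w \<in> Q"
    using assms unfolding big_cell_def by blast
  hence "u \<otimes> x = (u \<otimes> v) \<otimes> k \<otimes> t \<otimes> w" using assms by (simp add: m_assoc)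
  thus ?thesis by (rule big_cellI) (use assms \<open>v \<in> Q\<close> \<open>k \<in> K\<close> \<open>w \<in> Q\<close> in auto)
qed (use assms in simp)

lemma K_mult_cells:
  assumes "l \<in> K" "x \<in> B \<union> big_cell"
  shows "l \<otimes> x \<in> B \<union> big_cell"
proof (cases "x \<in> B")
  case False
  then obtain v k w where x: "x = v \<otimes> k \<otimes> t \<otimes> w" "v \<in> Q" "k \<in> K" "w \<in> Q"
    using assms unfolding big_cell_def by blast
  hence "l \<otimes> x = conjugate l v \<otimes> (l \<otimes> k) \<otimes> t \<otimes> w" using assms by (simp add: word_simps)
  thus ?thesis by (rule big_cellI) (use assms x K_normalizes_Q in auto)
qed (use assms in simp)

text \<open>The step in which the BN-pair axiom is used: for \<open>v \<noteq> 1\<close> the factor \<open>t v t\<close> is put back into the big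
  cell, and for \<open>v = 1\<close> the two copies of \<open>t\<close> cancel.\<close>
lemma t_mult_cells:
  assumes "x \<in> B \<union> big_cell"
  shows "t \<otimes> x \<in> B \<union> big_cell"
proof (cases "x \<in> B")
  case True
  then obtain u k where x: "x = u \<otimes> k" "u \<in> Q" "k \<in> K" unfolding B_def by blast
  have "t \<otimes> x = (t \<otimes> k) \<otimes> conjugate (inv k) u"
    using x by (simp add: word_simps)
  also have "\<dots> = \<one> \<otimes> inv k \<otimes> t \<otimes> conjugate (inv k) u"
    using x by (simp add: t_K)
  finally show ?thesis by (rule big_cellI) (use x K_normalizes_Q in auto)
next
  case False
  then obtain v k w where x: "x = v \<otimes> k \<otimes> t \<otimes> w" "v \<in> Q" "k \<in> K" "w \<in> Q"
    using assms unfolding big_cell_def by blast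
  have "t \<otimes> x = (t \<otimes> v \<otimes> t) \<otimes> (t \<otimes> k \<otimes> t) \<otimes> w" using x by (simp add: m_assoc)
  also have "\<dots> = (t \<otimes> v \<otimes> t) \<otimes> inv k \<otimes> w" using x t_inverts_K by simp
  finally have *: "t \<otimes> x = (t \<otimes> v \<otimes> t) \<otimes> inv k \<otimes> w" .
  show ?thesis
  proof (cases "v = \<one>")
    case True
    thus ?thesis using * x by simp
  next
    case False
    then obtain v' k' w' where y: "t \<otimes> v \<otimes> t = v' \<otimes> k' \<otimes> t \<otimes> w'" "v' \<in> Q" "k' \<in> K" "w' \<in> Q"
      using t_Q_t x by blast
    have "t \<otimes> x = v' \<otimes> k' \<otimes> (t \<otimes> inv k) \<otimes> (conjugate k w' \<otimes> w)"
      unfolding * y(1) using x y by (simp add: word_simps)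
    also have "\<dots> = v' \<otimes> (k' \<otimes> k) \<otimes> t \<otimes> (conjugate k w' \<otimes> w)"
      using x y by (simp add: t_K m_assoc)
    finally show ?thesis by (rule big_cellI) (use x y K_normalizes_Q in auto)
  qed
qed

lemma bruhat: "carrier G = B \<union> big_cell"
proof
  show "B \<union> big_cell \<subseteq> carrier G"
    unfolding big_cell_def by auto
  have *: "h \<otimes> x \<in> B \<union> big_cell" if "h \<in> generate G (Q \<union> K \<union> {t})" "x \<in> B \<union> big_cell" for h x
    using that
  proof (induction arbitrary: x rule: generate.induct)
    case one
    thus ?case using \<open>B \<union> big_cell \<subseteq> carrier G\<close> by auto
  next
    case (incl h)
    thus ?case using Q_mult_cells K_mult_cells t_mult_cells by blast
  next
    case (inv h)
    thus ?case using Q_mult_cells[of "inv h" x] K_mult_cells[of "inv h" x] t_mult_cells[of x] by auto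
  next
    case (eng h1 h2)
    hence "h1 \<otimes> (h2 \<otimes> x) \<in> B \<union> big_cell" by blast
    thus ?case using eng \<open>B \<union> big_cell \<subseteq> carrier G\<close> carrier_generated
      by (metis m_assoc subsetD)
  qed
  show "carrier G \<subseteq> B \<union> big_cell"
    using *[of _ \<one>] carrier_generated by (metis B_ops(1) UnI1 r_one subsetI)
qed

lemma not_in_B_cases:
  assumes "g \<in> carrier G" "g \<notin> B"
  obtains b u where "b \<in> B" "u \<in> Q" "g = b \<otimes> t \<otimes> u"
proof -
  obtain u k v where "u \<in> Q" "k \<in> K" "v \<in> Q" "g = (u \<otimes> k) \<otimes> t \<otimes> v"
    using assms bruhat unfolding big_cell_def by blast
  thus ?thesis using that[of "u \<otimes> k" v] by simp
qed

lemma inj_on_Q_K: "inj_on (\<lambda>(u, k). u \<otimes> k) (Q \<times> K)"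
proof (rule inj_onI, clarify)
  fix u k v l assume a: "u \<in> Q" "k \<in> K" "v \<in> Q" "l \<in> K" "u \<otimes> k = v \<otimes> l"
  have "inv v \<otimes> u = inv v \<otimes> (u \<otimes> k) \<otimes> inv k" using a(1-4) by (simp add: m_assoc)
  also have "\<dots> = l \<otimes> inv k" unfolding a(5) using a(1-4) by (simp add: m_assoc)
  finally have "inv v \<otimes> u \<in> Q \<inter> K" using a by (metis IntI K_ops(2,3) Q_ops(2,3))
  hence "inv v \<otimes> u = \<one>" using Q_Int_K by blast
  hence "u = v" using a by (metis Q_closed Q_ops(2) inv_equality inv_inv)
  thus "u = v \<and> k = l" using a by simp
qed

lemma B_eq_image: "B = (\<lambda>(u, k). u \<otimes> k) ` (Q \<times> K)"
  unfolding B_def by auto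

lemma card_B_eq: "card B = card Q * card K"
  unfolding B_eq_image using card_image[OF inj_on_Q_K] by (simp add: card_cartesian_product)

text \<open>The parametrization \<open>u k t v\<close> of the big cell is injective, since \<open>b t v = c t w\<close> puts
  \<open>t (w v\<inverse>) t\<close> into \<open>B\<close>, which forces \<open>w = v\<close>.\<close>

lemma order_eq: "order G = card Q * card K * (card Q + 1)"
proof -
  have fin: "finite Q" "finite K"
    using finite_carrier Q_closed K_closed by (meson finite_subset subsetI)+
  have "inj_on (\<lambda>(b, v). b \<otimes> t \<otimes> v) (B \<times> Q)"
  proof (rule inj_onI, clarify)
    fix b v c w assume a: "b \<in> B" "v \<in> Q" "c \<in> B" "w \<in> Q" "b \<otimes> t \<otimes> v = c \<otimes> t \<otimes> w"
    have "inv c \<otimes> b = inv c \<otimes> (b \<otimes> t \<otimes> v) \<otimes> inv v \<otimes> t"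
      using a(1-4) by (simp add: m_assoc)
    also have "\<dots> = inv c \<otimes> (c \<otimes> t \<otimes> w) \<otimes> inv v \<otimes> t" unfolding a(5) ..
    also have "\<dots> = t \<otimes> (w \<otimes> inv v) \<otimes> t" using a(1-4)
      by (simp add: m_assoc)
    finally have "t \<otimes> (w \<otimes> inv v) \<otimes> t \<in> B" using a by (metis B_ops(2,3))
    hence "w \<otimes> inv v = \<one>" using t_Q_t_notin_B a by simp
    hence "v = w" using a by (metis Q_closed Q_ops(2) inv_equality inv_inv)
    thus "b = c \<and> v = w" using a by simp
  qed
  moreover have "big_cell = (\<lambda>(b, v). b \<otimes> t \<otimes> v) ` (B \<times> Q)"
    unfolding B_def big_cell_def by force
  ultimately have cC: "card big_cell = card B * card Q"
    by (simp add: card_image card_cartesian_product)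
  have "B \<inter> big_cell = {}"
  proof (rule ccontr)
    assume "B \<inter> big_cell \<noteq> {}"
    then obtain u k v where "u \<in> Q" "k \<in> K" "v \<in> Q" "u \<otimes> k \<otimes> t \<otimes> v \<in> B"
      unfolding big_cell_def by blast
    thus False using t_notin_B by (simp add: B_mult_iff)
  qed
  moreover have "finite B" "finite big_cell" using bruhat finite_carrier by auto
  ultimately have "order G = card B + card big_cell"
    unfolding order_def bruhat by (intro card_Un_disjoint)
  thus ?thesis using card_B_eq cC by (simp add: algebra_simps)
qed

lemma card_B: "card B * (card Q + 1) = order G"
  using order_eq card_B_eq by simp

text \<open>A nontrivial element of \<open>Q\<close> fixes only the base point of the action on the cosets of \<open>B\<close>. So distinct
  conjugates of \<open>Q\<close> intersect trivially.\<close>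

lemma Q_TI:
  assumes "u \<in> Q" "u \<noteq> \<one>" "g \<in> carrier G" "conjugate g u \<in> B"
  shows "g \<in> B"
proof (rule ccontr)
  assume "g \<notin> B"
  then obtain b v where g: "b \<in> B" "v \<in> Q" "g = b \<otimes> t \<otimes> v"
    using assms not_in_B_cases by metis
  have "conjugate g u = conjugate b (t \<otimes> conjugate v u \<otimes> t)"
    using g assms by (simp add: word_simps)
  hence "t \<otimes> conjugate v u \<otimes> t \<in> B" using assms g B_conj_iff by simp
  hence "conjugate v u = \<one>"
    using g assms by (intro t_Q_t_notin_B) (simp_all add: conjugate_def)
  thus False using assms g conjugate_inj[of v u \<one>] by simp
qed

lemma B_normalizes_Q:
  assumes "b \<in> B" "u \<in> Q"
  shows "conjugate b u \<in> Q"
proof -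
  obtain v k where b: "b = v \<otimes> k" "v \<in> Q" "k \<in> K" using assms unfolding B_def by blast
  have "conjugate b u = v \<otimes> conjugate k u \<otimes> inv v"
    using assms b by (simp add: word_simps)
  thus ?thesis using assms b K_normalizes_Q by simp
qed

text \<open>For \<open>k \<noteq> 1\<close> the map \<open>s \<mapsto> s k s\<inverse> k\<inverse>\<close> on \<open>Q\<close> is injective because \<open>k\<close> acts freely; as \<open>Q\<close> is
  finite it is onto, so every element of the coset \<open>Q k\<close> is conjugate to \<open>k\<close> under \<open>Q\<close>.\<close>

lemma B_minus_Q_conj_K:
  assumes "b \<in> B" "b \<notin> Q"
  obtains v k where "v \<in> Q" "k \<in> K" "k \<noteq> \<one>" "b = conjugate v k"
proof -
  obtain u k where b: "b = u \<otimes> k" "u \<in> Q" "k \<in> K" using assms unfolding B_def by blast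
  have k1: "k \<noteq> \<one>" using assms b by auto
  define f where "f s = s \<otimes> conjugate k (inv s)" for s
  have "inj_on f Q"
  proof (rule inj_onI)
    fix s r assume a: "s \<in> Q" "r \<in> Q" "f s = f r"
    have "inv r \<otimes> f s \<otimes> k \<otimes> s = inv r \<otimes> s \<otimes> k"
      using a(1,2) b unfolding f_def by (simp add: word_simps)
    moreover have "inv r \<otimes> f r \<otimes> k \<otimes> s = k \<otimes> (inv r \<otimes> s)"
      using a(1,2) b unfolding f_def by (simp add: word_simps)
    ultimately have "k \<otimes> (inv r \<otimes> s) = (inv r \<otimes> s) \<otimes> k" using a by simp
    hence "conjugate k (inv r \<otimes> s) = inv r \<otimes> s" using a b by (simp add: conjugate_eq_iff)
    hence "inv r \<otimes> s = \<one>" using K_acts_freely_on_Q a b k1 by (metis Q_ops(2,3))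
    thus "s = r" using a by (metis Q_closed Q_ops(2) inv_equality inv_inv)
  qed
  moreover have "f ` Q \<subseteq> Q" unfolding f_def using b K_normalizes_Q by auto
  moreover have "finite Q" using finite_carrier Q_closed by (meson finite_subset subsetI)
  ultimately have "f ` Q = Q" by (simp add: endo_inj_surj)
  then obtain s where "s \<in> Q" "u = f s" using b by blast
  hence "b = conjugate s k" using b unfolding f_def by (simp add: word_simps)
  thus ?thesis using that \<open>s \<in> Q\<close> b k1 by blast
qed

text \<open>A nontrivial element \<open>k\<close> of \<open>K\<close> fixes exactly two points, the base point and its image under \<open>t\<close>.\<close>

lemma conjugate_K_in_B:
  assumes "k \<in> K" "k \<noteq> \<one>" "g \<in> carrier G" "conjugate g k \<in> B" "g \<notin> B"
  shows "\<exists>b\<in>B. g = b \<otimes> t"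
proof -
  obtain b u where g: "b \<in> B" "u \<in> Q" "g = b \<otimes> t \<otimes> u"
    using assms not_in_B_cases by metis
  let ?v = "u \<otimes> conjugate k (inv u)"
  have v: "?v \<in> Q" using g assms K_normalizes_Q by simp
  have "conjugate g k = conjugate b (t \<otimes> conjugate u k \<otimes> t)"
    using g assms by (simp add: word_simps)
  hence "t \<otimes> conjugate u k \<otimes> t \<in> B" using assms g B_conj_iff by simp
  moreover have "t \<otimes> conjugate u k \<otimes> t = (t \<otimes> ?v \<otimes> t) \<otimes> (t \<otimes> k \<otimes> t)"
    using g assms by (simp add: word_simps)
  ultimately have "(t \<otimes> ?v \<otimes> t) \<otimes> inv k \<in> B" using assms t_inverts_K by simp
  hence "t \<otimes> ?v \<otimes> t \<in> B" using assms v B_mult_iff(2)[of "inv k"] by simp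
  hence "?v = \<one>" using t_Q_t_notin_B v by simp
  hence "conjugate k (inv u) = inv u"
    using g assms inv_equality[of "conjugate k (inv u)" u] inv_comm[of u "conjugate k (inv u)"] by simp
  hence "inv u = \<one>" using K_acts_freely_on_Q[of k "inv u"] assms g by simp
  hence "u = \<one>" using g by (metis Q_closed inv_inv inv_one)
  hence "g = b \<otimes> t" using g by simp
  thus ?thesis using g by blast
qed

text \<open>The centralizer permutes the two fixed points of \<open>k\<close>. An element fixing both lies in \<open>K\<close>; one that
  swapped them would have the form \<open>b t\<close> with \<open>b\<close> in \<open>K\<close> and would invert \<open>k\<close>, making \<open>k\<close> an involution.\<close>

lemma centralizer_of_K:
  assumes "k \<in> K" "k \<noteq> \<one>"
  shows "centralizer_of k = K"
proof
  show "K \<subseteq> centralizer_of k"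
    unfolding centralizer_of_def using assms K_commute by auto
  show "centralizer_of k \<subseteq> K"
  proof
    fix g assume "g \<in> centralizer_of k"
    hence g: "g \<in> carrier G" "k \<otimes> g = g \<otimes> k" unfolding centralizer_of_def by auto
    have c: "conjugate g k = k" using g assms by (simp add: conjugate_eq_iff)
    have "conjugate (t \<otimes> g) k = conjugate t k"
      using g assms c conjugate_conjugate[of t g k] by simp
    hence tc: "conjugate (t \<otimes> g) k \<in> B"
      using assms t_inverts_K by (simp add: conjugate_def)
    consider "g \<in> B" | b where "b \<in> B" "g = b \<otimes> t"
      using conjugate_K_in_B[OF assms g(1)] c assms by auto
    thus "g \<in> K"
    proof cases
      case 1
      have "t \<otimes> g \<notin> B" using 1 t_notin_B by (simp add: B_mult_iff)
      then obtain b where "b \<in> B" "t \<otimes> g = b \<otimes> t"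
        using conjugate_K_in_B[OF assms _ tc] g by auto
      hence "t \<otimes> g \<otimes> t \<in> B" by (simp add: m_assoc)
      thus ?thesis using 1 t_B_t by simp
    next
      case 2
      show ?thesis
      proof (cases "t \<otimes> g \<in> B")
        case True
        hence "b \<in> K" using 2 t_B_t by (simp add: m_assoc)
        have "g \<otimes> k = b \<otimes> (t \<otimes> k)"
          using 2 assms by (simp add: m_assoc)
        also have "\<dots> = b \<otimes> inv k \<otimes> t" using 2 assms by (simp add: t_K m_assoc)
        also have "\<dots> = inv k \<otimes> g"
          using K_commute[of b "inv k"] \<open>b \<in> K\<close> 2 assms by (simp add: m_assoc)
        finally have "k \<otimes> g = inv k \<otimes> g" using g by simp
        hence "k = inv k" using g assms by simp
        hence "k \<otimes> k = \<one>" using assms by (metis K_closed r_inv)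
        thus ?thesis using K_no_involution assms by blast
      next
        case False
        then obtain b' where "b' \<in> B" "t \<otimes> g = b' \<otimes> t"
          using conjugate_K_in_B[OF assms _ tc] g by auto
        hence "t \<otimes> b \<in> B" using 2
          by (metis B_closed m_assoc m_closed r_one t_closed t_involution)
        thus ?thesis using 2 t_notin_B by (simp add: B_mult_iff)
      qed
    qed
  qed
qed

definition conj_to_Q :: "'a \<Rightarrow> bool" where
  "conj_to_Q x \<longleftrightarrow> (\<exists>g\<in>carrier G. x \<in> conjugate g ` Q)"

text \<open>Elements without a fixed point on the cosets of \<open>B\<close>.\<close>

definition fpf :: "'a \<Rightarrow> bool" where
  "fpf x \<longleftrightarrow> x \<in> carrier G \<and> (\<forall>g\<in>carrier G. x \<notin> conjugate g ` B)"

lemma fpf_not_conj_to_Q: "fpf x \<Longrightarrow> \<not> conj_to_Q x"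
  unfolding fpf_def conj_to_Q_def by auto

text \<open>An element outside the conjugates of \<open>Q\<close> has either no or exactly two fixed points.\<close>

lemma not_conj_to_Q_cases:
  assumes "x \<in> carrier G" "\<not> conj_to_Q x"
  obtains "fpf x" | g k where "g \<in> carrier G" "k \<in> K" "k \<noteq> \<one>" "x = conjugate g k"
proof (cases "fpf x")
  case False
  then obtain g b where g: "g \<in> carrier G" "b \<in> B" "x = conjugate g b"
    using assms unfolding fpf_def by blast
  hence "b \<notin> Q" using assms unfolding conj_to_Q_def by blast
  then obtain v k where "v \<in> Q" "k \<in> K" "k \<noteq> \<one>" "b = conjugate v k"
    using B_minus_Q_conj_K g by metis
  thus ?thesis using that(2)[of "g \<otimes> v" k] g conjugate_conjugate by simp
qed (use that in blast)

lemma commute_not_conj_to_Q: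
  assumes "x \<in> carrier G" "\<not> conj_to_Q x" "y \<in> centralizer_of x" "y \<noteq> \<one>"
  shows "\<not> conj_to_Q y"
proof
  assume "conj_to_Q y"
  then obtain g u where y: "g \<in> carrier G" "u \<in> Q" "y = conjugate g u"
    unfolding conj_to_Q_def by blast
  let ?x = "conjugate (inv g) x"
  have u1: "u \<noteq> \<one>" using y assms by auto
  have "conjugate (inv g) y = u" using y by simp
  moreover have "?x \<otimes> conjugate (inv g) y = conjugate (inv g) y \<otimes> ?x"
    using assms y unfolding centralizer_of_def by (intro commute_conjugate) auto
  ultimately have xu: "?x \<otimes> u = u \<otimes> ?x" by simp
  hence "conjugate ?x u = u" using y assms by (simp add: conjugate_eq_iff)
  hence xB: "?x \<in> B" using Q_TI[of u ?x] y u1 assms by simp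
  have "x = conjugate g ?x" using y assms by simp
  hence "?x \<notin> Q" using assms y unfolding conj_to_Q_def by blast
  then obtain v k where v: "v \<in> Q" "k \<in> K" "k \<noteq> \<one>" "?x = conjugate v k"
    using B_minus_Q_conj_K xB by metis
  let ?u = "conjugate (inv v) u"
  have "conjugate (inv v) ?x \<otimes> ?u = ?u \<otimes> conjugate (inv v) ?x"
    using xu v y assms by (intro commute_conjugate) auto
  hence "conjugate k ?u = ?u" using v y by (simp add: conjugate_eq_iff)
  moreover have "?u \<in> Q" using v y by (simp add: conjugate_def)
  ultimately have "?u = \<one>" using K_acts_freely_on_Q v by blast
  thus False using u1 v y conjugate_inj[of "inv v" u \<one>] by simp
qed

lemma commute_fpf:
  assumes "fpf x" "y \<in> centralizer_of x" "y \<noteq> \<one>"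
  shows "fpf y"
proof -
  have x: "x \<in> carrier G" using assms unfolding fpf_def by simp
  have y: "y \<in> carrier G" "x \<otimes> y = y \<otimes> x" using assms unfolding centralizer_of_def by auto
  have "\<not> conj_to_Q y"
    using commute_not_conj_to_Q[OF x fpf_not_conj_to_Q] assms by blast
  with y(1) show ?thesis
  proof (cases rule: not_conj_to_Q_cases)
    case (2 g k)
    have "conjugate (inv g) x \<otimes> conjugate (inv g) y = conjugate (inv g) y \<otimes> conjugate (inv g) x"
      using x y 2 by (intro commute_conjugate) auto
    hence "conjugate (inv g) x \<in> centralizer_of k"
      using 2 x unfolding centralizer_of_def by simp
    hence "conjugate (inv g) x \<in> B" using 2 centralizer_of_K by simp
    moreover have "x = conjugate g (conjugate (inv g) x)" using 2 x by simp
    ultimately show ?thesis using assms 2 unfolding fpf_def by blast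
  qed
qed

text \<open>The centralizer \<open>H\<close> of \<open>x\<close> acts freely on the \<open>|Q| + 1\<close> cosets of \<open>B\<close>, because its nontrivial elements
  have no fixed points either. In terms of double cosets: every \<open>H g B\<close> has \<open>|H| |B|\<close> elements, hence
  \<open>|H|\<close> divides \<open>|Q| + 1\<close>.\<close>

lemma fpf_pow_card_Q:
  assumes "fpf x"
  shows "x [^] (card Q + 1) = \<one>"
proof -
  have x: "x \<in> carrier G" using assms unfolding fpf_def by simp
  let ?H = "centralizer_of x"
  interpret H: subgroup ?H G using subgroup_centralizer_of x by simp
  have finH: "finite ?H" and finB: "finite B"
    using finite_carrier finite_subset H.subset by (blast, meson B_closed finite_subset subsetI)
  define D where "D g = (\<lambda>(h, b). h \<otimes> g \<otimes> b) ` (?H \<times> B)" for g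
  have inj: "inj_on (\<lambda>(h, b). h \<otimes> g \<otimes> b) (?H \<times> B)" if g: "g \<in> carrier G" for g
  proof (rule inj_onI, clarify)
    fix h b h' b' assume a: "h \<in> ?H" "b \<in> B" "h' \<in> ?H" "b' \<in> B" "h \<otimes> g \<otimes> b = h' \<otimes> g \<otimes> b'"
    have "inv h' \<otimes> h = inv h' \<otimes> (h \<otimes> g \<otimes> b) \<otimes> inv b \<otimes> inv g"
      using a(1-4) g by (simp add: m_assoc)
    also have "\<dots> = conjugate g (b' \<otimes> inv b)"
      unfolding a(5) using a(1-4) g by (simp add: word_simps)
    finally have *: "inv h' \<otimes> h = conjugate g (b' \<otimes> inv b)" .
    have "inv h' \<otimes> h = \<one>"
    proof (rule ccontr)
      assume "inv h' \<otimes> h \<noteq> \<one>"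
      hence "fpf (inv h' \<otimes> h)" using commute_fpf[OF assms] a by simp
      thus False using * a g unfolding fpf_def by auto
    qed
    hence "h = h'" using a by (metis H.mem_carrier H.m_inv_closed inv_equality inv_inv)
    thus "h = h' \<and> b = b'" using a g by simp
  qed
  have DI: "h \<otimes> g \<otimes> b \<in> D g" if "h \<in> ?H" "b \<in> B" for h g b
    unfolding D_def using that by (intro image_eqI[of _ _ "(h, b)"]) auto
  have cD: "card (D g) = card ?H * card B" if "g \<in> carrier G" for g
    unfolding D_def using card_image[OF inj[OF that]] by (simp add: card_cartesian_product)
  have Dsub: "D g \<subseteq> carrier G" if "g \<in> carrier G" for g
    unfolding D_def using that by auto
  have Dmono: "D g \<subseteq> D g'" if gD: "g \<in> D g'" "g' \<in> carrier G" for g g'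
  proof
    fix y assume "y \<in> D g"
    then obtain h b where y: "h \<in> ?H" "b \<in> B" "y = h \<otimes> g \<otimes> b" unfolding D_def by auto
    obtain h' b' where g: "h' \<in> ?H" "b' \<in> B" "g = h' \<otimes> g' \<otimes> b'"
      using gD(1) unfolding D_def by auto
    have "y = (h \<otimes> h') \<otimes> g' \<otimes> (b' \<otimes> b)" using y g gD by (simp add: m_assoc)
    thus "y \<in> D g'" using DI[of "h \<otimes> h'" "b' \<otimes> b" g'] y g by simp
  qed
  have Dsym: "g' \<in> D g" if gD: "g \<in> D g'" "g' \<in> carrier G" for g g'
  proof -
    obtain h' b' where g: "h' \<in> ?H" "b' \<in> B" "g = h' \<otimes> g' \<otimes> b'"
      using gD(1) unfolding D_def by auto
    have "g' = inv h' \<otimes> g \<otimes> inv b'" using g gD by (simp add: m_assoc)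
    thus ?thesis using DI[of "inv h'" "inv b'" g] g by simp
  qed
  have Dself: "g \<in> D g" if "g \<in> carrier G" for g
  proof -
    show ?thesis using DI[of \<one> \<one> g] that by simp
  qed
  have "\<Union> (D ` carrier G) = carrier G" using Dself Dsub by blast
  moreover have "(card ?H * card B) * card (D ` carrier G) = card (\<Union> (D ` carrier G))"
  proof (rule card_partition)
    show "finite (D ` carrier G)" "finite (\<Union> (D ` carrier G))"
      using finite_carrier \<open>\<Union> (D ` carrier G) = carrier G\<close> by auto
    fix c1 c2 assume c: "c1 \<in> D ` carrier G" "c2 \<in> D ` carrier G" "c1 \<noteq> c2"
    then obtain g1 g2 where g: "g1 \<in> carrier G" "c1 = D g1" "g2 \<in> carrier G" "c2 = D g2" by auto
    show "c1 \<inter> c2 = {}"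
    proof (rule ccontr)
      assume "c1 \<inter> c2 \<noteq> {}"
      then obtain y where y: "y \<in> D g1" "y \<in> D g2" using g by auto
      hence "D y = D g1" "D y = D g2" using g Dmono Dsym Dsub by (metis subset_antisym subsetD)+
      thus False using c g by simp
    qed
  qed (use cD in auto)
  ultimately have "(card ?H * card (D ` carrier G)) * card B = (card Q + 1) * card B"
    using card_B unfolding order_def by (simp add: mult_ac)
  moreover have "card B > 0" using finB B_ops(1) card_gt_0_iff by blast
  ultimately have "card ?H dvd card Q + 1" by (metis dvd_triv_left mult_right_cancel neq0_conv)
  then obtain m where m: "card Q + 1 = card ?H * m" by blast
  interpret HG: group "G\<lparr>carrier := ?H\<rparr>" using H.subgroup_is_group is_group by simp
  have xH: "x \<in> ?H" using x unfolding centralizer_of_def by simp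
  have "x [^]\<^bsub>G\<lparr>carrier := ?H\<rparr>\<^esub> order (G\<lparr>carrier := ?H\<rparr>) = \<one>"
    using HG.pow_order_eq_1 xH by simp
  hence "x [^] card ?H = \<one>" unfolding order_def using nat_pow_consistent by simp
  hence "(x [^] card ?H) [^] m = \<one>" by simp
  thus ?thesis using m x by (simp add: nat_pow_pow)
qed

text \<open>The conjugates of \<open>Q\<close> by the elements \<open>u t\<close> with \<open>u\<close> in \<open>Q\<close> are distinct from each other and from \<open>Q\<close>, so
  together they contribute at least \<open>|Q| + |Q| (|Q| - 1)\<close> elements.\<close>

lemma card_conj_to_Q: "card {x \<in> carrier G. conj_to_Q x} \<ge> (card Q)\<^sup>2"
proof -
  have finQ: "finite Q" using finite_carrier Q_closed by (meson finite_subset subsetI)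
  let ?f = "\<lambda>(u, v). conjugate (u \<otimes> t) v"
  let ?A = "?f ` (Q \<times> (Q - {\<one>}))"
  have *: "u = u' \<and> v = v'"
    if a: "u \<in> Q" "v \<in> Q" "u' \<in> Q" "v' \<in> Q" "v \<noteq> \<one>" "v' \<noteq> \<one>"
      "conjugate (u \<otimes> t) v = conjugate (u' \<otimes> t) v'" for u v u' v'
  proof -
    have "conjugate (inv (u' \<otimes> t)) (conjugate (u \<otimes> t) v) = v'"
      using a(1-6) unfolding a(7) by simp
    hence "conjugate (inv (u' \<otimes> t) \<otimes> (u \<otimes> t)) v = v'"
      using a(1-6) by (simp add: conjugate_conjugate)
    moreover have "v' \<in> B" using a(4) by simp
    ultimately have c: "conjugate (inv (u' \<otimes> t) \<otimes> (u \<otimes> t)) v \<in> B" by (rule ssubst)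
    have "inv (u' \<otimes> t) \<otimes> (u \<otimes> t) \<in> B"
      by (rule Q_TI[OF a(2,5) _ c]) (use a(1,3) in simp)
    hence "t \<otimes> (inv u' \<otimes> u) \<otimes> t \<in> B" using a(1-6) by (simp add: word_simps)
    hence "inv u' \<otimes> u = \<one>" using a t_Q_t_notin_B by simp
    hence "u = u'" using a by (metis Q_closed Q_ops(2) inv_equality inv_inv)
    hence "u' = u" "v = v'" using a conjugate_inj[of "u \<otimes> t" v v'] by simp_all
    thus "u = u' \<and> v = v'" by simp
  qed
  have inj: "inj_on ?f (Q \<times> (Q - {\<one>}))"
  proof (rule inj_onI)
    fix p r assume "p \<in> Q \<times> (Q - {\<one>})" "r \<in> Q \<times> (Q - {\<one>})" "?f p = ?f r"
    thus "p = r"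
      using *[of "fst p" "snd p" "fst r" "snd r"]
      by (simp only: case_prod_beta mem_Times_iff prod_eq_iff Diff_iff singleton_iff) blast
  qed
  have "Q \<inter> ?A = {}"
  proof (rule ccontr)
    assume "Q \<inter> ?A \<noteq> {}"
    then obtain u v where "u \<in> Q" "v \<in> Q" "v \<noteq> \<one>" "conjugate (u \<otimes> t) v \<in> Q" by auto
    hence "u \<otimes> t \<in> B" using Q_TI[of v "u \<otimes> t"] by simp
    thus False using t_notin_B \<open>u \<in> Q\<close> by (simp add: B_mult_iff)
  qed
  hence "card (Q \<union> ?A) = card Q + card ?A"
    using finQ by (intro card_Un_disjoint) auto
  also have "card ?A = card Q * (card Q - 1)"
    using card_image[OF inj] finQ by (simp add: card_cartesian_product)
  also have "card Q + card Q * (card Q - 1) = (card Q)\<^sup>2"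
    using finQ Q_ops(1) by (cases "card Q") (auto simp: power2_eq_square)
  finally have "card (Q \<union> ?A) = (card Q)\<^sup>2" .
  moreover have "Q \<union> ?A \<subseteq> {x \<in> carrier G. conj_to_Q x}"
  proof -
    have "conj_to_Q u" if "u \<in> Q" for u
      unfolding conj_to_Q_def using that
      by (intro bexI[of _ \<one>]) (auto intro!: image_eqI[of _ _ u])
    moreover have "conj_to_Q (conjugate (u \<otimes> t) v)" if "u \<in> Q" "v \<in> Q" for u v
      unfolding conj_to_Q_def using that by (intro bexI[of _ "u \<otimes> t"]) auto
    ultimately show ?thesis by auto
  qed
  ultimately show ?thesis
    using finite_carrier card_mono[of "{x \<in> carrier G. conj_to_Q x}" "Q \<union> ?A"] by simp
qed

text \<open>The conjugates of \<open>Q\<close> are disjoint outside the identity by \<open>Q_TI\<close>. All other elements have abelian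
  centralizers, by assumption or because the centralizer is conjugate to \<open>K\<close>, and therefore two such
  centralizers with a common nontrivial element coincide. The involution \<open>t\<close> is not in \<open>Q\<close>, which
  excludes the partition with one component.\<close>

theorem nontrivial_partition:
  assumes comm: "\<And>x y z. fpf x \<Longrightarrow> y \<in> centralizer_of x \<Longrightarrow> z \<in> centralizer_of x \<Longrightarrow> y \<otimes> z = z \<otimes> y"
  shows "has_nontrivial_partition G"
proof -
  have abelian: "y \<otimes> z = z \<otimes> y"
    if x: "x \<in> carrier G" "\<not> conj_to_Q x" and y: "y \<in> centralizer_of x" and z: "z \<in> centralizer_of x"
    for x y z
    using x
  proof (cases rule: not_conj_to_Q_cases)
    case 1
    thus ?thesis using comm y z by blast
  next
    case (2 g k)
    have *: "conjugate (inv g) w \<in> K" if w: "w \<in> centralizer_of x" for w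
    proof -
      have "conjugate (inv g) x \<otimes> conjugate (inv g) w = conjugate (inv g) w \<otimes> conjugate (inv g) x"
        using x w 2 unfolding centralizer_of_def by (intro commute_conjugate) auto
      hence "conjugate (inv g) w \<in> centralizer_of k"
        using 2 w unfolding centralizer_of_def by simp
      thus ?thesis using centralizer_of_K 2 by simp
    qed
    have yz: "y \<in> carrier G" "z \<in> carrier G" using y z unfolding centralizer_of_def by auto
    have "conjugate g (conjugate (inv g) y) \<otimes> conjugate g (conjugate (inv g) z)
      = conjugate g (conjugate (inv g) z) \<otimes> conjugate g (conjugate (inv g) y)"
      by (rule commute_conjugate[OF _ _ _ K_commute[OF *[OF y] *[OF z]]]) (use 2 yz in simp_all)
    thus ?thesis using yz 2 by simp
  qed
  define P where "P = {conjugate g ` Q | g. g \<in> carrier G} \<union>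
    {centralizer_of x | x. x \<in> carrier G \<and> \<not> conj_to_Q x}"
  have one_conj: "conj_to_Q \<one>"
    unfolding conj_to_Q_def by (intro bexI[of _ \<one>]) (auto intro!: image_eqI[of _ _ \<one>])
  have cent_eq: "centralizer_of x = centralizer_of y"
    if "x \<in> carrier G" "\<not> conj_to_Q x" "y \<in> centralizer_of x" "y \<noteq> \<one>" for x y
  proof -
    have y: "y \<in> carrier G" "\<not> conj_to_Q y" "x \<in> centralizer_of y" 
      using that commute_not_conj_to_Q unfolding centralizer_of_def by auto
    have "z \<in> centralizer_of x \<longleftrightarrow> z \<in> centralizer_of y" if "z \<in> carrier G" for z
    proof
      assume z: "z \<in> centralizer_of x"
      show "z \<in> centralizer_of y"
        using abelian[of x y z] z that \<open>x \<in> carrier G\<close> \<open>\<not> conj_to_Q x\<close> \<open>y \<in> centralizer_of x\<close>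
        by (simp add: centralizer_of_def)
    next
      assume z: "z \<in> centralizer_of y"
      show "z \<in> centralizer_of x"
        using abelian[of y x z] z that y by (simp add: centralizer_of_def)
    qed
    thus ?thesis unfolding centralizer_of_def by auto
  qed
  have conj_Q_eq: "conjugate g ` Q = conjugate h ` Q"
    if gh: "g \<in> carrier G" "h \<in> carrier G" and y: "y \<in> conjugate g ` Q" "y \<in> conjugate h ` Q" "y \<noteq> \<one>"
    for g h y
  proof -
    have sub: "conjugate g ` Q \<subseteq> conjugate h ` Q"
      if gh: "g \<in> carrier G" "h \<in> carrier G" and y: "y \<in> conjugate g ` Q" "y \<in> conjugate h ` Q" "y \<noteq> \<one>"
      for g h
    proof -
      obtain u v where uv: "u \<in> Q" "v \<in> Q" "y = conjugate g u" "y = conjugate h v" using y by auto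
      have "conjugate (inv h \<otimes> g) u = conjugate (inv h) (conjugate g u)"
        using uv gh by (simp add: conjugate_conjugate)
      also have "\<dots> = v" using uv gh by (metis Q_closed conjugate_inv_cancel(2))
      finally have "conjugate (inv h \<otimes> g) u \<in> B" using uv by simp
      moreover have "u \<noteq> \<one>" using uv gh y by auto
      ultimately have "inv h \<otimes> g \<in> B"
        using uv gh Q_TI[of u "inv h \<otimes> g"] by simp
      hence *: "conjugate (inv h \<otimes> g) w \<in> Q" if "w \<in> Q" for w
        using that B_normalizes_Q by blast
      show ?thesis
      proof
        fix z assume "z \<in> conjugate g ` Q"
        then obtain w where w: "w \<in> Q" "z = conjugate g w" by auto
        hence "z = conjugate h (conjugate (inv h \<otimes> g) w)"
          using gh by (simp add: conjugate_conjugate inv_cancel_left)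
        thus "z \<in> conjugate h ` Q" using * w by blast
      qed
    qed
    show ?thesis using sub[of g h] sub[of h g] gh y by blast
  qed
  have part: "group_partition G P"
    unfolding group_partition_def
  proof (intro conjI ballI)
    obtain u where "u \<in> Q" "u \<noteq> \<one>" using Q_nontrivial Q_ops(1) by blast
    thus "carrier G \<noteq> {\<one>}" using Q_closed by blast
    fix H assume "H \<in> P"
    thus "subgroup H G"
      unfolding P_def using subgroup_conjugate[OF subgroup_Q] subgroup_centralizer_of by auto
    show "H \<noteq> {\<one>}"
    proof (cases "H \<in> {conjugate g ` Q | g. g \<in> carrier G}")
      case True
      then obtain g where g: "g \<in> carrier G" "H = conjugate g ` Q" by auto
      hence "conjugate g u \<in> H" "conjugate g u \<noteq> \<one>"
        using \<open>u \<in> Q\<close> \<open>u \<noteq> \<one>\<close> conjugate_inj[of g u \<one>] by auto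
      thus ?thesis by blast
    next
      case False
      then obtain x where x: "x \<in> carrier G" "\<not> conj_to_Q x" "H = centralizer_of x"
        using \<open>H \<in> P\<close> unfolding P_def by blast
      hence "x \<in> H" "x \<noteq> \<one>" using one_conj unfolding centralizer_of_def by auto
      thus ?thesis by blast
    qed
  next
    fix x assume "x \<in> carrier G - {\<one>}"
    hence x: "x \<in> carrier G" "x \<noteq> \<one>" by auto
    show "\<exists>!H. H \<in> P \<and> x \<in> H"
    proof (cases "conj_to_Q x")
      case True
      then obtain g where g: "g \<in> carrier G" "x \<in> conjugate g ` Q" unfolding conj_to_Q_def by blast
      show ?thesis
      proof (rule ex1I[of _ "conjugate g ` Q"])
        show "conjugate g ` Q \<in> P \<and> x \<in> conjugate g ` Q" using g unfolding P_def by blast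
        fix H assume H: "H \<in> P \<and> x \<in> H"
        show "H = conjugate g ` Q"
        proof (cases "H \<in> {conjugate g ` Q | g. g \<in> carrier G}")
          case True
          thus ?thesis using H g x conj_Q_eq by blast
        next
          case False
          thus ?thesis using H x \<open>conj_to_Q x\<close> commute_not_conj_to_Q unfolding P_def by blast
        qed
      qed
    next
      case False
      show ?thesis
      proof (rule ex1I[of _ "centralizer_of x"])
        show "centralizer_of x \<in> P \<and> x \<in> centralizer_of x"
          using x False unfolding P_def centralizer_of_def by blast
        fix H assume H: "H \<in> P \<and> x \<in> H"
        hence "H \<notin> {conjugate g ` Q | g. g \<in> carrier G}"
          using False unfolding conj_to_Q_def by blast
        then obtain y where "y \<in> carrier G" "\<not> conj_to_Q y" "H = centralizer_of y"
          using H unfolding P_def by blast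
        thus "H = centralizer_of x" using cent_eq H x by blast
      qed
    qed
  qed
  moreover have "card P \<noteq> 1"
  proof
    assume "card P = 1"
    then obtain H where "P = {H}" by (auto simp: card_1_singleton_iff)
    moreover have "conjugate \<one> ` Q \<in> P" unfolding P_def by blast
    moreover have "conjugate \<one> ` Q = Q" by (simp add: image_def)
    ultimately have "P = {Q}" by simp
    moreover have "t \<noteq> \<one>" using t_notin_B by auto
    ultimately have "t \<in> Q" using part t_closed unfolding group_partition_def by blast
    thus False using t_notin_B by simp
  qed
  ultimately show ?thesis
    unfolding has_nontrivial_partition_def using finite_carrier is_group by blast
qed

end

section \<open>The monoid of square matrices\<close>

lemma (in abelian_monoid) finsum_swap:
  assumes "finite A" "finite B" "\<And>i j. i \<in> A \<Longrightarrow> j \<in> B \<Longrightarrow> f i j \<in> carrier G"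
  shows "(\<Oplus>i\<in>A. \<Oplus>j\<in>B. f i j) = (\<Oplus>j\<in>B. \<Oplus>i\<in>A. f i j)"
  using assms(1,3)
proof (induction A rule: finite_induct)
  case empty
  show ?case by simp
next
  case (insert a A)
  have "(\<Oplus>i\<in>insert a A. \<Oplus>j\<in>B. f i j) = (\<Oplus>j\<in>B. f a j) \<oplus> (\<Oplus>j\<in>B. \<Oplus>i\<in>A. f i j)"
    using insert by (subst finsum_insert) (auto intro!: finsum_closed)
  also have "\<dots> = (\<Oplus>j\<in>B. f a j \<oplus> (\<Oplus>i\<in>A. f i j))"
    using insert by (subst finsum_addf) (auto intro!: finsum_closed)
  also have "\<dots> = (\<Oplus>j\<in>B. \<Oplus>i\<in>insert a A. f i j)"
    using insert by (intro finsum_cong') (auto intro!: finsum_closed simp: Pi_def)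
  finally show ?case .
qed

lemma mat_monoid_simps:
  "carrier (mat_monoid n R) = ({..<n} \<times> {..<n}) \<rightarrow>\<^sub>E carrier R"
  "\<one>\<^bsub>mat_monoid n R\<^esub> = scalar_mat n R \<one>\<^bsub>R\<^esub>"
  by (simp_all add: mat_monoid_def)

lemma mat_monoid_mult_entry:
  "i < n \<Longrightarrow> j < n \<Longrightarrow>
    (A \<otimes>\<^bsub>mat_monoid n R\<^esub> B) (i, j) = (\<Oplus>\<^bsub>R\<^esub>k\<in>{..<n}. A (i, k) \<otimes>\<^bsub>R\<^esub> B (k, j))"
  by (simp add: mat_monoid_def)

lemma scalar_mat_entry:
  "i < n \<Longrightarrow> j < n \<Longrightarrow> scalar_mat n R c (i, j) = (if i = j then c else \<zero>\<^bsub>R\<^esub>)"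
  by (simp add: scalar_mat_def)

lemma mat_monoid_eqI:
  assumes "A \<in> carrier (mat_monoid n R)" "B \<in> carrier (mat_monoid n R)"
    and "\<And>i j. i < n \<Longrightarrow> j < n \<Longrightarrow> A (i, j) = B (i, j)"
  shows "A = B"
  using assms unfolding mat_monoid_simps by (intro PiE_ext) auto

lemma mat_entry_closed [intro]:
  "A \<in> carrier (mat_monoid n R) \<Longrightarrow> i < n \<Longrightarrow> j < n \<Longrightarrow> A (i, j) \<in> carrier R"
  unfolding mat_monoid_simps by blast

lemma (in ring) mat_mult_closed:
  assumes "A \<in> carrier (mat_monoid n R)" "B \<in> carrier (mat_monoid n R)"
  shows "A \<otimes>\<^bsub>mat_monoid n R\<^esub> B \<in> carrier (mat_monoid n R)"
proof -
  have "(\<Oplus>k\<in>{..<n}. A (i, k) \<otimes> B (k, j)) \<in> carrier R" if "i < n" "j < n" for i j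
    using that assms by (intro finsum_closed) auto
  thus ?thesis unfolding mat_monoid_def by auto
qed

lemma (in ring) scalar_mat_closed: "c \<in> carrier R \<Longrightarrow> scalar_mat n R c \<in> carrier (mat_monoid n R)"
  unfolding scalar_mat_def mat_monoid_simps by auto

lemma (in ring) mat_monoid_is_monoid: "monoid (mat_monoid n R)"
proof
  let ?M = "mat_monoid n R"
  show "\<one>\<^bsub>?M\<^esub> \<in> carrier ?M" by (simp add: mat_monoid_simps(2) scalar_mat_closed)
  fix A assume A: "A \<in> carrier ?M"
  have "(\<Oplus>k\<in>{..<n}. scalar_mat n R \<one> (i, k) \<otimes> A (k, j)) = A (i, j)" if "i < n" "j < n" for i j
  proof -
    have "(\<Oplus>k\<in>{..<n}. scalar_mat n R \<one> (i, k) \<otimes> A (k, j))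
        = (\<Oplus>k\<in>{..<n}. if i = k then A (k, j) else \<zero>)"
      using that A by (intro finsum_cong') (auto simp: scalar_mat_entry mat_entry_closed)
    also have "\<dots> = A (i, j)" using that A by (intro add.finprod_singleton) auto
    finally show ?thesis .
  qed
  thus "\<one>\<^bsub>?M\<^esub> \<otimes>\<^bsub>?M\<^esub> A = A"
    using A by (intro mat_monoid_eqI[of _ n R] mat_mult_closed)
      (auto simp: mat_monoid_simps(2) scalar_mat_closed mat_monoid_mult_entry)
  have "(\<Oplus>k\<in>{..<n}. A (i, k) \<otimes> scalar_mat n R \<one> (k, j)) = A (i, j)" if "i < n" "j < n" for i j
  proof -
    have "(\<Oplus>k\<in>{..<n}. A (i, k) \<otimes> scalar_mat n R \<one> (k, j))
        = (\<Oplus>k\<in>{..<n}. if j = k then A (i, k) else \<zero>)"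
      using that A by (intro finsum_cong') (auto simp: scalar_mat_entry mat_entry_closed)
    also have "\<dots> = A (i, j)" using that A by (intro add.finprod_singleton) auto
    finally show ?thesis .
  qed
  thus "A \<otimes>\<^bsub>?M\<^esub> \<one>\<^bsub>?M\<^esub> = A"
    using A by (intro mat_monoid_eqI[of _ n R] mat_mult_closed)
      (auto simp: mat_monoid_simps(2) scalar_mat_closed mat_monoid_mult_entry)
  fix B assume B: "B \<in> carrier ?M"
  show "A \<otimes>\<^bsub>?M\<^esub> B \<in> carrier ?M" using A B mat_mult_closed by simp
  fix C assume C: "C \<in> carrier ?M"
  show "A \<otimes>\<^bsub>?M\<^esub> B \<otimes>\<^bsub>?M\<^esub> C = A \<otimes>\<^bsub>?M\<^esub> (B \<otimes>\<^bsub>?M\<^esub> C)"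
  proof (intro mat_monoid_eqI[of _ n R] mat_mult_closed A B C)
    fix i j assume ij: "i < n" "j < n"
    have "(A \<otimes>\<^bsub>?M\<^esub> B \<otimes>\<^bsub>?M\<^esub> C) (i, j)
        = (\<Oplus>k\<in>{..<n}. (\<Oplus>l\<in>{..<n}. A (i, l) \<otimes> B (l, k)) \<otimes> C (k, j))"
      using ij A B C mat_mult_closed[OF A B] unfolding mat_monoid_mult_entry[OF ij]
      by (intro finsum_cong') (auto simp: mat_monoid_mult_entry intro!: finsum_closed)
    also have "\<dots> = (\<Oplus>k\<in>{..<n}. \<Oplus>l\<in>{..<n}. A (i, l) \<otimes> B (l, k) \<otimes> C (k, j))"
      using ij A B C by (intro finsum_cong' finsum_ldistr) (auto intro!: finsum_closed)
    also have "\<dots> = (\<Oplus>l\<in>{..<n}. \<Oplus>k\<in>{..<n}. A (i, l) \<otimes> B (l, k) \<otimes> C (k, j))"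
      using ij A B C by (intro finsum_swap) auto
    also have "\<dots> = (\<Oplus>l\<in>{..<n}. A (i, l) \<otimes> (\<Oplus>k\<in>{..<n}. B (l, k) \<otimes> C (k, j)))"
    proof (rule finsum_cong')
      fix l assume l: "l \<in> {..<n}"
      have "(\<Oplus>k\<in>{..<n}. A (i, l) \<otimes> B (l, k) \<otimes> C (k, j))
          = (\<Oplus>k\<in>{..<n}. A (i, l) \<otimes> (B (l, k) \<otimes> C (k, j)))"
        using ij l A B C by (intro finsum_cong') (auto simp: m_assoc mat_entry_closed)
      also have "\<dots> = A (i, l) \<otimes> (\<Oplus>k\<in>{..<n}. B (l, k) \<otimes> C (k, j))"
        using ij l A B C by (intro finsum_rdistr[symmetric]) auto
      finally show "(\<Oplus>k\<in>{..<n}. A (i, l) \<otimes> B (l, k) \<otimes> C (k, j))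
          = A (i, l) \<otimes> (\<Oplus>k\<in>{..<n}. B (l, k) \<otimes> C (k, j))" .
    qed (use ij A B C in \<open>auto intro!: finsum_closed m_closed\<close>)
    also have "\<dots> = (A \<otimes>\<^bsub>?M\<^esub> (B \<otimes>\<^bsub>?M\<^esub> C)) (i, j)"
      using ij A B C mat_mult_closed[OF B C] unfolding mat_monoid_mult_entry[OF ij]
      by (intro finsum_cong') (auto simp: mat_monoid_mult_entry intro!: finsum_closed m_closed)
    finally show "(A \<otimes>\<^bsub>?M\<^esub> B \<otimes>\<^bsub>?M\<^esub> C) (i, j) = (A \<otimes>\<^bsub>?M\<^esub> (B \<otimes>\<^bsub>?M\<^esub> C)) (i, j)" .
  qed
qed

lemma (in ring) group_GL: "group (GL n R)"
  unfolding GL_def using mat_monoid_is_monoid by (rule monoid.units_group)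

lemma GL_simps:
  "carrier (GL n R) = Units (mat_monoid n R)"
  "mult (GL n R) = mult (mat_monoid n R)"
  "\<one>\<^bsub>GL n R\<^esub> = scalar_mat n R \<one>\<^bsub>R\<^esub>"
  by (simp_all add: GL_def units_of_carrier units_of_mult units_of_one mat_monoid_simps)

lemma carrier_GL_subset: "carrier (GL n R) \<subseteq> carrier (mat_monoid n R)"
  unfolding GL_simps Units_def by blast

lemma (in abelian_monoid) finsum_lessThan_2:
  assumes "f 0 \<in> carrier G" "f 1 \<in> carrier G"
  shows "(\<Oplus>k\<in>{..<2::nat}. f k) = f 0 \<oplus> f 1"
proof -
  have *: "{..<2::nat} = insert 0 (insert 1 {})" by auto
  have "f \<in> {1} \<rightarrow> carrier G" using assms by auto
  thus ?thesis using assms unfolding * by simp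
qed

lemma (in abelian_monoid) finsum_lessThan_4:
  assumes "f 0 \<in> carrier G" "f 1 \<in> carrier G" "f 2 \<in> carrier G" "f 3 \<in> carrier G"
  shows "(\<Oplus>k\<in>{..<4::nat}. f k) = f 0 \<oplus> f 1 \<oplus> f 2 \<oplus> f 3"
proof -
  have *: "{..<4::nat} = insert 0 (insert 1 (insert 2 (insert 3 {})))" by auto
  have "f \<in> {1,2,3} \<rightarrow> carrier G" "f \<in> {2,3} \<rightarrow> carrier G" "f \<in> {3} \<rightarrow> carrier G"
    using assms by auto
  thus ?thesis using assms unfolding * by (simp add: a_assoc)
qed

section \<open>Partitions of central quotients\<close>

context group
begin

lemma central_subgroup_normal:
  assumes "subgroup Z G" "\<And>z x. z \<in> Z \<Longrightarrow> x \<in> carrier G \<Longrightarrow> z \<otimes> x = x \<otimes> z"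
  shows "Z \<lhd> G"
proof -
  interpret Z: subgroup Z G by fact
  have "x \<otimes> h \<otimes> inv x = h" if "x \<in> carrier G" "h \<in> Z" for x h
    using that assms(2)[of h x] by (simp add: m_assoc) (metis Z.mem_carrier m_assoc inv_closed r_inv r_one)
  thus ?thesis using assms(1) unfolding normal_inv_iff by simp
qed

text \<open>If commuting is transitive on the elements outside a central subgroup \<open>Z\<close>, the centralizers of two
  such elements are equal or meet exactly in \<open>Z\<close>. Their images are thus the components of a partition
  of the quotient; two noncommuting elements give two different components.\<close>

lemma central_quotient_partition:
  assumes fin: "finite (carrier G)" and Z: "subgroup Z G"
    and central: "\<And>z x. z \<in> Z \<Longrightarrow> x \<in> carrier G \<Longrightarrow> z \<otimes> x = x \<otimes> z"
    and trans: "\<And>x y z. x \<in> carrier G - Z \<Longrightarrow> y \<in> carrier G \<Longrightarrow> z \<in> carrier G \<Longrightarrow>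
      x \<otimes> y = y \<otimes> x \<Longrightarrow> x \<otimes> z = z \<otimes> x \<Longrightarrow> y \<otimes> z = z \<otimes> y"
    and noncomm: "\<exists>a\<in>carrier G. \<exists>b\<in>carrier G. a \<otimes> b \<noteq> b \<otimes> a"
  shows "has_nontrivial_partition (G Mod Z)"
proof -
  interpret N: normal Z G using central_subgroup_normal Z central by blast
  interpret Q: group "G Mod Z" by (rule N.factorgroup_is_group)
  interpret h: group_hom G "G Mod Z" "\<lambda>a. Z #> a"
    using N.r_coset_hom_Mod by unfold_locales
  define C where "C x = (\<lambda>a. Z #> a) ` centralizer_of x" for x
  have car: "carrier (G Mod Z) = (\<lambda>a. Z #> a) ` carrier G"
    unfolding FactGroup_def RCOSETS_def by auto
  have coset_mem: "x \<in> Z #> y \<longleftrightarrow> Z #> x = Z #> y" if "x \<in> carrier G" "y \<in> carrier G" for x y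
    using that Z by (metis rcos_self repr_independence)
  have in_C: "Z #> y \<in> C x \<longleftrightarrow> y \<in> centralizer_of x"
    if xy: "x \<in> carrier G" "y \<in> carrier G" for x y
  proof
    assume "Z #> y \<in> C x"
    then obtain w where w: "w \<in> carrier G" "x \<otimes> w = w \<otimes> x" "Z #> y = Z #> w"
      unfolding C_def centralizer_of_def by blast
    hence "y \<in> Z #> w" using coset_mem xy by blast
    then obtain z where z: "z \<in> Z" "y = z \<otimes> w" unfolding r_coset_def by blast
    have "x \<otimes> y = z \<otimes> (x \<otimes> w)"
      using z w xy central[of z x] by (metis N.mem_carrier m_assoc)
    also have "\<dots> = y \<otimes> x" using z w xy by (simp add: m_assoc)
    finally show "y \<in> centralizer_of x" using xy unfolding centralizer_of_def by simp
  qed (auto simp: C_def)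
  have one: "Z #> x = \<one>\<^bsub>G Mod Z\<^esub> \<longleftrightarrow> x \<in> Z" if "x \<in> carrier G" for x
    using that coset_join1[OF _ that Z] N.rcos_const[OF is_group] unfolding FactGroup_def by auto
  define P where "P = C ` (carrier G - Z)"
  obtain a b where ab: "a \<in> carrier G" "b \<in> carrier G" "a \<otimes> b \<noteq> b \<otimes> a" using noncomm by blast
  have "group_partition (G Mod Z) P"
    unfolding group_partition_def
  proof (intro conjI ballI)
    have "a \<notin> Z" using central ab by blast
    hence "Z #> a \<noteq> \<one>\<^bsub>G Mod Z\<^esub>" using one ab by blast
    thus "carrier (G Mod Z) \<noteq> {\<one>\<^bsub>G Mod Z\<^esub>}" using car ab by blast
    fix H assume "H \<in> P"
    then obtain x where x: "x \<in> carrier G" "x \<notin> Z" "H = C x" unfolding P_def by blast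
    show "subgroup H (G Mod Z)"
      unfolding x C_def using subgroup_centralizer_of[OF x(1)] by (rule h.subgroup_img_is_subgroup)
    have "Z #> x \<in> H" using x in_C unfolding centralizer_of_def by simp
    thus "H \<noteq> {\<one>\<^bsub>G Mod Z\<^esub>}" using one x by blast
  next
    fix X assume "X \<in> carrier (G Mod Z) - {\<one>\<^bsub>G Mod Z\<^esub>}"
    then obtain x where x: "x \<in> carrier G" "X = Z #> x" using car by blast
    hence "x \<notin> Z" using one \<open>X \<in> _\<close> by blast
    note x = x this
    show "\<exists>!H. H \<in> P \<and> X \<in> H"
    proof (rule ex1I[of _ "C x"])
      show "C x \<in> P \<and> X \<in> C x"
        using x in_C unfolding P_def centralizer_of_def by simp
      fix H assume H: "H \<in> P \<and> X \<in> H"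
      then obtain y where y: "y \<in> carrier G" "y \<notin> Z" "H = C y" unfolding P_def by blast
      have xy: "y \<otimes> x = x \<otimes> y" using H x y in_C unfolding centralizer_of_def by simp
      have "w \<in> centralizer_of x \<longleftrightarrow> w \<in> centralizer_of y" if "w \<in> carrier G" for w
      proof
        assume "w \<in> centralizer_of x"
        thus "w \<in> centralizer_of y"
          using trans[of x w y] x y xy that by (simp add: centralizer_of_def)
      next
        assume "w \<in> centralizer_of y"
        thus "w \<in> centralizer_of x"
          using trans[of y w x] x y xy that by (simp add: centralizer_of_def)
      qed
      hence "centralizer_of x = centralizer_of y" unfolding centralizer_of_def by blast
      thus "H = C x" unfolding y C_def by simp
    qed
  qed
  moreover have "card P \<noteq> 1"
  proof
    assume "card P = 1"
    then obtain H where P: "P = {H}" by (auto simp: card_1_singleton_iff)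
    have "a \<notin> Z" "b \<notin> Z" using central ab by (blast, metis)
    hence "C a = C b" using P ab unfolding P_def by blast
    moreover have "Z #> b \<in> C b" using in_C ab unfolding centralizer_of_def by simp
    ultimately have "Z #> b \<in> C a" by metis
    hence "b \<in> centralizer_of a" using in_C ab by blast
    thus False using ab unfolding centralizer_of_def by simp
  qed
  moreover have "finite (carrier (G Mod Z))" using car fin by simp
  ultimately show ?thesis
    unfolding has_nontrivial_partition_def using Q.is_group by blast
qed

lemma order_quotient:
  assumes "Z \<lhd> G" "finite (carrier G)"
  shows "order (G Mod Z) * card Z = order G"
proof -
  interpret N: normal Z G by fact
  show ?thesis
    using lagrange_finite[OF assms(2) N.subgroup_axioms] unfolding FactGroup_def order_def
    by (simp add: mult.commute)
qed

text \<open>Solutions of \<open>x ^ k = 1\<close> in the quotient are counted through their preimages: each coset covers at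
  most \<open>|Z|\<close> elements of \<open>S\<close>.\<close>

lemma card_root_set_quotient:
  assumes "Z \<lhd> G" "finite (carrier G)" "S \<subseteq> carrier G" "\<And>x. x \<in> S \<Longrightarrow> x [^] k \<in> Z"
  shows "card S \<le> card (root_set k (G Mod Z)) * card Z"
proof -
  interpret N: normal Z G by fact
  interpret h: group_hom G "G Mod Z" "\<lambda>a. Z #> a"
    using N.r_coset_hom_Mod N.factorgroup_is_group is_group
    by (intro group_hom.intro group_hom_axioms.intro)
  let ?R = "(\<lambda>a. Z #> a) ` S"
  have sub: "?R \<subseteq> rcosets Z" unfolding RCOSETS_def using assms by blast
  have "\<Union> ?R \<subseteq> carrier G"
    using sub rcosets_part_G[OF N.subgroup_axioms] by blast
  hence fin: "finite (\<Union> ?R)" using assms finite_subset by blast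
  have "card (\<Union> ?R) = card Z * card ?R"
  proof (rule card_partition[symmetric])
    show "finite ?R" "finite (\<Union> ?R)"
      using fin finite_UnionD[OF fin] by simp_all
    show "card c = card Z" if "c \<in> ?R" for c
      using card_rcosets_equal[OF subsetD[OF sub that] N.subset] by simp
    show "c1 \<inter> c2 = {}" if "c1 \<in> ?R" "c2 \<in> ?R" "c1 \<noteq> c2" for c1 c2
      using that sub rcos_disjoint[OF N.subgroup_axioms] unfolding pairwise_def disjnt_def by blast
  qed
  moreover have "S \<subseteq> \<Union> ?R" using assms rcos_self[OF _ N.subgroup_axioms] by blast
  ultimately have "card S \<le> card Z * card ?R" using card_mono[OF fin] by simp
  also have "card ?R \<le> card (root_set k (G Mod Z))"
  proof (rule card_mono)
    show "finite (root_set k (G Mod Z))"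
      unfolding root_set_def FactGroup_def RCOSETS_def using assms by simp
    show "?R \<subseteq> root_set k (G Mod Z)"
    proof
      fix X assume "X \<in> ?R"
      then obtain x where x: "x \<in> S" "X = Z #> x" by blast
      have "X [^]\<^bsub>G Mod Z\<^esub> k = Z #> (x [^] k)" using x assms h.hom_nat_pow[of x k] by auto
      also have "\<dots> = Z" using assms x N.rcos_const[OF is_group] by simp
      finally show "X \<in> root_set k (G Mod Z)"
        using x assms unfolding root_set_def FactGroup_def RCOSETS_def by auto
    qed
  qed
  finally show ?thesis by (simp add: mult.commute)
qed

end

section \<open>Deciding ring identities by reflection\<close>

context cring
begin

text \<open>Identities in a commutative ring are proved here by normalizing polynomial expressions with the
  reflected normalizer for such expressions. Reification happens by resolution: with \<open>xs\<close> left
  schematic, the rules below turn \<open>s\<close> into \<open>Ipolex xs P\<close> and extend \<open>xs\<close> by every new atom they meet. The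
  simplifier then evaluates the normal form. Hypotheses whose left sides are monomials are used as
  rewrite rules for polynomials; the two numbers bound the number of rounds of this rewriting.\<close>

lemma ring_eqI_hyps:
  "s = Ipolex xs P \<Longrightarrow> t = Ipolex xs Q \<Longrightarrow> Ipolex_polex_list xs ps \<Longrightarrow> in_carrier xs
    \<Longrightarrow> pnsubstl (norm (Sub P Q)) (mk_monpol_list ps) 9 9 = Pc 0 \<Longrightarrow> s = t"
  using norm_subst_correct[of xs ps "Sub P Q" 9 9] norm_ci[of xs P] norm_ci[of xs Q] r_right_minus_eq
  by simp

lemma ring_eqI:
  "s = Ipolex xs P \<Longrightarrow> t = Ipolex xs Q \<Longrightarrow> in_carrier xs \<Longrightarrow> norm (Sub P Q) = Pc 0 \<Longrightarrow> s = t"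
  using norm_ci[of xs "Sub P Q"] norm_ci[of xs P] norm_ci[of xs Q] r_right_minus_eq
  by (simp del: norm.simps)

lemma ring_eqI1:
  assumes "a1 = b1" "a1 = Ipolex xs A1" "b1 = Ipolex xs B1" "s = Ipolex xs P" "t = Ipolex xs Q"
    "in_carrier xs" "pnsubstl (norm (Sub P Q)) (mk_monpol_list [(A1, B1)]) 9 9 = Pc 0"
  shows "s = t"
  by (rule ring_eqI_hyps[OF _ _ _ assms(6,7)]) (use assms in simp_all)

lemma ring_eqI2:
  assumes "a1 = b1" "a2 = b2" "a1 = Ipolex xs A1" "b1 = Ipolex xs B1" "a2 = Ipolex xs A2" "b2 = Ipolex xs B2"
    "s = Ipolex xs P" "t = Ipolex xs Q"
    "in_carrier xs" "pnsubstl (norm (Sub P Q)) (mk_monpol_list [(A1, B1), (A2, B2)]) 9 9 = Pc 0"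
  shows "s = t"
  by (rule ring_eqI_hyps[OF _ _ _ assms(9,10)]) (use assms in simp_all)

lemma ring_eqI4:
  assumes "a1 = b1" "a2 = b2" "a3 = b3" "a4 = b4" 
    "a1 = Ipolex xs A1" "b1 = Ipolex xs B1" "a2 = Ipolex xs A2" "b2 = Ipolex xs B2"
    "a3 = Ipolex xs A3" "b3 = Ipolex xs B3" "a4 = Ipolex xs A4" "b4 = Ipolex xs B4"
    "s = Ipolex xs P" "t = Ipolex xs Q"
    "in_carrier xs" "pnsubstl (norm (Sub P Q)) (mk_monpol_list [(A1, B1), (A2, B2), (A3, B3), (A4, B4)]) 9 9 = Pc 0"
  shows "s = t"
  by (rule ring_eqI_hyps[OF _ _ _ assms(15,16)]) (use assms in simp_all)

text \<open>The order matters. A term is an atom only if no ring operation applies; an atom is looked up in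
  the list before the list is extended; and the empty list closes the schematic tail at the end.\<close>

lemma reify:
  "s = Ipolex xs P \<Longrightarrow> t = Ipolex xs Q \<Longrightarrow> s \<oplus> t = Ipolex xs (Add P Q)"
  "s = Ipolex xs P \<Longrightarrow> t = Ipolex xs Q \<Longrightarrow> s \<ominus> t = Ipolex xs (Sub P Q)"
  "s = Ipolex xs P \<Longrightarrow> t = Ipolex xs Q \<Longrightarrow> s \<otimes> t = Ipolex xs (Mul P Q)"
  "s = Ipolex xs P \<Longrightarrow> s [^] n = Ipolex xs (Pow P n)"
  "s = Ipolex xs P \<Longrightarrow> \<ominus> s = Ipolex xs (Neg P)"
  "\<zero> = Ipolex xs (Const 0)"
  "\<one> = Ipolex xs (Const 1)"
  "x = Ipolex (x # xs) (Var 0)"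
  "x = Ipolex xs (Var n) \<Longrightarrow> x = Ipolex (y # xs) (Var (Suc n))"
  "in_carrier []"
  "x \<in> carrier R \<Longrightarrow> in_carrier xs \<Longrightarrow> in_carrier (x # xs)"
  by (simp_all add: in_carrier_def)

end

text \<open>With these rules the simplifier evaluates the normalizer on closed polynomial expressions.\<close>

declare mkPinj_def [simp] mkPX_def [simp] sub_def [simp] mkMinj_def [simp] Minj_pred_def [simp]
  ponesubst_def [simp] pnsubst_def [simp] pnsubst1.simps [simp] pnsubstl.simps [simp]

lemma pow_numeral [simp]:
  "pow 1 P = P \<langle>*\<rangle> Pc 1" "pow 2 P = sqr P \<langle>*\<rangle> Pc 1" "pow 3 P = P \<langle>*\<rangle> (sqr P \<langle>*\<rangle> Pc 1)" "pow 4 P = sqr (sqr P) \<langle>*\<rangle> Pc 1"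
  by (simp_all add: pow_if)

section \<open>Two by two matrices\<close>

lemma mat_of_rows_entry [simp]:
  "i < n \<Longrightarrow> j < n \<Longrightarrow> mat_of_rows n rows (i, j) = rows ! i ! j"
  by (simp add: mat_of_rows_def)

definition mat2 :: "'a \<Rightarrow> 'a \<Rightarrow> 'a \<Rightarrow> 'a \<Rightarrow> nat \<times> nat \<Rightarrow> 'a" where
  "mat2 a b c d = mat_of_rows 2 [[a, b], [c, d]]"

lemma mat2_entries [simp]:
  "mat2 a b c d (0, 0) = a" "mat2 a b c d (0, 1) = b"
  "mat2 a b c d (1, 0) = c" "mat2 a b c d (1, 1) = d"
  "mat2 a b c d (0, Suc 0) = b" "mat2 a b c d (Suc 0, 0) = c" "mat2 a b c d (Suc 0, Suc 0) = d"
  by (simp_all add: mat2_def mat_of_rows_def)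

lemma mat2_eq_iff [simp]:
  "mat2 a b c d = mat2 a' b' c' d' \<longleftrightarrow> a = a' \<and> b = b' \<and> c = c' \<and> d = d'"
  by (metis mat2_entries(1-4))

lemma mat2_closed:
  assumes "a \<in> carrier R" "b \<in> carrier R" "c \<in> carrier R" "d \<in> carrier R"
  shows "mat2 a b c d \<in> carrier (mat_monoid 2 R)"
proof -
  have "mat2 a b c d (i, j) \<in> carrier R" if "i < 2" "j < 2" for i j
    using that assms by (auto simp: numeral_2_eq_2 less_Suc_eq)
  thus ?thesis unfolding mat_monoid_simps by (auto simp: mat2_def mat_of_rows_def)
qed

lemma mat2_exhaust:
  assumes "A \<in> carrier (mat_monoid 2 R)"
  obtains a b c d where "a \<in> carrier R" "b \<in> carrier R" "c \<in> carrier R" "d \<in> carrier R"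
    "A = mat2 a b c d"
proof -
  have e: "A (0, 0) \<in> carrier R" "A (0, 1) \<in> carrier R" "A (1, 0) \<in> carrier R" "A (1, 1) \<in> carrier R"
    using assms by (auto intro!: mat_entry_closed[of A 2 R])
  have "A = mat2 (A (0, 0)) (A (0, 1)) (A (1, 0)) (A (1, 1))"
    using assms e by (intro mat_monoid_eqI[of _ 2 R] mat2_closed)
      (auto simp: numeral_2_eq_2 less_Suc_eq)
  thus ?thesis using that e by blast
qed

lemma scalar_mat_2: "scalar_mat 2 R c = mat2 c \<zero>\<^bsub>R\<^esub> \<zero>\<^bsub>R\<^esub> c"
  unfolding scalar_mat_def mat2_def mat_of_rows_def
  by (rule ext) (auto simp: numeral_2_eq_2 less_Suc_eq)

lemma det2_mat2 [simp]:
  "det2 R (mat2 a b c d) = a \<otimes>\<^bsub>R\<^esub> d \<ominus>\<^bsub>R\<^esub> b \<otimes>\<^bsub>R\<^esub> c"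
  by (simp add: det2_def)

lemma (in ring) mat2_mult:
  assumes "a \<in> carrier R" "b \<in> carrier R" "c \<in> carrier R" "d \<in> carrier R"
    and "a' \<in> carrier R" "b' \<in> carrier R" "c' \<in> carrier R" "d' \<in> carrier R"
  shows "mat2 a b c d \<otimes>\<^bsub>mat_monoid 2 R\<^esub> mat2 a' b' c' d' =
    mat2 (a \<otimes> a' \<oplus> b \<otimes> c') (a \<otimes> b' \<oplus> b \<otimes> d') (c \<otimes> a' \<oplus> d \<otimes> c') (c \<otimes> b' \<oplus> d \<otimes> d')"
proof (rule mat_monoid_eqI[of _ 2 R])
  fix i j :: nat assume "i < 2" "j < 2"
  hence "i = 0 \<or> i = 1" "j = 0 \<or> j = 1" by auto
  thus "(mat2 a b c d \<otimes>\<^bsub>mat_monoid 2 R\<^esub> mat2 a' b' c' d') (i, j) =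
    mat2 (a \<otimes> a' \<oplus> b \<otimes> c') (a \<otimes> b' \<oplus> b \<otimes> d') (c \<otimes> a' \<oplus> d \<otimes> c') (c \<otimes> b' \<oplus> d \<otimes> d') (i, j)"
    using assms by (auto simp: mat_monoid_mult_entry finsum_lessThan_2)
qed (use assms in \<open>auto intro!: mat_mult_closed mat2_closed\<close>)

lemma (in field) det2_mult:
  assumes "A \<in> carrier (mat_monoid 2 R)" "B \<in> carrier (mat_monoid 2 R)"
  shows "det2 R (A \<otimes>\<^bsub>mat_monoid 2 R\<^esub> B) = det2 R A \<otimes> det2 R B"
proof -
  obtain a b c d where A: "a \<in> carrier R" "b \<in> carrier R" "c \<in> carrier R" "d \<in> carrier R"
    "A = mat2 a b c d" using assms(1) by (rule mat2_exhaust)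
  obtain a' b' c' d' where B: "a' \<in> carrier R" "b' \<in> carrier R" "c' \<in> carrier R" "d' \<in> carrier R"
    "B = mat2 a' b' c' d'" using assms(2) by (rule mat2_exhaust)
  show ?thesis unfolding A(5) B(5) using A(1-4) B(1-4)
    apply (simp only: mat2_mult det2_mat2) by - (rule ring_eqI, (rule reify | simp)+)
qed

lemma (in cring) det2_closed: "A \<in> carrier (mat_monoid 2 R) \<Longrightarrow> det2 R A \<in> carrier R"
  by (auto elim!: mat2_exhaust)

lemma (in field) Units_mat_monoid_2:
  "Units (mat_monoid 2 R) = {A \<in> carrier (mat_monoid 2 R). det2 R A \<noteq> \<zero>}"
proof safe
  fix A assume A: "A \<in> Units (mat_monoid 2 R)"
  thus Ac: "A \<in> carrier (mat_monoid 2 R)" unfolding Units_def by blast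
  obtain B where B: "B \<in> carrier (mat_monoid 2 R)" "B \<otimes>\<^bsub>mat_monoid 2 R\<^esub> A = \<one>\<^bsub>mat_monoid 2 R\<^esub>"
    using A unfolding Units_def by blast
  assume "det2 R A = \<zero>"
  hence "det2 R (\<one>\<^bsub>mat_monoid 2 R\<^esub>) = \<zero>"
    using det2_mult[OF B(1) Ac] B det2_closed[OF B(1)] by simp
  thus False by (simp add: mat_monoid_simps scalar_mat_2)
next
  fix A assume "A \<in> carrier (mat_monoid 2 R)" and nz: "det2 R A \<noteq> \<zero>"
  then obtain a b c d where A: "a \<in> carrier R" "b \<in> carrier R" "c \<in> carrier R" "d \<in> carrier R"
    "A = mat2 a b c d" by (auto elim: mat2_exhaust)
  define e where "e = inv (a \<otimes> d \<ominus> b \<otimes> c)"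
  have D: "a \<otimes> d \<ominus> b \<otimes> c \<in> Units R" using nz A field_Units by simp
  hence e: "e \<in> carrier R" "e \<otimes> (a \<otimes> d \<ominus> b \<otimes> c) = \<one>" unfolding e_def by auto
  let ?B = "mat2 (e \<otimes> d) (\<ominus> (e \<otimes> b)) (\<ominus> (e \<otimes> c)) (e \<otimes> a)"
  have B: "?B \<in> carrier (mat_monoid 2 R)" using A e by (intro mat2_closed) auto
  have 1: "e \<otimes> d \<otimes> a \<oplus> \<ominus> (e \<otimes> b) \<otimes> c = \<one>" "\<ominus> (e \<otimes> c) \<otimes> b \<oplus> e \<otimes> a \<otimes> d = \<one>"
    "a \<otimes> (e \<otimes> d) \<oplus> b \<otimes> \<ominus> (e \<otimes> c) = \<one>" "c \<otimes> \<ominus> (e \<otimes> b) \<oplus> d \<otimes> (e \<otimes> a) = \<one>"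
    unfolding e(2)[symmetric] using A(1-4) e(1) by - ((rule ring_eqI, (rule reify | simp)+)[1])+
  have 2: "e \<otimes> d \<otimes> b \<oplus> \<ominus> (e \<otimes> b) \<otimes> d = \<zero>" "\<ominus> (e \<otimes> c) \<otimes> a \<oplus> e \<otimes> a \<otimes> c = \<zero>"
    "a \<otimes> \<ominus> (e \<otimes> b) \<oplus> b \<otimes> (e \<otimes> a) = \<zero>" "c \<otimes> (e \<otimes> d) \<oplus> d \<otimes> \<ominus> (e \<otimes> c) = \<zero>"
    using A(1-4) e(1) by - ((rule ring_eqI, (rule reify | simp)+)[1])+
  have "?B \<otimes>\<^bsub>mat_monoid 2 R\<^esub> A = \<one>\<^bsub>mat_monoid 2 R\<^esub>" "A \<otimes>\<^bsub>mat_monoid 2 R\<^esub> ?B = \<one>\<^bsub>mat_monoid 2 R\<^esub>"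
    unfolding A(5) mat_monoid_simps scalar_mat_2 using A(1-4) e(1) 1 2
    by (simp_all add: mat2_mult)
  thus "A \<in> Units (mat_monoid 2 R)"
    using B \<open>A \<in> carrier _\<close> unfolding Units_def by blast
qed

lemma (in field) carrier_GL_2:
  "carrier (GL 2 R) = {A \<in> carrier (mat_monoid 2 R). det2 R A \<noteq> \<zero>}"
  by (simp add: GL_simps Units_mat_monoid_2)

lemma (in field) subgroup_SL2:
  "subgroup {A \<in> carrier (GL 2 R). det2 R A = \<one>} (GL 2 R)"
proof -
  interpret G: group "GL 2 R" by (rule group_GL)
  have sub: "A \<in> carrier (mat_monoid 2 R)" if "A \<in> carrier (GL 2 R)" for A
    using that carrier_GL_subset by blast
  show ?thesis
  proof (rule G.subgroupI)
    have "\<one>\<^bsub>GL 2 R\<^esub> \<in> {A \<in> carrier (GL 2 R). det2 R A = \<one>}"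
      using G.one_closed by (simp add: GL_simps(3) scalar_mat_2)
    thus "{A \<in> carrier (GL 2 R). det2 R A = \<one>} \<noteq> {}" by blast
    fix A assume A: "A \<in> {A \<in> carrier (GL 2 R). det2 R A = \<one>}"
    have "det2 R (inv\<^bsub>GL 2 R\<^esub> A \<otimes>\<^bsub>GL 2 R\<^esub> A) = \<one>"
      using A G.one_closed by (simp add: GL_simps(3) scalar_mat_2)
    hence "det2 R (inv\<^bsub>GL 2 R\<^esub> A) \<otimes> \<one> = \<one>"
      using A sub det2_mult[of "inv\<^bsub>GL 2 R\<^esub> A" A] by (simp add: GL_simps(2))
    moreover have "det2 R (inv\<^bsub>GL 2 R\<^esub> A) \<in> carrier R"
      using A sub det2_closed by simp
    ultimately show "inv\<^bsub>GL 2 R\<^esub> A \<in> {A \<in> carrier (GL 2 R). det2 R A = \<one>}" using A by simp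
    fix B assume B: "B \<in> {A \<in> carrier (GL 2 R). det2 R A = \<one>}"
    show "A \<otimes>\<^bsub>GL 2 R\<^esub> B \<in> {A \<in> carrier (GL 2 R). det2 R A = \<one>}"
      using A B sub det2_mult[of A B] G.m_closed[of A B] by (simp add: GL_simps(2))
  qed auto
qed

lemma (in field) group_SL2: "group (SL2 R)"
  unfolding SL2_def using subgroup.subgroup_is_group[OF subgroup_SL2 group_GL] .

lemma (in field) carrier_SL2:
  "carrier (SL2 R) = {A \<in> carrier (mat_monoid 2 R). det2 R A = \<one>}"
  by (auto simp: SL2_def carrier_GL_2)

lemma SL2_simps:
  "mult (SL2 R) = mult (mat_monoid 2 R)"
  "\<one>\<^bsub>SL2 R\<^esub> = scalar_mat 2 R \<one>\<^bsub>R\<^esub>"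
  by (simp_all add: SL2_def GL_simps)

lemma (in ring) eq_iff_of_minus_eq:
  assumes "p \<ominus> q = r \<ominus> s"
    and "p \<in> carrier R" "q \<in> carrier R" "r \<in> carrier R" "s \<in> carrier R"
  shows "p = q \<longleftrightarrow> r = s"
  using assms by (metis r_right_minus_eq)

text \<open>The three equations say that the vectors \<open>(b, c, a - d)\<close> and \<open>(b', c', a' - d')\<close>, which describe the
  matrices modulo scalars, are parallel.\<close>

lemma (in field) commute_mat2_iff:
  assumes x: "a \<in> carrier R" "b \<in> carrier R" "c \<in> carrier R" "d \<in> carrier R"
    and y: "a' \<in> carrier R" "b' \<in> carrier R" "c' \<in> carrier R" "d' \<in> carrier R"
  shows "mat2 a b c d \<otimes>\<^bsub>mat_monoid 2 R\<^esub> mat2 a' b' c' d'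
       = mat2 a' b' c' d' \<otimes>\<^bsub>mat_monoid 2 R\<^esub> mat2 a b c d \<longleftrightarrow>
    b \<otimes> c' = b' \<otimes> c \<and> (a \<ominus> d) \<otimes> b' = (a' \<ominus> d') \<otimes> b \<and> (a \<ominus> d) \<otimes> c' = (a' \<ominus> d') \<otimes> c"
proof -
  have 1: "a \<otimes> a' \<oplus> b \<otimes> c' = a' \<otimes> a \<oplus> b' \<otimes> c \<longleftrightarrow> b \<otimes> c' = b' \<otimes> c"
    using x y by (simp add: m_comm)
  have 2: "c \<otimes> b' \<oplus> d \<otimes> d' = c' \<otimes> b \<oplus> d' \<otimes> d \<longleftrightarrow> b \<otimes> c' = b' \<otimes> c"
    using x y by (simp add: m_comm) metis
  have "a \<otimes> b' \<oplus> b \<otimes> d' \<ominus> (a' \<otimes> b \<oplus> b' \<otimes> d) = (a \<ominus> d) \<otimes> b' \<ominus> (a' \<ominus> d') \<otimes> b"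
    using x y by - (rule ring_eqI, (rule reify | simp)+)
  hence 3: "a \<otimes> b' \<oplus> b \<otimes> d' = a' \<otimes> b \<oplus> b' \<otimes> d \<longleftrightarrow> (a \<ominus> d) \<otimes> b' = (a' \<ominus> d') \<otimes> b"
    by (rule eq_iff_of_minus_eq) (use x y in simp_all)
  have "c' \<otimes> a \<oplus> d' \<otimes> c \<ominus> (c \<otimes> a' \<oplus> d \<otimes> c') = (a \<ominus> d) \<otimes> c' \<ominus> (a' \<ominus> d') \<otimes> c"
    using x y by - (rule ring_eqI, (rule reify | simp)+)
  hence 4: "c' \<otimes> a \<oplus> d' \<otimes> c = c \<otimes> a' \<oplus> d \<otimes> c' \<longleftrightarrow> (a \<ominus> d) \<otimes> c' = (a' \<ominus> d') \<otimes> c"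
    by (rule eq_iff_of_minus_eq) (use x y in simp_all)
  show ?thesis
    unfolding mat2_mult[OF x y] mat2_mult[OF y x] mat2_eq_iff
    using 1 2 3 4 by metis
qed

text \<open>Both other vectors are multiples of the nonzero vector \<open>x\<close>.\<close>

lemma (in field) parallel_trans:
  assumes x: "x1 \<in> carrier R" "x2 \<in> carrier R" "x3 \<in> carrier R"
    and y: "y1 \<in> carrier R" "y2 \<in> carrier R" "y3 \<in> carrier R"
    and z: "z1 \<in> carrier R" "z2 \<in> carrier R" "z3 \<in> carrier R"
    and nz: "x1 \<noteq> \<zero> \<or> x2 \<noteq> \<zero> \<or> x3 \<noteq> \<zero>"
    and xy: "x1 \<otimes> y2 = y1 \<otimes> x2" "x3 \<otimes> y1 = y3 \<otimes> x1" "x3 \<otimes> y2 = y3 \<otimes> x2"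
    and xz: "x1 \<otimes> z2 = z1 \<otimes> x2" "x3 \<otimes> z1 = z3 \<otimes> x1" "x3 \<otimes> z2 = z3 \<otimes> x2"
  shows "y1 \<otimes> z2 = z1 \<otimes> y2 \<and> y3 \<otimes> z1 = z3 \<otimes> y1 \<and> y3 \<otimes> z2 = z3 \<otimes> y2"
proof -
  have scale: "\<exists>l\<in>carrier R. y1 = l \<otimes> x1 \<and> y2 = l \<otimes> x2 \<and> y3 = l \<otimes> x3"
    if y: "y1 \<in> carrier R" "y2 \<in> carrier R" "y3 \<in> carrier R"
      and xy: "x1 \<otimes> y2 = y1 \<otimes> x2" "x3 \<otimes> y1 = y3 \<otimes> x1" "x3 \<otimes> y2 = y3 \<otimes> x2" for y1 y2 y3
  proof -
    have inv: "\<exists>e\<in>carrier R. e \<otimes> u = \<one>" if "u \<in> carrier R" "u \<noteq> \<zero>" for u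
      using that field_Units by (metis Diff_iff Units_inv_closed Units_l_inv empty_iff insert_iff)
    have divide: "v = (e \<otimes> u) \<otimes> r"
      if "e \<otimes> p = \<one>" "p \<otimes> v = u \<otimes> r"
        "e \<in> carrier R" "p \<in> carrier R" "v \<in> carrier R" "u \<in> carrier R" "r \<in> carrier R" for e p v u r
      using that by (metis l_one m_assoc)
    have yx: "x1 \<otimes> y3 = y1 \<otimes> x3" "x2 \<otimes> y1 = y2 \<otimes> x1" "x2 \<otimes> y3 = y2 \<otimes> x3"
      using xy x y by (simp_all add: m_comm)
    from nz consider "x1 \<noteq> \<zero>" | "x2 \<noteq> \<zero>" | "x3 \<noteq> \<zero>" by blast
    thus ?thesis
    proof cases
      case 1
      then obtain e where e: "e \<in> carrier R" "e \<otimes> x1 = \<one>" using inv x by blast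
      show ?thesis
        by (intro bexI[of _ "e \<otimes> y1"] conjI divide[OF e(2)]) (use e x y xy yx in \<open>simp_all add: m_comm\<close>)
    next
      case 2
      then obtain e where e: "e \<in> carrier R" "e \<otimes> x2 = \<one>" using inv x by blast
      show ?thesis
        by (intro bexI[of _ "e \<otimes> y2"] conjI divide[OF e(2)]) (use e x y xy yx in \<open>simp_all add: m_comm\<close>)
    next
      case 3
      then obtain e where e: "e \<in> carrier R" "e \<otimes> x3 = \<one>" using inv x by blast
      show ?thesis
        by (intro bexI[of _ "e \<otimes> y3"] conjI divide[OF e(2)]) (use e x y xy yx in \<open>simp_all add: m_comm\<close>)
    qed
  qed
  obtain l where l: "l \<in> carrier R" "y1 = l \<otimes> x1" "y2 = l \<otimes> x2" "y3 = l \<otimes> x3"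
    using scale[OF y xy] by blast
  obtain m where m: "m \<in> carrier R" "z1 = m \<otimes> x1" "z2 = m \<otimes> x2" "z3 = m \<otimes> x3"
    using scale[OF z xz] by blast
  show ?thesis unfolding l(2-4) m(2-4) using l(1) m(1) x by - (intro conjI; (rule ring_eqI, (rule reify | simp)+))
qed

lemma (in field) commute_trans:
  assumes "x \<in> carrier (mat_monoid 2 R)" "x \<notin> scalars2 R"
    and "y \<in> carrier (mat_monoid 2 R)" "z \<in> carrier (mat_monoid 2 R)"
    and "x \<otimes>\<^bsub>mat_monoid 2 R\<^esub> y = y \<otimes>\<^bsub>mat_monoid 2 R\<^esub> x"
    and "x \<otimes>\<^bsub>mat_monoid 2 R\<^esub> z = z \<otimes>\<^bsub>mat_monoid 2 R\<^esub> x"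
  shows "y \<otimes>\<^bsub>mat_monoid 2 R\<^esub> z = z \<otimes>\<^bsub>mat_monoid 2 R\<^esub> y"
proof -
  obtain x1 x2 x3 x4 where x: "x1 \<in> carrier R" "x2 \<in> carrier R" "x3 \<in> carrier R" "x4 \<in> carrier R"
    "x = mat2 x1 x2 x3 x4" using assms(1) by (rule mat2_exhaust)
  obtain y1 y2 y3 y4 where y: "y1 \<in> carrier R" "y2 \<in> carrier R" "y3 \<in> carrier R" "y4 \<in> carrier R"
    "y = mat2 y1 y2 y3 y4" using assms(3) by (rule mat2_exhaust)
  obtain z1 z2 z3 z4 where z: "z1 \<in> carrier R" "z2 \<in> carrier R" "z3 \<in> carrier R" "z4 \<in> carrier R"
    "z = mat2 z1 z2 z3 z4" using assms(4) by (rule mat2_exhaust)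
  have "x2 \<noteq> \<zero> \<or> x3 \<noteq> \<zero> \<or> x1 \<ominus> x4 \<noteq> \<zero>"
    using assms(2) x unfolding scalars2_def scalar_mat_2 by auto
  thus ?thesis
    using parallel_trans[of x2 x3 "x1 \<ominus> x4" y2 y3 "y1 \<ominus> y4" z2 z3 "z1 \<ominus> z4"] x y z assms(5,6)
    by (simp add: commute_mat2_iff)
qed

section \<open>Linear groups of degree two over a finite field\<close>

lemma (in monoid) pow_two: "x \<in> carrier G \<Longrightarrow> x [^] (2::nat) = x \<otimes> x"
  by (simp add: numeral_2_eq_2)

lemma (in monoid) pow_three: "x \<in> carrier G \<Longrightarrow> x [^] (3::nat) = x \<otimes> x \<otimes> x"
  by (simp add: numeral_3_eq_3)

locale finite_field = field R for R (structure) +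
  assumes finite_carrier [simp]: "finite (carrier R)"
begin

abbreviation q :: nat where "q \<equiv> order R"

lemma q_gt_1: "q > 1"
proof -
  have "card {\<zero>, \<one>} \<le> q" unfolding order_def by (intro card_mono) auto
  thus ?thesis by simp
qed

lemma card_nonzero: "card (carrier R - {\<zero>}) = q - 1"
  unfolding order_def by (simp add: card_Diff_singleton)

lemma inverse_exists: "u \<in> carrier R \<Longrightarrow> u \<noteq> \<zero> \<Longrightarrow> \<exists>v\<in>carrier R. v \<otimes> u = \<one>"
  using field_Units by (metis Diff_iff Units_inv_closed Units_l_inv empty_iff insert_iff)

text \<open>The group of units has odd order \<open>q - 1\<close>, so \<open>1 = (-1) ^ (q - 1) = -1\<close>.\<close>

lemma char_two_if_even:
  assumes "even q"
  shows "\<one> \<oplus> \<one> = \<zero>"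
proof -
  have "\<ominus> \<one> \<in> Units R" using field_Units by simp
  moreover have "finite (Units R)" using field_Units by simp
  moreover have "card (Units R) = q - 1" using field_Units card_nonzero by simp
  ultimately have "(\<ominus> \<one>) [^] (q - 1) = \<one>" using units_power_order_eq_one by metis
  moreover obtain m where "q - 1 = 2 * m + 1"
    using assms q_gt_1 by (metis Suc_eq_plus1 even_Suc oddE Suc_diff_1 less_imp_le_nat less_trans zero_less_one)
  moreover have "(\<ominus> \<one>) [^] (2 * m + 1) = \<ominus> \<one>"
  proof -
    have "(\<ominus> \<one>) [^] (2::nat) = \<one>" by (simp add: numeral_2_eq_2 l_minus)
    thus ?thesis by (simp add: nat_pow_pow[symmetric])
  qed
  ultimately have "\<ominus> \<one> = \<one>" by simp
  thus ?thesis by (metis one_closed r_neg)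
qed

lemma card_mult_eq:
  assumes "e \<in> carrier R"
  shows "card {(b, c). b \<in> carrier R \<and> c \<in> carrier R \<and> b \<otimes> c = e} = (if e = \<zero> then q + (q - 1) else q - 1)"
proof (cases "e = \<zero>")
  case True
  have "{(b, c). b \<in> carrier R \<and> c \<in> carrier R \<and> b \<otimes> c = e}
      = {\<zero>} \<times> carrier R \<union> (carrier R - {\<zero>}) \<times> {\<zero>}"
    using True by (auto simp: integral_iff)
  moreover have "card ({\<zero>} \<times> carrier R \<union> (carrier R - {\<zero>}) \<times> {\<zero>}) = q + (q - 1)"
    by (subst card_Un_disjoint) (auto simp: card_cartesian_product card_nonzero order_def)
  ultimately show ?thesis using True by simp
next
  case False
  have "bij_betw fst {(b, c). b \<in> carrier R \<and> c \<in> carrier R \<and> b \<otimes> c = e} (carrier R - {\<zero>})"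
    unfolding bij_betw_def
  proof
    show "inj_on fst {(b, c). b \<in> carrier R \<and> c \<in> carrier R \<and> b \<otimes> c = e}"
    proof (rule inj_onI)
      fix x y assume xy: "x \<in> {(b, c). b \<in> carrier R \<and> c \<in> carrier R \<and> b \<otimes> c = e}"
        "y \<in> {(b, c). b \<in> carrier R \<and> c \<in> carrier R \<and> b \<otimes> c = e}" "fst x = fst y"
      then obtain b c c' where a: "x = (b, c)" "y = (b, c')" "b \<in> carrier R" "c \<in> carrier R"
        "c' \<in> carrier R" "b \<otimes> c = e" "b \<otimes> c' = e" by auto
      hence "b \<noteq> \<zero>" using False by auto
      thus "x = y" using a m_lcancel[of b c c'] by simp
    qed
    show "fst ` {(b, c). b \<in> carrier R \<and> c \<in> carrier R \<and> b \<otimes> c = e} = carrier R - {\<zero>}"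
    proof (intro equalityI subsetI)
      fix b assume "b \<in> carrier R - {\<zero>}"
      hence b: "b \<in> carrier R" "b \<noteq> \<zero>" by auto
      then obtain v where v: "v \<in> carrier R" "v \<otimes> b = \<one>" using inverse_exists by blast
      have "b \<otimes> (v \<otimes> e) = e" using b v assms by (metis l_one m_assoc m_comm)
      thus "b \<in> fst ` {(b, c). b \<in> carrier R \<and> c \<in> carrier R \<and> b \<otimes> c = e}"
        using b v assms by (intro image_eqI[of _ _ "(b, v \<otimes> e)"]) auto
    qed (use False assms in auto)
  qed
  thus ?thesis using False card_nonzero bij_betw_same_card by fastforce
qed

text \<open>Every set of \<open>2 \<times> 2\<close> matrices counted below is given by its diagonal, subject to conditions, and an
  off-diagonal pair with prescribed product; the product zero belongs to \<open>q\<close> pairs more than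
  any other.\<close>

lemma card_fibered:
  assumes "finite P" "\<And>p. p \<in> P \<Longrightarrow> e p \<in> carrier R"
  shows "card {(p, b, c). p \<in> P \<and> b \<in> carrier R \<and> c \<in> carrier R \<and> b \<otimes> c = e p}
    = card P * (q - 1) + q * card {p \<in> P. e p = \<zero>}"
proof -
  have "{(p, b, c). p \<in> P \<and> b \<in> carrier R \<and> c \<in> carrier R \<and> b \<otimes> c = e p}
    = (SIGMA p:P. {(b, c). b \<in> carrier R \<and> c \<in> carrier R \<and> b \<otimes> c = e p})" by auto
  moreover have "card (SIGMA p:P. {(b, c). b \<in> carrier R \<and> c \<in> carrier R \<and> b \<otimes> c = e p})
    = (\<Sum>p\<in>P. card {(b, c). b \<in> carrier R \<and> c \<in> carrier R \<and> b \<otimes> c = e p})"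
    using assms(1) by (intro card_SigmaI)
      (auto intro: finite_subset[of _ "carrier R \<times> carrier R"])
  also have "\<dots> = (\<Sum>p\<in>P. (q - 1) + (if e p = \<zero> then q else 0))"
    using assms(2) card_mult_eq by (intro sum.cong) auto
  also have "\<dots> = card P * (q - 1) + q * card {p \<in> P. e p = \<zero>}"
    using assms(1) by (simp add: sum.distrib sum.If_cases Int_def)
  ultimately show ?thesis by simp
qed

lemma card_det_eq:
  assumes "\<delta> \<in> carrier R"
  shows "card {A \<in> carrier (mat_monoid 2 R). det2 R A = \<delta>}
    = q * q * (q - 1) + q * (if \<delta> = \<zero> then q + (q - 1) else q - 1)"
proof -
  let ?enc = "\<lambda>((a, d), b, c). mat2 a b c d"
  let ?S = "{(p, b, c). p \<in> carrier R \<times> carrier R \<and> b \<in> carrier R \<and> c \<in> carrier R \<and>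
    b \<otimes> c = fst p \<otimes> snd p \<ominus> \<delta>}"
  have "{A \<in> carrier (mat_monoid 2 R). det2 R A = \<delta>} = ?enc ` ?S"
  proof (intro equalityI subsetI)
    fix A assume "A \<in> {A \<in> carrier (mat_monoid 2 R). det2 R A = \<delta>}"
    hence A': "A \<in> carrier (mat_monoid 2 R)" "det2 R A = \<delta>" by auto
    then obtain a b c d where A: "a \<in> carrier R" "b \<in> carrier R" "c \<in> carrier R" "d \<in> carrier R"
      "A = mat2 a b c d" "a \<otimes> d \<ominus> b \<otimes> c = \<delta>" by (auto elim: mat2_exhaust)
    have "b \<otimes> c = a \<otimes> d \<ominus> (a \<otimes> d \<ominus> b \<otimes> c)" using A(1-4) by - (rule ring_eqI, (rule reify | simp)+)
    thus "A \<in> ?enc ` ?S"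
      using A by (intro image_eqI[of _ _ "((a, d), b, c)"]) auto
  next
    fix A assume "A \<in> ?enc ` ?S"
    then obtain a b c d where a: "a \<in> carrier R" "b \<in> carrier R" "c \<in> carrier R" "d \<in> carrier R"
      "b \<otimes> c = a \<otimes> d \<ominus> \<delta>" "A = mat2 a b c d" by auto
    have "a \<otimes> d \<ominus> (a \<otimes> d \<ominus> \<delta>) = \<delta>" using a(1-4) assms by - (rule ring_eqI, (rule reify | simp)+)
    thus "A \<in> {A \<in> carrier (mat_monoid 2 R). det2 R A = \<delta>}"
      using a by (auto intro: mat2_closed)
  qed
  moreover have "inj_on ?enc ?S" by (auto intro!: inj_onI)
  ultimately have "card {A \<in> carrier (mat_monoid 2 R). det2 R A = \<delta>} = card ?S"
    by (simp add: card_image)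
  also have "\<dots> = card (carrier R \<times> carrier R) * (q - 1) +
      q * card {p \<in> carrier R \<times> carrier R. fst p \<otimes> snd p \<ominus> \<delta> = \<zero>}"
    using assms by (intro card_fibered) auto
  also have "{p \<in> carrier R \<times> carrier R. fst p \<otimes> snd p \<ominus> \<delta> = \<zero>}
      = {(b, c). b \<in> carrier R \<and> c \<in> carrier R \<and> b \<otimes> c = \<delta>}"
    using assms by auto
  finally show ?thesis using card_mult_eq[OF assms] by (simp add: card_cartesian_product order_def)
qed

lemma finite_mats: "finite (carrier (mat_monoid 2 R))"
  unfolding mat_monoid_simps by (intro finite_PiE) auto

lemma card_mats: "card (carrier (mat_monoid 2 R)) = q ^ 4"
  unfolding mat_monoid_simps by (simp add: card_PiE order_def)

lemma order_SL2: "order (SL2 R) = q * (q - 1) * (q + 1)"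
  unfolding order_def carrier_SL2 using card_det_eq[of \<one>]
  by (simp add: order_def algebra_simps)

lemma order_GL2: "order (GL 2 R) = q * (q - 1) * (q - 1) * (q + 1)"
proof -
  have "carrier (GL 2 R) = carrier (mat_monoid 2 R) - {A \<in> carrier (mat_monoid 2 R). det2 R A = \<zero>}"
    unfolding carrier_GL_2 by auto
  hence "order (GL 2 R) = q ^ 4 - (q * q * (q - 1) + q * (q + (q - 1)))"
    using card_det_eq[of \<zero>] finite_mats card_mats
    by (simp add: order_def card_Diff_subset)
  also obtain m where m: "q = Suc m" using q_gt_1 by (cases q) auto
  hence "q ^ 4 - (q * q * (q - 1) + q * (q + (q - 1))) = q * (q - 1) * (q - 1) * (q + 1)"
    by (simp add: eval_nat_numeral algebra_simps)
  finally show ?thesis .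
qed

lemma finite_GL2: "finite (carrier (GL 2 R))"
  using carrier_GL_subset finite_mats finite_subset by metis

lemma finite_SL2: "finite (carrier (SL2 R))"
  unfolding carrier_SL2 using finite_mats by simp

lemma scalar_subgroup:
  assumes "group H" "carrier H \<subseteq> carrier (mat_monoid 2 R)"
    and mult: "mult H = mult (mat_monoid 2 R)" and one: "\<one>\<^bsub>H\<^esub> = \<one>\<^bsub>mat_monoid 2 R\<^esub>"
  shows "subgroup (carrier H \<inter> scalars2 R) H"
    and "\<And>z x. z \<in> carrier H \<inter> scalars2 R \<Longrightarrow> x \<in> carrier H \<Longrightarrow> z \<otimes>\<^bsub>H\<^esub> x = x \<otimes>\<^bsub>H\<^esub> z"
proof -
  interpret H: group H by fact
  have sc: "x \<in> scalars2 R \<longleftrightarrow> (\<exists>s\<in>carrier R. x = mat2 s \<zero> \<zero> s)" for x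
    unfolding scalars2_def scalar_mat_2 by auto
  show "subgroup (carrier H \<inter> scalars2 R) H"
  proof (rule H.subgroupI)
    have "\<one>\<^bsub>H\<^esub> \<in> carrier H \<inter> scalars2 R"
      using H.one_closed unfolding Int_iff sc one mat_monoid_simps scalar_mat_2 by (simp add: one mat_monoid_simps scalar_mat_2)
    thus "carrier H \<inter> scalars2 R \<noteq> {}" by blast
    fix x assume x: "x \<in> carrier H \<inter> scalars2 R"
    then obtain s where s: "s \<in> carrier R" "x = mat2 s \<zero> \<zero> s" using sc by blast
    have "inv\<^bsub>H\<^esub> x \<in> carrier (mat_monoid 2 R)" using H.inv_closed[of x] x assms(2) by blast
    then obtain a b c d where y: "a \<in> carrier R" "b \<in> carrier R" "c \<in> carrier R" "d \<in> carrier R"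
      "inv\<^bsub>H\<^esub> x = mat2 a b c d" by (rule mat2_exhaust)
    have "x \<otimes>\<^bsub>H\<^esub> inv\<^bsub>H\<^esub> x = \<one>\<^bsub>H\<^esub>" using x by simp
    hence e: "s \<otimes> a = \<one>" "s \<otimes> b = \<zero>" "s \<otimes> c = \<zero>" "s \<otimes> d = \<one>"
      unfolding y(5) unfolding s(2) mult one mat_monoid_simps scalar_mat_2
      using s(1) y(1-4) by (simp_all add: mult one mat_monoid_simps scalar_mat_2 mat2_mult)
    hence "s \<noteq> \<zero>" using y by auto
    moreover have "s \<otimes> a = s \<otimes> d" using e by simp
    ultimately have "b = \<zero>" "c = \<zero>" "a = d"
      using e s y m_lcancel[of s a d] by (simp_all add: integral_iff)
    thus "inv\<^bsub>H\<^esub> x \<in> carrier H \<inter> scalars2 R"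
      using x y sc[of "inv\<^bsub>H\<^esub> x"] H.inv_closed[of x] by blast
    fix y assume y: "y \<in> carrier H \<inter> scalars2 R"
    then obtain r where r: "r \<in> carrier R" "y = mat2 r \<zero> \<zero> r" using sc by blast
    have "x \<otimes>\<^bsub>H\<^esub> y = mat2 (s \<otimes> r) \<zero> \<zero> (s \<otimes> r)"
      using r s by (simp add: mult mat2_mult)
    thus "x \<otimes>\<^bsub>H\<^esub> y \<in> carrier H \<inter> scalars2 R" using x y sc r s H.m_closed[of x y] by auto
  qed auto
  fix z x assume z: "z \<in> carrier H \<inter> scalars2 R" and x: "x \<in> carrier H"
  obtain s where s: "s \<in> carrier R" "z = mat2 s \<zero> \<zero> s" using sc z by blast
  have "x \<in> carrier (mat_monoid 2 R)" using x assms(2) by blast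
  then obtain a b c d where y: "a \<in> carrier R" "b \<in> carrier R" "c \<in> carrier R" "d \<in> carrier R"
    "x = mat2 a b c d" by (rule mat2_exhaust)
  show "z \<otimes>\<^bsub>H\<^esub> x = x \<otimes>\<^bsub>H\<^esub> z"
    using s y by (simp add: mult mat2_mult m_comm)
qed

text \<open>Stated for all groups between \<open>SL(2,q)\<close> and \<open>GL(2,q)\<close>, so that it covers \<open>PSL(2,q)\<close> and \<open>PGL(2,q)\<close> at
  once. The two elementary transvections do not commute.\<close>

lemma partition_mod_scalars:
  assumes "group H" "carrier H \<subseteq> carrier (mat_monoid 2 R)" "carrier (SL2 R) \<subseteq> carrier H"
    and mult: "mult H = mult (mat_monoid 2 R)" and one: "\<one>\<^bsub>H\<^esub> = \<one>\<^bsub>mat_monoid 2 R\<^esub>"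
  shows "has_nontrivial_partition (H Mod (carrier H \<inter> scalars2 R))"
proof (rule group.central_quotient_partition[OF \<open>group H\<close>])
  show "finite (carrier H)" using assms(2) finite_mats finite_subset by blast
  show "subgroup (carrier H \<inter> scalars2 R) H"
    "\<And>z x. z \<in> carrier H \<inter> scalars2 R \<Longrightarrow> x \<in> carrier H \<Longrightarrow> z \<otimes>\<^bsub>H\<^esub> x = x \<otimes>\<^bsub>H\<^esub> z"
    using scalar_subgroup assms by blast+
  show "y \<otimes>\<^bsub>H\<^esub> z = z \<otimes>\<^bsub>H\<^esub> y"
    if "x \<in> carrier H - carrier H \<inter> scalars2 R" "y \<in> carrier H" "z \<in> carrier H"
      "x \<otimes>\<^bsub>H\<^esub> y = y \<otimes>\<^bsub>H\<^esub> x" "x \<otimes>\<^bsub>H\<^esub> z = z \<otimes>\<^bsub>H\<^esub> x" for x y z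
    using that assms(2) unfolding mult by (intro commute_trans[of x y z]) auto
  have "mat2 \<one> \<one> \<zero> \<one> \<in> carrier H" "mat2 \<one> \<zero> \<one> \<one> \<in> carrier H"
    using assms(3) by (auto simp: carrier_SL2 subset_iff mat2_closed)
  moreover have "mat2 \<one> \<one> \<zero> \<one> \<otimes>\<^bsub>H\<^esub> mat2 \<one> \<zero> \<one> \<one> \<noteq> mat2 \<one> \<zero> \<one> \<one> \<otimes>\<^bsub>H\<^esub> mat2 \<one> \<one> \<zero> \<one>"
    using add.r_cancel_one[of \<one> \<one>] by (auto simp: mult mat2_mult)
  ultimately show "\<exists>a\<in>carrier H. \<exists>b\<in>carrier H. a \<otimes>\<^bsub>H\<^esub> b \<noteq> b \<otimes>\<^bsub>H\<^esub> a" by blast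
qed

lemma SL2_in_matrices:
  "carrier (SL2 R) \<subseteq> carrier (mat_monoid 2 R)" "\<one>\<^bsub>SL2 R\<^esub> = \<one>\<^bsub>mat_monoid 2 R\<^esub>"
  by (auto simp: carrier_SL2 SL2_simps mat_monoid_simps)

lemma SL2_in_GL2:
  "carrier (SL2 R) \<subseteq> carrier (GL 2 R)" "\<one>\<^bsub>GL 2 R\<^esub> = \<one>\<^bsub>mat_monoid 2 R\<^esub>"
proof -
  show "carrier (SL2 R) \<subseteq> carrier (GL 2 R)" by (auto simp: carrier_GL_2 carrier_SL2)
qed (simp add: GL_simps mat_monoid_simps)

lemma partition_PGL2: "has_nontrivial_partition (PGL2 R)"
  unfolding PGL2_def using partition_mod_scalars group_GL carrier_GL_subset SL2_in_GL2 GL_simps(2)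
  by blast

lemma partition_PSL2: "has_nontrivial_partition (PSL2 R)"
  unfolding PSL2_def using partition_mod_scalars group_SL2 SL2_in_matrices SL2_simps(1) by blast

lemma normal_GL2: "carrier (GL 2 R) \<inter> scalars2 R \<lhd> GL 2 R"
  using scalar_subgroup[OF group_GL carrier_GL_subset GL_simps(2) SL2_in_GL2(2)]
  by (intro group.central_subgroup_normal[OF group_GL])

lemma normal_SL2: "carrier (SL2 R) \<inter> scalars2 R \<lhd> SL2 R"
  using scalar_subgroup[OF group_SL2 SL2_in_matrices(1) SL2_simps(1) SL2_in_matrices(2)]
  by (intro group.central_subgroup_normal[OF group_SL2])

lemma card_scalars_GL2: "card (carrier (GL 2 R) \<inter> scalars2 R) = q - 1"
proof -
  have "carrier (GL 2 R) \<inter> scalars2 R = (\<lambda>s. mat2 s \<zero> \<zero> s) ` (carrier R - {\<zero>})"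
    by (auto simp: carrier_GL_2 scalars2_def scalar_mat_2 mat2_closed integral_iff)
  moreover have "inj_on (\<lambda>s. mat2 s \<zero> \<zero> s) (carrier R - {\<zero>})" by (auto intro: inj_onI)
  ultimately show ?thesis using card_nonzero by (simp add: card_image)
qed

lemma scalars_SL2: "carrier (SL2 R) \<inter> scalars2 R = {mat2 \<one> \<zero> \<zero> \<one>, mat2 (\<ominus> \<one>) \<zero> \<zero> (\<ominus> \<one>)}"
proof -
  have "s \<otimes> s = \<one> \<longleftrightarrow> s = \<one> \<or> s = \<ominus> \<one>" if "s \<in> carrier R" for s
  proof -
    have "s \<otimes> s \<ominus> \<one> = (s \<ominus> \<one>) \<otimes> (s \<ominus> \<ominus> \<one>)" using that by - (rule ring_eqI, (rule reify | simp)+)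
    hence "s \<otimes> s = \<one> \<longleftrightarrow> s \<ominus> \<one> = \<zero> \<or> s \<ominus> \<ominus> \<one> = \<zero>"
      using that integral_iff[of "s \<ominus> \<one>" "s \<ominus> \<ominus> \<one>"] by (metis a_inv_closed m_closed minus_closed one_closed r_right_minus_eq)
    thus ?thesis using that by (metis a_inv_closed one_closed r_right_minus_eq)
  qed
  thus ?thesis
    by (auto simp: carrier_SL2 scalars2_def scalar_mat_2 mat2_closed)
qed

lemma order_PGL2: "order (PGL2 R) = q * (q - 1) * (q + 1)"
proof -
  have "order (PGL2 R) * (q - 1) = (q * (q - 1) * (q + 1)) * (q - 1)"
    using group.order_quotient[OF group_GL normal_GL2 finite_GL2] card_scalars_GL2 order_GL2
    unfolding PGL2_def by (simp only: mult.commute mult.left_commute mult.assoc)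
  thus ?thesis using q_gt_1 by simp
qed

lemma order_PSL2: "order (PSL2 R) * card (carrier (SL2 R) \<inter> scalars2 R) = q * (q - 1) * (q + 1)"
  using group.order_quotient[OF group_SL2 normal_SL2 finite_SL2] order_SL2
  unfolding PSL2_def by simp

lemma group_PGL2: "group (PGL2 R)" and finite_PGL2: "finite (carrier (PGL2 R))"
  and group_PSL2: "group (PSL2 R)" and finite_PSL2: "finite (carrier (PSL2 R))"
  using partition_PGL2 partition_PSL2 unfolding has_nontrivial_partition_def by auto

text \<open>The matrices of trace \<open>\<tau>\<close> and determinant \<open>\<delta>\<close>, parametrized by three of their entries.\<close>

definition trace_det :: "'a \<Rightarrow> 'a \<Rightarrow> (nat \<times> nat \<Rightarrow> 'a) set" where
  "trace_det \<tau> \<delta> = (\<lambda>(a, b, c). mat2 a b c (\<tau> \<ominus> a)) `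
    {(a, b, c). a \<in> carrier R \<and> b \<in> carrier R \<and> c \<in> carrier R \<and> b \<otimes> c = a \<otimes> (\<tau> \<ominus> a) \<ominus> \<delta>}"

lemma card_trace_det:
  assumes "\<tau> \<in> carrier R" "\<delta> \<in> carrier R"
  shows "card (trace_det \<tau> \<delta>) = q * (q - 1) + q * card {a \<in> carrier R. a \<otimes> (\<tau> \<ominus> a) \<ominus> \<delta> = \<zero>}"
proof -
  let ?S = "{(a, b, c). a \<in> carrier R \<and> b \<in> carrier R \<and> c \<in> carrier R \<and> b \<otimes> c = a \<otimes> (\<tau> \<ominus> a) \<ominus> \<delta>}"
  have "inj_on (\<lambda>(a, b, c). mat2 a b c (\<tau> \<ominus> a)) ?S" by (auto intro!: inj_onI)
  hence "card (trace_det \<tau> \<delta>) = card ?S" unfolding trace_det_def by (rule card_image)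
  also have "\<dots> = card (carrier R) * (q - 1) + q * card {a \<in> carrier R. a \<otimes> (\<tau> \<ominus> a) \<ominus> \<delta> = \<zero>}"
    using assms by (intro card_fibered) auto
  finally show ?thesis by (simp add: order_def)
qed

lemma trace_det_elim:
  assumes "A \<in> trace_det \<tau> \<delta>"
  obtains a b c where "a \<in> carrier R" "b \<in> carrier R" "c \<in> carrier R"
    "b \<otimes> c = a \<otimes> (\<tau> \<ominus> a) \<ominus> \<delta>" "A = mat2 a b c (\<tau> \<ominus> a)"
  using assms unfolding trace_det_def by auto

lemma trace_det_closed:
  assumes "A \<in> trace_det \<tau> \<delta>" "\<tau> \<in> carrier R" "\<delta> \<in> carrier R"
  shows "A \<in> carrier (mat_monoid 2 R)" "det2 R A = \<delta>"
proof -
  obtain a b c where a: "a \<in> carrier R" "b \<in> carrier R" "c \<in> carrier R"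
    "b \<otimes> c = a \<otimes> (\<tau> \<ominus> a) \<ominus> \<delta>" "A = mat2 a b c (\<tau> \<ominus> a)" using assms(1) by (rule trace_det_elim)
  show "A \<in> carrier (mat_monoid 2 R)" using a assms by (auto intro: mat2_closed)
  have "a \<otimes> (\<tau> \<ominus> a) \<ominus> (a \<otimes> (\<tau> \<ominus> a) \<ominus> \<delta>) = \<delta>" using a(1-3) assms(2,3) by - (rule ring_eqI, (rule reify | simp)+)
  thus "det2 R A = \<delta>" using a by simp
qed

text \<open>The Cayley-Hamilton theorem for trace zero.\<close>

lemma trace_zero_square:
  assumes "A \<in> trace_det \<zero> \<delta>" "\<delta> \<in> carrier R"
  shows "A \<otimes>\<^bsub>mat_monoid 2 R\<^esub> A \<in> scalars2 R"
proof -
  obtain a b c where a: "a \<in> carrier R" "b \<in> carrier R" "c \<in> carrier R" "A = mat2 a b c (\<zero> \<ominus> a)"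
    using assms(1) by (rule trace_det_elim)
  have "a \<otimes> b \<oplus> b \<otimes> (\<zero> \<ominus> a) = \<zero>" "c \<otimes> a \<oplus> (\<zero> \<ominus> a) \<otimes> c = \<zero>"
    "c \<otimes> b \<oplus> (\<zero> \<ominus> a) \<otimes> (\<zero> \<ominus> a) = a \<otimes> a \<oplus> b \<otimes> c"
    using a(1-3) by - ((rule ring_eqI, (rule reify | simp)+)[1])+
  thus ?thesis unfolding scalars2_def scalar_mat_2 a(4) using a(1-3)
    by (auto simp: mat2_mult)
qed

text \<open>There are \<open>q ^ 3\<close> matrices of trace zero, and \<open>q\<^sup>2\<close> of them are singular. The remaining
  \<open>q\<^sup>2 (q - 1)\<close> square to scalars, and \<open>q - 1\<close> of them represent the same element of \<open>PGL(2,q)\<close>.\<close>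

lemma card_roots_PGL2: "q\<^sup>2 \<le> card (root_set 2 (PGL2 R))"
proof -
  interpret G: group "GL 2 R" by (rule group_GL)
  let ?S = "\<Union>\<delta>\<in>carrier R - {\<zero>}. trace_det \<zero> \<delta>"
  have S: "?S \<subseteq> carrier (GL 2 R)" using trace_det_closed by (auto simp: carrier_GL_2)
  have "A [^]\<^bsub>GL 2 R\<^esub> (2::nat) \<in> carrier (GL 2 R) \<inter> scalars2 R" if "A \<in> ?S" for A
  proof -
    have A: "A \<in> carrier (GL 2 R)" using that S by blast
    hence "A [^]\<^bsub>GL 2 R\<^esub> (2::nat) = A \<otimes>\<^bsub>GL 2 R\<^esub> A" by (rule G.pow_two)
    moreover have "A \<otimes>\<^bsub>GL 2 R\<^esub> A \<in> scalars2 R"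
      using that trace_zero_square by (auto simp: GL_simps(2))
    ultimately show ?thesis using A by auto
  qed
  hence "card ?S \<le> card (root_set 2 (PGL2 R)) * (q - 1)"
    using G.card_root_set_quotient[OF normal_GL2 finite_GL2 S] card_scalars_GL2
    unfolding PGL2_def by simp
  moreover have "card ?S = q * q * (q - 1)"
  proof -
    have fin: "finite (trace_det \<zero> \<delta>)" if "\<delta> \<in> carrier R" for \<delta>
      using that trace_det_closed(1)[of _ \<zero> \<delta>] finite_mats by (meson finite_subset subsetI zero_closed)
    have all: "card (\<Union>\<delta>\<in>carrier R. trace_det \<zero> \<delta>) = q * q * q"
    proof -
      have "(\<Union>\<delta>\<in>carrier R. trace_det \<zero> \<delta>) = (\<lambda>(a, b, c). mat2 a b c (\<zero> \<ominus> a)) ` (carrier R \<times> carrier R \<times> carrier R)"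
      proof safe
        fix \<delta> A assume "\<delta> \<in> carrier R" "A \<in> trace_det \<zero> \<delta>"
        then obtain a b c where "a \<in> carrier R" "b \<in> carrier R" "c \<in> carrier R"
          "A = mat2 a b c (\<zero> \<ominus> a)" by (metis trace_det_elim)
        thus "A \<in> (\<lambda>(a, b, c). mat2 a b c (\<zero> \<ominus> a)) ` (carrier R \<times> carrier R \<times> carrier R)"
          by (intro image_eqI[of _ _ "(a, b, c)"]) auto
      next
        fix a b c assume a: "a \<in> carrier R" "b \<in> carrier R" "c \<in> carrier R"
        have "b \<otimes> c = a \<otimes> (\<zero> \<ominus> a) \<ominus> (a \<otimes> (\<zero> \<ominus> a) \<ominus> b \<otimes> c)" using a by - (rule ring_eqI, (rule reify | simp)+)
        thus "mat2 a b c (\<zero> \<ominus> a) \<in> (\<Union>\<delta>\<in>carrier R. trace_det \<zero> \<delta>)"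
          unfolding trace_det_def using a
          by (intro UN_I[of "a \<otimes> (\<zero> \<ominus> a) \<ominus> b \<otimes> c"]) force+
      qed
      moreover have "inj_on (\<lambda>(a, b, c). mat2 a b c (\<zero> \<ominus> a)) (carrier R \<times> carrier R \<times> carrier R)"
        by (auto intro!: inj_onI)
      ultimately show ?thesis by (simp add: card_image card_cartesian_product order_def)
    qed
    have "?S = (\<Union>\<delta>\<in>carrier R. trace_det \<zero> \<delta>) - trace_det \<zero> \<zero>"
      using trace_det_closed(2) by (auto, metis zero_closed)
    hence "card ?S = q * q * q - card (trace_det \<zero> \<zero>)"
      using all fin by (simp add: card_Diff_subset UN_upper)
    also have "card (trace_det \<zero> \<zero>) = q * (q - 1) + q * card {a \<in> carrier R. a \<otimes> (\<zero> \<ominus> a) \<ominus> \<zero> = \<zero>}"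
      by (rule card_trace_det) auto
    also have "{a \<in> carrier R. a \<otimes> (\<zero> \<ominus> a) \<ominus> \<zero> = \<zero>} = {\<zero>}"
      by (auto simp: minus_eq integral_iff)
    finally have "card ?S = q * q * q - q * q"
      using q_gt_1 by (simp add: algebra_simps)
    thus ?thesis by (simp add: algebra_simps)
  qed
  ultimately have "(q * q) * (q - 1) \<le> card (root_set 2 (PGL2 R)) * (q - 1)" by simp
  thus ?thesis using q_gt_1 unfolding monoid_mult_class.power2_eq_square by simp
qed

lemma even_order_prod: "2 dvd q * (q - 1) * (q + 1)"
  by (cases "even q") auto

lemma breadth_PGL2: "q\<^sup>2 / 2 \<le> global_breadth (PGL2 R)"
  using global_breadth_ge_card[OF group_PGL2 finite_PGL2, of 2 "root_set 2 (PGL2 R)" "q\<^sup>2"]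
    card_roots_PGL2 order_PGL2 even_order_prod by simp

lemma order_PGL2_real: "real (order (PGL2 R)) = real q ^ 3 - real q"
proof -
  obtain m where "q = Suc m" using q_gt_1 by (cases q) auto
  thus ?thesis unfolding order_PGL2 by (simp add: algebra_simps eval_nat_numeral)
qed

theorem PGL2_large_breadth:
  shows "real (order (PGL2 R)) \<le> 2 * sqrt 2 * global_breadth (PGL2 R) * sqrt (global_breadth (PGL2 R))"
    and "q \<ge> 4 \<Longrightarrow> in_class_H (PGL2 R)"
proof -
  have "real (order (PGL2 R)) \<le> sqrt 2 ^ 3 * global_breadth (PGL2 R) * sqrt (global_breadth (PGL2 R))"
    by (rule order_le_power_three_halves[of _ "real q"])
       (use breadth_PGL2 order_PGL2_real in simp_all)
  also have "sqrt 2 ^ 3 = 2 * sqrt 2" by (simp add: eval_nat_numeral)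
  finally show "real (order (PGL2 R)) \<le> 2 * sqrt 2 * global_breadth (PGL2 R) * sqrt (global_breadth (PGL2 R))" .
  assume "q \<ge> 4"
  hence "real q ^ 3 - real q \<le> (real q)\<^sup>2 / 2 * ((real q)\<^sup>2 / 2 + 1)"
    by (intro cube_minus_le_half_square) simp
  thus "in_class_H (PGL2 R)"
    by (intro in_class_HI[OF group_PGL2 finite_PGL2 _ breadth_PGL2]) (simp_all add: order_PGL2_real)
qed

lemma trace_det_disjoint_scalars:
  assumes "\<tau> \<in> carrier R" "\<delta> \<in> carrier R" "s \<in> carrier R" "s \<oplus> s \<noteq> \<tau>"
  shows "mat2 s \<zero> \<zero> s \<notin> trace_det \<tau> \<delta>"
proof
  assume "mat2 s \<zero> \<zero> s \<in> trace_det \<tau> \<delta>"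
  then obtain a b c where a: "a \<in> carrier R" "b \<in> carrier R" "c \<in> carrier R"
    "mat2 s \<zero> \<zero> s = mat2 a b c (\<tau> \<ominus> a)" by (rule trace_det_elim)
  hence "s = \<tau> \<ominus> s" by (metis mat2_eq_iff)
  moreover have "s \<oplus> (\<tau> \<ominus> s) = \<tau>" using assms by - (rule ring_eqI, (rule reify | simp)+)
  ultimately show False using assms by metis
qed

lemma card_roots_PSL2:
  assumes "S \<subseteq> carrier (SL2 R)"
    and "\<And>A. A \<in> S \<Longrightarrow> A [^]\<^bsub>SL2 R\<^esub> (k::nat) \<in> scalars2 R"
  shows "card S \<le> card (root_set k (PSL2 R)) * card (carrier (SL2 R) \<inter> scalars2 R)"
proof -
  interpret G: group "SL2 R" by (rule group_SL2)
  show ?thesis unfolding PSL2_def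
    using assms by (intro G.card_root_set_quotient[OF normal_SL2 finite_SL2]) auto
qed

lemma trace_det_SL2: "\<tau> \<in> carrier R \<Longrightarrow> trace_det \<tau> \<one> \<subseteq> carrier (SL2 R)"
  using trace_det_closed by (auto simp: carrier_SL2)

lemma finite_trace_det: "\<tau> \<in> carrier R \<Longrightarrow> finite (trace_det \<tau> \<one>)"
  using trace_det_SL2 finite_SL2 finite_subset by blast

lemma trace_zero_pow:
  assumes "A \<in> trace_det \<zero> \<one>"
  shows "A [^]\<^bsub>SL2 R\<^esub> (2::nat) \<in> scalars2 R"
proof -
  interpret G: group "SL2 R" by (rule group_SL2)
  have "A \<in> carrier (SL2 R)" using assms trace_det_SL2 by blast
  hence "A [^]\<^bsub>SL2 R\<^esub> (2::nat) = A \<otimes>\<^bsub>SL2 R\<^esub> A" by (rule G.pow_two)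
  thus ?thesis using trace_zero_square[OF assms] by (simp add: SL2_simps)
qed

text \<open>In characteristic two the only scalar of determinant one is the identity, and the element \<open>1\<close> is a
  solution of \<open>a\<^sup>2 = -1\<close>, which raises the number of matrices of trace zero to \<open>q\<^sup>2\<close>.\<close>

lemma PSL2_char_two:
  assumes "\<one> \<oplus> \<one> = \<zero>"
  shows "order (PSL2 R) = q * (q - 1) * (q + 1)" "q\<^sup>2 \<le> card (root_set 2 (PSL2 R))"
proof -
  have "\<ominus> \<one> = \<one>" using assms by (metis a_inv_closed minus_equality one_closed)
  hence Z: "card (carrier (SL2 R) \<inter> scalars2 R) = 1" unfolding scalars_SL2 by simp
  thus "order (PSL2 R) = q * (q - 1) * (q + 1)" using order_PSL2 by simp
  let ?N = "{a \<in> carrier R. a \<otimes> (\<zero> \<ominus> a) \<ominus> \<one> = \<zero>}"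
  have "\<one> \<in> ?N" using \<open>\<ominus> \<one> = \<one>\<close> by (simp add: minus_eq r_neg assms)
  hence "card ?N \<ge> 1" by (metis (no_types, lifting) card_gt_0_iff empty_iff finite_Collect_conjI finite_carrier
    Suc_leI One_nat_def finite_subset mem_Collect_eq subsetI)
  hence "q * (q - 1) + q * 1 \<le> card (trace_det \<zero> \<one>)"
    using card_trace_det[of \<zero> \<one>] by simp
  moreover have "q * (q - 1) + q * 1 = q * q" using q_gt_1 by (cases q) simp_all
  moreover have "card (trace_det \<zero> \<one>) \<le> card (root_set 2 (PSL2 R)) * card (carrier (SL2 R) \<inter> scalars2 R)"
    by (rule card_roots_PSL2) (use trace_det_SL2 trace_zero_pow in auto)
  ultimately show "q\<^sup>2 \<le> card (root_set 2 (PSL2 R))" unfolding monoid_mult_class.power2_eq_square Z by simp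
qed

text \<open>Here the center of \<open>SL(2,q)\<close> is \<open>{1, -1}\<close>. Besides the matrices of trace zero the two central
  elements have a central square; without them the resulting bound would just miss the class \<open>H\<close> for \<open>q = 9\<close>.\<close>

lemma PSL2_odd_characteristic:
  assumes "\<one> \<oplus> \<one> \<noteq> \<zero>"
  shows "card (carrier (SL2 R) \<inter> scalars2 R) = 2"
    and "order (PSL2 R) * 2 = q * (q - 1) * (q + 1)" and "odd q" and "even (order (PSL2 R))"
    and "card (trace_det \<zero> \<one>) + 2 \<le> card (root_set 2 (PSL2 R)) * 2"
proof -
  have ne: "\<ominus> \<one> \<noteq> \<one>" using assms by (metis one_closed r_neg)
  thus Z: "card (carrier (SL2 R) \<inter> scalars2 R) = 2" unfolding scalars_SL2 by simp
  thus ord: "order (PSL2 R) * 2 = q * (q - 1) * (q + 1)" using order_PSL2 by simp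
  show "odd q" using char_two_if_even assms by blast
  then obtain m where m: "q = 2 * m + 1" by (rule oddE)
  have "order (PSL2 R) * 2 = (2 * (m * (m + 1) * q)) * 2"
    unfolding ord m by (simp add: algebra_simps)
  hence "order (PSL2 R) = 2 * (m * (m + 1) * q)" by simp
  thus "even (order (PSL2 R))" by simp
  let ?Z = "{mat2 \<one> \<zero> \<zero> \<one>, mat2 (\<ominus> \<one>) \<zero> \<zero> (\<ominus> \<one>)}"
  have "\<ominus> \<one> \<oplus> \<ominus> \<one> \<noteq> \<zero>" using assms ne by (metis a_inv_closed local.minus_minus minus_equality one_closed)
  hence "trace_det \<zero> \<one> \<inter> ?Z = {}"
    using trace_det_disjoint_scalars[of \<zero> \<one>] assms by auto
  hence "card (trace_det \<zero> \<one> \<union> ?Z) = card (trace_det \<zero> \<one>) + card ?Z"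
    using finite_trace_det by (intro card_Un_disjoint) auto
  moreover have "card ?Z = 2" using Z scalars_SL2 by simp
  moreover have "card (trace_det \<zero> \<one> \<union> ?Z) \<le> card (root_set 2 (PSL2 R)) * card (carrier (SL2 R) \<inter> scalars2 R)"
  proof (rule card_roots_PSL2)
    have "?Z \<subseteq> carrier (SL2 R)" using scalars_SL2 by blast
    thus "trace_det \<zero> \<one> \<union> ?Z \<subseteq> carrier (SL2 R)" using trace_det_SL2 by blast
    interpret G: group "SL2 R" by (rule group_SL2)
    interpret N: normal "carrier (SL2 R) \<inter> scalars2 R" "SL2 R" by (rule normal_SL2)
    fix A assume A: "A \<in> trace_det \<zero> \<one> \<union> ?Z"
    show "A [^]\<^bsub>SL2 R\<^esub> (2::nat) \<in> scalars2 R"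
    proof (cases "A \<in> ?Z")
      case True
      hence "A \<in> carrier (SL2 R) \<inter> scalars2 R" using scalars_SL2 by simp
      hence "A [^]\<^bsub>SL2 R\<^esub> (2::nat) \<in> carrier (SL2 R) \<inter> scalars2 R"
        using G.pow_two[of A] N.m_closed[of A A] by auto
      thus ?thesis by blast
    qed (use A trace_zero_pow in blast)
  qed
  ultimately show "card (trace_det \<zero> \<one>) + 2 \<le> card (root_set 2 (PSL2 R)) * 2"
    unfolding Z by linarith
qed

text \<open>By the Cayley-Hamilton theorem \<open>A\<^sup>2 = \<tau> A - 1\<close>, so \<open>A ^ 3 = (\<tau>\<^sup>2 - 1) A - \<tau> = - \<tau>\<close>.\<close>

lemma trace_one_cube:
  assumes "A \<in> trace_det \<tau> \<one>" "\<tau> = \<one> \<or> \<tau> = \<ominus> \<one>"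
  shows "A [^]\<^bsub>SL2 R\<^esub> (3::nat) \<in> scalars2 R"
proof -
  interpret G: group "SL2 R" by (rule group_SL2)
  have \<tau>: "\<tau> \<in> carrier R" "\<tau> \<otimes> \<tau> = \<one>" using assms(2) by (auto simp: l_minus)
  obtain a b c where a: "a \<in> carrier R" "b \<in> carrier R" "c \<in> carrier R"
    "b \<otimes> c = a \<otimes> (\<tau> \<ominus> a) \<ominus> \<one>" "A = mat2 a b c (\<tau> \<ominus> a)" using assms(1) by (rule trace_det_elim)
  let ?d = "\<tau> \<ominus> a"
  have 1: "a \<otimes> a \<oplus> b \<otimes> c = \<tau> \<otimes> a \<ominus> \<one>" "a \<otimes> b \<oplus> b \<otimes> ?d = \<tau> \<otimes> b"
    "c \<otimes> a \<oplus> ?d \<otimes> c = \<tau> \<otimes> c"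
    using a(1-3) \<tau>(1) by - ((rule ring_eqI1[OF a(4)], (rule reify | simp)+)[1])+
  have 4: "c \<otimes> b \<oplus> ?d \<otimes> ?d = \<tau> \<otimes> ?d \<ominus> \<one>"
  proof -
    have "c \<otimes> b = a \<otimes> (\<tau> \<ominus> a) \<ominus> \<one>" using a m_comm by simp
    thus ?thesis using a(1-3) \<tau>(1) by simp (rule ring_eqI, (rule reify | simp)+)
  qed
  have 5: "(\<tau> \<otimes> a \<ominus> \<one>) \<otimes> a \<oplus> (\<tau> \<otimes> b) \<otimes> c = \<tau> \<otimes> \<tau> \<otimes> a \<ominus> a \<ominus> \<tau>"
    "(\<tau> \<otimes> a \<ominus> \<one>) \<otimes> b \<oplus> (\<tau> \<otimes> b) \<otimes> ?d = \<tau> \<otimes> \<tau> \<otimes> b \<ominus> b"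
    "(\<tau> \<otimes> c) \<otimes> a \<oplus> (\<tau> \<otimes> ?d \<ominus> \<one>) \<otimes> c = \<tau> \<otimes> \<tau> \<otimes> c \<ominus> c"
    "(\<tau> \<otimes> c) \<otimes> b \<oplus> (\<tau> \<otimes> ?d \<ominus> \<one>) \<otimes> ?d = (\<tau> \<otimes> \<tau> \<ominus> \<one>) \<otimes> ?d \<ominus> \<tau>"
    using a(1-3) \<tau>(1) by - ((rule ring_eqI1[OF a(4)], (rule reify | simp)+)[1])+
  have "A \<otimes>\<^bsub>mat_monoid 2 R\<^esub> A = mat2 (\<tau> \<otimes> a \<ominus> \<one>) (\<tau> \<otimes> b) (\<tau> \<otimes> c) (\<tau> \<otimes> ?d \<ominus> \<one>)"
    unfolding a(5) using a(1-3) \<tau>(1) 1 4 by (simp add: mat2_mult)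
  hence "A \<otimes>\<^bsub>mat_monoid 2 R\<^esub> A \<otimes>\<^bsub>mat_monoid 2 R\<^esub> A = mat2 (\<ominus> \<tau>) \<zero> \<zero> (\<ominus> \<tau>)"
    unfolding a(5) using a(1-3) \<tau> 5 by (simp add: mat2_mult) (simp add: minus_eq r_neg)
  moreover have "A \<in> carrier (SL2 R)" using assms trace_det_SL2 \<tau> by blast
  ultimately show ?thesis
    using G.pow_three[of A] \<tau> by (simp add: SL2_simps scalars2_def scalar_mat_2)
qed

lemma breadth_PSL2_odd:
  assumes "\<one> \<oplus> \<one> \<noteq> \<zero>"
  shows "(real q * (real q - 1) + 2) / 4 \<le> global_breadth (PSL2 R)"
proof -
  let ?r = "card (root_set 2 (PSL2 R))"
  have "real q * (real q - 1) + 2 \<le> real (card (trace_det \<zero> \<one>) + 2)"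
    using card_trace_det[of \<zero> \<one>] q_gt_1 by (simp add: of_nat_diff)
  also have "\<dots> \<le> real (?r * 2)" using PSL2_odd_characteristic(5)[OF assms] by (intro of_nat_mono)
  finally have "(real q * (real q - 1) + 2) / 4 \<le> real ?r / 2" by simp
  thus ?thesis
    using global_breadth_ge_card[OF group_PSL2 finite_PSL2, of 2 "root_set 2 (PSL2 R)" ?r]
      PSL2_odd_characteristic(4)[OF assms] by simp
qed

lemma order_PSL2_real:
  assumes "\<one> \<oplus> \<one> \<noteq> \<zero>"
  shows "real (order (PSL2 R)) = (real q ^ 3 - real q) / 2"
proof -
  obtain m where "q = Suc m" using q_gt_1 by (cases q) auto
  hence "real (q * (q - 1) * (q + 1)) = real q ^ 3 - real q"
    by (simp add: algebra_simps eval_nat_numeral)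
  moreover have "real (order (PSL2 R) * 2) = real (q * (q - 1) * (q + 1))"
    using PSL2_odd_characteristic(2)[OF assms] by (rule arg_cong)
  ultimately show ?thesis by simp
qed

lemma two_squared_of_five_elements:
  assumes "q = 5"
  shows "(\<one> \<oplus> \<one>) \<otimes> (\<one> \<oplus> \<one>) = \<ominus> \<one>"
proof -
  have "[order (add_monoid R)] \<cdot> \<one> = \<zero>"
    using group.pow_order_eq_1[OF a_group, of \<one>] by (simp add: add_pow_def)
  hence "[(5::nat)] \<cdot> \<one> = \<zero>" using assms by (simp add: order_def)
  hence "\<one> \<oplus> \<one> \<oplus> \<one> \<oplus> \<one> \<oplus> \<one> = \<zero>" by (simp add: eval_nat_numeral)
  moreover have "\<one> \<oplus> \<one> \<oplus> \<one> \<oplus> \<one> \<oplus> \<one> = (\<one> \<oplus> \<one>) \<otimes> (\<one> \<oplus> \<one>) \<oplus> \<one>"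
    by (simp add: l_distr r_distr a_assoc)
  ultimately show ?thesis by (metis a_closed m_closed minus_equality one_closed)
qed

text \<open>For odd \<open>q \<ge> 9\<close> the generic bound for \<open>k = 2\<close> suffices; with \<open>q = x + 9\<close> the difference of the two sides
  is a polynomial in \<open>x\<close> with positive coefficients. The cases 5 and 7 need the finer counts.\<close>

lemma PSL2_in_class_H:
  assumes "q \<ge> 4"
  shows "in_class_H (PSL2 R)"
proof (cases "\<one> \<oplus> \<one> = \<zero>")
  case True
  have b: "real q ^ 2 / 2 \<le> global_breadth (PSL2 R)"
    using global_breadth_ge_card[OF group_PSL2 finite_PSL2, of 2 "root_set 2 (PSL2 R)" "q\<^sup>2"]
      PSL2_char_two[OF True] even_order_prod by simp
  have o: "order (PSL2 R) = order (PGL2 R)" using PSL2_char_two[OF True] order_PGL2 by simp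
  have "real q ^ 3 - real q \<le> (real q)\<^sup>2 / 2 * ((real q)\<^sup>2 / 2 + 1)"
    using assms by (intro cube_minus_le_half_square) simp
  thus ?thesis
    by (intro in_class_HI[OF group_PSL2 finite_PSL2 _ b]) (simp_all add: o order_PGL2_real)
next
  case False
  have o: "real (order (PSL2 R)) = (real q ^ 3 - real q) / 2" by (rule order_PSL2_real[OF False])
  have "q = 5 \<or> q = 7 \<or> q \<ge> 9"
    using PSL2_odd_characteristic(3)[OF False] assms by presburger
  thus ?thesis
  proof (elim disjE)
    assume q5: "q = 5"
    \<comment> \<open>The two square roots of \<open>-1\<close> raise the number of matrices of trace zero from 20 to 30.\<close>
    let ?N = "{a \<in> carrier R. a \<otimes> (\<zero> \<ominus> a) \<ominus> \<one> = \<zero>}"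
    let ?t = "\<one> \<oplus> \<one>"
    have "?t \<otimes> ?t = \<ominus> \<one>" by (rule two_squared_of_five_elements[OF q5])
    hence "?t \<in> ?N" "\<ominus> ?t \<in> ?N"
      by (simp_all add: minus_eq l_minus r_minus r_neg del: minus_add)
    moreover have "?t \<noteq> \<ominus> ?t"
    proof
      assume "?t = \<ominus> ?t"
      hence "?t \<oplus> ?t = \<zero>" by (metis a_closed one_closed r_neg)
      moreover have "?t \<oplus> ?t = ?t \<otimes> ?t" by (simp add: l_distr)
      ultimately show False using False integral_iff[of ?t ?t] by simp
    qed
    ultimately have "card {?t, \<ominus> ?t} \<le> card ?N" "card {?t, \<ominus> ?t} = 2"
      by (intro card_mono, auto)
    hence "32 \<le> card (trace_det \<zero> \<one>) + 2" using card_trace_det[of \<zero> \<one>] q5 by simp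
    hence "16 \<le> card (root_set 2 (PSL2 R))" using PSL2_odd_characteristic(5)[OF False] by simp
    hence "8 \<le> global_breadth (PSL2 R)"
      using global_breadth_ge_card[OF group_PSL2 finite_PSL2, of 2 "root_set 2 (PSL2 R)" 16]
        PSL2_odd_characteristic(4)[OF False] by simp
    thus ?thesis
      by (intro in_class_HI[OF group_PSL2 finite_PSL2, of 8]) (simp_all add: o q5)
  next
    assume q7: "q = 7"
    \<comment> \<open>The order is 168. The exponent two gives only the bound 11, but the elements of order three, lifted to
      the traces \<open>1\<close> and \<open>-1\<close>, give at least 14.\<close>
    have ne: "\<ominus> \<one> \<noteq> \<one>" using False by (metis one_closed r_neg)
    have "trace_det \<one> \<one> \<inter> trace_det (\<ominus> \<one>) \<one> = {}"
    proof (rule ccontr)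
      assume "trace_det \<one> \<one> \<inter> trace_det (\<ominus> \<one>) \<one> \<noteq> {}"
      then obtain A where "A \<in> trace_det \<one> \<one>" "A \<in> trace_det (\<ominus> \<one>) \<one>" by blast
      then obtain a where "a \<in> carrier R" "\<one> \<ominus> a = \<ominus> \<one> \<ominus> a"
        by (metis mat2_eq_iff trace_det_elim)
      thus False using ne by (simp add: minus_eq)
    qed
    hence "card (trace_det \<one> \<one> \<union> trace_det (\<ominus> \<one>) \<one>) = card (trace_det \<one> \<one>) + card (trace_det (\<ominus> \<one>) \<one>)"
      using finite_trace_det by (intro card_Un_disjoint) auto
    also have "\<dots> \<ge> 84"
      using card_trace_det[of \<one> \<one>] card_trace_det[of "\<ominus> \<one>" \<one>] q7 by simp
    finally have "84 \<le> card (trace_det \<one> \<one> \<union> trace_det (\<ominus> \<one>) \<one>)" .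
    also have "\<dots> \<le> card (root_set 3 (PSL2 R)) * card (carrier (SL2 R) \<inter> scalars2 R)"
      by (rule card_roots_PSL2) (use trace_det_SL2 trace_one_cube in auto)
    finally have "42 \<le> card (root_set 3 (PSL2 R))" using PSL2_odd_characteristic(1)[OF False] by simp
    moreover have "3 dvd order (PSL2 R)" using PSL2_odd_characteristic(2)[OF False] q7 by simp
    ultimately have "14 \<le> global_breadth (PSL2 R)"
      using global_breadth_ge_card[OF group_PSL2 finite_PSL2, of 3 "root_set 3 (PSL2 R)" 42] by simp
    thus ?thesis
      by (intro in_class_HI[OF group_PSL2 finite_PSL2, of 14]) (simp_all add: o q7)
  next
    assume q9: "q \<ge> 9"
    define x where "x = real q - 9"
    have x: "real q = x + 9" "x \<ge> 0" using q9 unfolding x_def by auto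
    let ?b = "(real q * (real q - 1) + 2) / 4"
    have "(real q ^ 3 - real q) / 2 \<le> ?b * (?b + 1)"
    proof -
      have "?b * (?b + 1) - (real q ^ 3 - real q) / 2
          = (x ^ 4 + 26 * x ^ 3 + 225 * x ^ 2 + 648 * x + 12) / 16"
        unfolding x by (simp add: field_simps eval_nat_numeral)
      also have "\<dots> \<ge> 0" using x by simp
      finally show ?thesis by simp
    qed
    moreover have "0 \<le> ?b" using q9 by simp
    ultimately show ?thesis
      by (intro in_class_HI[OF group_PSL2 finite_PSL2 _ breadth_PSL2_odd[OF False]]) (simp_all add: o)
  qed
qed

text \<open>The constant is \<open>3 ^ 3\<close>: for \<open>q \<ge> 5\<close> the breadth is at least \<open>q\<^sup>2 / 9\<close>.\<close>

lemma PSL2_bound: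
  assumes "q \<ge> 5"
  shows "real (order (PSL2 R)) \<le> 27 * global_breadth (PSL2 R) * sqrt (global_breadth (PSL2 R))"
proof -
  have q: "5 * real q \<le> real q * real q" using assms by (intro mult_right_mono) auto
  have "(real q)\<^sup>2 / 3\<^sup>2 \<le> global_breadth (PSL2 R) \<and> real (order (PSL2 R)) \<le> real q ^ 3"
  proof (cases "\<one> \<oplus> \<one> = \<zero>")
    case True
    have b: "real q ^ 2 / 2 \<le> global_breadth (PSL2 R)"
      using global_breadth_ge_card[OF group_PSL2 finite_PSL2, of 2 "root_set 2 (PSL2 R)" "q\<^sup>2"]
        PSL2_char_two[OF True] even_order_prod by simp
    have "order (PSL2 R) = order (PGL2 R)" using PSL2_char_two[OF True] order_PGL2 by simp
    moreover have "(real q)\<^sup>2 / 3\<^sup>2 \<le> (real q)\<^sup>2 / 2" by simp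
    hence "(real q)\<^sup>2 / 3\<^sup>2 \<le> global_breadth (PSL2 R)" using b by linarith
    ultimately show ?thesis using order_PGL2_real by simp
  next
    case False
    have "(real q ^ 3 - real q) / 2 \<le> real q ^ 3"
      using zero_le_power[of "real q" 3] by (simp add: field_simps)
    hence "real (order (PSL2 R)) \<le> real q ^ 3" unfolding order_PSL2_real[OF False] .
    moreover have "(real q)\<^sup>2 / 9 \<le> (real q * (real q - 1) + 2) / 4"
      using q by (simp add: monoid_mult_class.power2_eq_square right_diff_distrib)
    ultimately show ?thesis using breadth_PSL2_odd[OF False] by simp
  qed
  hence "real (order (PSL2 R)) \<le> 3 ^ 3 * global_breadth (PSL2 R) * sqrt (global_breadth (PSL2 R))"
    by (intro order_le_power_three_halves[of _ "real q"]) auto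
  thus ?thesis by simp
qed

end

section \<open>Four by four matrices\<close>

lemma less_4_cases: "(i::nat) < 4 \<Longrightarrow> i = 0 \<or> i = 1 \<or> i = 2 \<or> i = 3"
  by auto

lemma mat4_closed:
  assumes "{a00, a01, a02, a03, a10, a11, a12, a13, a20, a21, a22, a23, a30, a31, a32, a33} \<subseteq> carrier R"
  shows "mat_of_rows 4 [[a00, a01, a02, a03], [a10, a11, a12, a13], [a20, a21, a22, a23], [a30, a31, a32, a33]]
    \<in> carrier (mat_monoid 4 R)"
proof -
  let ?A = "mat_of_rows 4 [[a00, a01, a02, a03], [a10, a11, a12, a13], [a20, a21, a22, a23], [a30, a31, a32, a33]]"
  have "?A (i, j) \<in> carrier R" if "i < 4" "j < 4" for i j
    using less_4_cases[OF that(1)] less_4_cases[OF that(2)] assms by auto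
  thus ?thesis unfolding mat_monoid_simps by (auto simp: mat_of_rows_def)
qed

lemma (in ring) mat4_mult:
  assumes "{a00, a01, a02, a03, a10, a11, a12, a13, a20, a21, a22, a23, a30, a31, a32, a33} \<subseteq> carrier R"
    and "{b00, b01, b02, b03, b10, b11, b12, b13, b20, b21, b22, b23, b30, b31, b32, b33} \<subseteq> carrier R"
  shows "mat_of_rows 4 [[a00, a01, a02, a03], [a10, a11, a12, a13], [a20, a21, a22, a23], [a30, a31, a32, a33]]
    \<otimes>\<^bsub>mat_monoid 4 R\<^esub>
    mat_of_rows 4 [[b00, b01, b02, b03], [b10, b11, b12, b13], [b20, b21, b22, b23], [b30, b31, b32, b33]]
    = mat_of_rows 4
      [[a00 \<otimes> b00 \<oplus> a01 \<otimes> b10 \<oplus> a02 \<otimes> b20 \<oplus> a03 \<otimes> b30, a00 \<otimes> b01 \<oplus> a01 \<otimes> b11 \<oplus> a02 \<otimes> b21 \<oplus> a03 \<otimes> b31,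
        a00 \<otimes> b02 \<oplus> a01 \<otimes> b12 \<oplus> a02 \<otimes> b22 \<oplus> a03 \<otimes> b32, a00 \<otimes> b03 \<oplus> a01 \<otimes> b13 \<oplus> a02 \<otimes> b23 \<oplus> a03 \<otimes> b33],
       [a10 \<otimes> b00 \<oplus> a11 \<otimes> b10 \<oplus> a12 \<otimes> b20 \<oplus> a13 \<otimes> b30, a10 \<otimes> b01 \<oplus> a11 \<otimes> b11 \<oplus> a12 \<otimes> b21 \<oplus> a13 \<otimes> b31,
        a10 \<otimes> b02 \<oplus> a11 \<otimes> b12 \<oplus> a12 \<otimes> b22 \<oplus> a13 \<otimes> b32, a10 \<otimes> b03 \<oplus> a11 \<otimes> b13 \<oplus> a12 \<otimes> b23 \<oplus> a13 \<otimes> b33],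
       [a20 \<otimes> b00 \<oplus> a21 \<otimes> b10 \<oplus> a22 \<otimes> b20 \<oplus> a23 \<otimes> b30, a20 \<otimes> b01 \<oplus> a21 \<otimes> b11 \<oplus> a22 \<otimes> b21 \<oplus> a23 \<otimes> b31,
        a20 \<otimes> b02 \<oplus> a21 \<otimes> b12 \<oplus> a22 \<otimes> b22 \<oplus> a23 \<otimes> b32, a20 \<otimes> b03 \<oplus> a21 \<otimes> b13 \<oplus> a22 \<otimes> b23 \<oplus> a23 \<otimes> b33],
       [a30 \<otimes> b00 \<oplus> a31 \<otimes> b10 \<oplus> a32 \<otimes> b20 \<oplus> a33 \<otimes> b30, a30 \<otimes> b01 \<oplus> a31 \<otimes> b11 \<oplus> a32 \<otimes> b21 \<oplus> a33 \<otimes> b31,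
        a30 \<otimes> b02 \<oplus> a31 \<otimes> b12 \<oplus> a32 \<otimes> b22 \<oplus> a33 \<otimes> b32, a30 \<otimes> b03 \<oplus> a31 \<otimes> b13 \<oplus> a32 \<otimes> b23 \<oplus> a33 \<otimes> b33]]"
    (is "?A \<otimes>\<^bsub>_\<^esub> ?B = ?C")
proof (rule mat_monoid_eqI[of _ 4 R])
  fix i j :: nat assume ij: "i < 4" "j < 4"
  have "(?A \<otimes>\<^bsub>mat_monoid 4 R\<^esub> ?B) (i, j) = ?A (i, 0) \<otimes> ?B (0, j) \<oplus> ?A (i, 1) \<otimes> ?B (1, j)
      \<oplus> ?A (i, 2) \<otimes> ?B (2, j) \<oplus> ?A (i, 3) \<otimes> ?B (3, j)"
    unfolding mat_monoid_mult_entry[OF ij]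
    using mat4_closed[OF assms(1)] mat4_closed[OF assms(2)] ij
    by (intro finsum_lessThan_4 m_closed) (auto intro!: mat_entry_closed[of _ 4 R] simp del: mat_of_rows_entry)
  also have "\<dots> = ?C (i, j)"
    using less_4_cases[OF ij(1)] less_4_cases[OF ij(2)]
    by (elim disjE; simp)
  finally show "(?A \<otimes>\<^bsub>mat_monoid 4 R\<^esub> ?B) (i, j) = ?C (i, j)" .
next
  show "?A \<otimes>\<^bsub>mat_monoid 4 R\<^esub> ?B \<in> carrier (mat_monoid 4 R)"
    by (intro mat_mult_closed mat4_closed assms)
  show "?C \<in> carrier (mat_monoid 4 R)"
    using assms by (intro mat4_closed) simp
qed

lemma mat4_eqI:
  assumes "a00 = b00" "a01 = b01" "a02 = b02" "a03 = b03" "a10 = b10" "a11 = b11" "a12 = b12" "a13 = b13"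
    "a20 = b20" "a21 = b21" "a22 = b22" "a23 = b23" "a30 = b30" "a31 = b31" "a32 = b32" "a33 = b33"
  shows "mat_of_rows 4 [[a00, a01, a02, a03], [a10, a11, a12, a13], [a20, a21, a22, a23], [a30, a31, a32, a33]]
    = mat_of_rows 4 [[b00, b01, b02, b03], [b10, b11, b12, b13], [b20, b21, b22, b23], [b30, b31, b32, b33]]"
  using assms by simp

lemma scalar_mat_4: "scalar_mat 4 R c = mat_of_rows 4
  [[c, \<zero>\<^bsub>R\<^esub>, \<zero>\<^bsub>R\<^esub>, \<zero>\<^bsub>R\<^esub>], [\<zero>\<^bsub>R\<^esub>, c, \<zero>\<^bsub>R\<^esub>, \<zero>\<^bsub>R\<^esub>], [\<zero>\<^bsub>R\<^esub>, \<zero>\<^bsub>R\<^esub>, c, \<zero>\<^bsub>R\<^esub>], [\<zero>\<^bsub>R\<^esub>, \<zero>\<^bsub>R\<^esub>, \<zero>\<^bsub>R\<^esub>, c]]"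
  (is "_ = ?B")
proof
  fix p :: "nat \<times> nat"
  obtain i j where p: "p = (i, j)" by (cases p)
  show "scalar_mat 4 R c p = ?B p"
  proof (cases "i < 4 \<and> j < 4")
    case True
    thus ?thesis unfolding p using less_4_cases[of i] less_4_cases[of j]
      by (elim conjE disjE) (auto simp: scalar_mat_entry)
  next
    case False
    thus ?thesis unfolding p by (auto simp: scalar_mat_def mat_of_rows_def)
  qed
qed

section \<open>Matrix identities behind the Suzuki groups\<close>

context field
begin

text \<open>Suzuki's generators with all values of field automorphisms and inverses replaced by independent
  variables: \<open>\<alpha>\<close>, \<open>\<beta>\<close>, \<open>\<nu>\<close> stand for the images of \<open>a\<close>, \<open>b\<close>, \<open>\<mu>\<close>, and \<open>w\<close>, \<open>v\<close> for the inverses of \<open>\<mu>\<close>, \<open>\<nu>\<close>.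
  This turns the relations between the generators into polynomial identities.\<close>

definition unip :: "'a \<Rightarrow> 'a \<Rightarrow> 'a \<Rightarrow> 'a \<Rightarrow> nat \<times> nat \<Rightarrow> 'a" where
  "unip a \<alpha> b \<beta> = mat_of_rows 4
    [[\<one>, \<zero>, \<zero>, \<zero>], [a, \<one>, \<zero>, \<zero>], [b, \<alpha>, \<one>, \<zero>],
     [a [^] (2::nat) \<otimes> \<alpha> \<oplus> a \<otimes> b \<oplus> \<beta>, a \<otimes> \<alpha> \<oplus> b, a, \<one>]]"

definition diag :: "'a \<Rightarrow> 'a \<Rightarrow> 'a \<Rightarrow> 'a \<Rightarrow> nat \<times> nat \<Rightarrow> 'a" where
  "diag \<mu> \<nu> w v = mat_of_rows 4
    [[\<mu> \<otimes> \<nu>, \<zero>, \<zero>, \<zero>], [\<zero>, \<mu>, \<zero>, \<zero>], [\<zero>, \<zero>, w, \<zero>], [\<zero>, \<zero>, \<zero>, w \<otimes> v]]"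

definition flip :: "nat \<times> nat \<Rightarrow> 'a" where
  "flip = mat_of_rows 4
    [[\<zero>, \<zero>, \<zero>, \<one>], [\<zero>, \<zero>, \<one>, \<zero>], [\<zero>, \<one>, \<zero>, \<zero>], [\<one>, \<zero>, \<zero>, \<zero>]]"

lemma unip_mult:
  assumes c: "\<one> \<oplus> \<one> = \<zero>" and "a \<in> carrier R" "\<alpha> \<in> carrier R" "b \<in> carrier R" "\<beta> \<in> carrier R"
    "c \<in> carrier R" "\<gamma> \<in> carrier R" "d \<in> carrier R" "\<delta> \<in> carrier R"
  shows "unip a \<alpha> b \<beta> \<otimes>\<^bsub>mat_monoid 4 R\<^esub> unip c \<gamma> d \<delta>
    = unip (a \<oplus> c) (\<alpha> \<oplus> \<gamma>) (b \<oplus> d \<oplus> \<alpha> \<otimes> c) (\<beta> \<oplus> \<delta> \<oplus> a [^] (2::nat) \<otimes> \<gamma>)"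
  unfolding unip_def
  apply (subst mat4_mult) using assms(2-) apply simp using assms(2-) apply simp
  by (rule mat4_eqI; ((simp add: assms(2-); fail) | (rule ring_eqI1[OF c], (rule reify | simp add: assms(2-))+)))

lemma diag_mult:
  assumes "\<mu> \<in> carrier R" "\<nu> \<in> carrier R" "w \<in> carrier R" "v \<in> carrier R"
    "\<mu>' \<in> carrier R" "\<nu>' \<in> carrier R" "w' \<in> carrier R" "v' \<in> carrier R"
  shows "diag \<mu> \<nu> w v \<otimes>\<^bsub>mat_monoid 4 R\<^esub> diag \<mu>' \<nu>' w' v' = diag (\<mu> \<otimes> \<mu>') (\<nu> \<otimes> \<nu>') (w \<otimes> w') (v \<otimes> v')"
  unfolding diag_def
  apply (subst mat4_mult) using assms apply simp using assms apply simp
  by (rule mat4_eqI; ((simp add: assms; fail) | (rule ring_eqI, (rule reify | simp add: assms)+)))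

lemma unip_diag:
  assumes wm: "w \<otimes> \<mu> = \<one>" and vn: "v \<otimes> \<nu> = \<one>" and \<alpha>: "\<mu> \<in> carrier R" "\<nu> \<in> carrier R" "w \<in> carrier R" "v \<in> carrier R"
    "a \<in> carrier R" "\<alpha> \<in> carrier R" "b \<in> carrier R" "\<beta> \<in> carrier R"
  shows "diag \<mu> \<nu> w v \<otimes>\<^bsub>mat_monoid 4 R\<^esub> unip (\<nu> \<otimes> a) (\<mu> \<otimes> \<mu> \<otimes> \<alpha>) (\<mu> \<otimes> \<mu> \<otimes> \<nu> \<otimes> b) (\<nu> \<otimes> \<nu> \<otimes> \<mu> \<otimes> \<mu> \<otimes> \<beta>)
    = unip a \<alpha> b \<beta> \<otimes>\<^bsub>mat_monoid 4 R\<^esub> diag \<mu> \<nu> w v"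
  unfolding unip_def diag_def
  apply (subst mat4_mult) using \<alpha> apply simp using \<alpha> apply simp
  apply (subst mat4_mult) using \<alpha> apply simp using \<alpha> apply simp
  by (rule mat4_eqI; ((simp add: \<alpha>; fail) | (rule ring_eqI2[OF wm vn], (rule reify | simp add: \<alpha>)+)))

lemma flip_flip: "flip \<otimes>\<^bsub>mat_monoid 4 R\<^esub> flip = scalar_mat 4 R \<one>"
  unfolding flip_def scalar_mat_4
  by (subst mat4_mult) simp_all

lemma flip_diag_flip:
  assumes wm: "w \<otimes> \<mu> = \<one>" and vn: "v \<otimes> \<nu> = \<one>" and \<alpha>: "\<mu> \<in> carrier R" "\<nu> \<in> carrier R" "w \<in> carrier R" "v \<in> carrier R"
  shows "flip \<otimes>\<^bsub>mat_monoid 4 R\<^esub> diag \<mu> \<nu> w v \<otimes>\<^bsub>mat_monoid 4 R\<^esub> flip = diag w v \<mu> \<nu>"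
  unfolding flip_def diag_def
  apply (subst mat4_mult) using \<alpha> apply simp using \<alpha> apply simp
  apply (subst mat4_mult) using \<alpha> apply simp using \<alpha> apply simp
  by (rule mat4_eqI; ((simp add: \<alpha>; fail) | (rule ring_eqI2[OF wm vn], (rule reify | simp add: \<alpha>)+)))

text \<open>The product \<open>unip * diag * flip\<close>, a general element of the big cell up to a unipotent factor.\<close>

definition cell :: "'a \<Rightarrow> 'a \<Rightarrow> 'a \<Rightarrow> 'a \<Rightarrow> 'a \<Rightarrow> 'a \<Rightarrow> 'a \<Rightarrow> 'a \<Rightarrow> nat \<times> nat \<Rightarrow> 'a" where
  "cell a \<alpha> b \<beta> \<mu> \<nu> w v = mat_of_rows 4
    [[\<zero>, \<zero>, \<zero>, \<mu> \<otimes> \<nu>], [\<zero>, \<zero>, \<mu>, a \<otimes> (\<mu> \<otimes> \<nu>)], [\<zero>, w, \<alpha> \<otimes> \<mu>, b \<otimes> (\<mu> \<otimes> \<nu>)],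
     [w \<otimes> v, a \<otimes> w, (a \<otimes> \<alpha> \<oplus> b) \<otimes> \<mu>, (a [^] (2::nat) \<otimes> \<alpha> \<oplus> a \<otimes> b \<oplus> \<beta>) \<otimes> (\<mu> \<otimes> \<nu>)]]"

lemma cell_eq:
  assumes \<alpha>: "\<mu> \<in> carrier R" "\<nu> \<in> carrier R" "w \<in> carrier R" "v \<in> carrier R"
    "a \<in> carrier R" "\<alpha> \<in> carrier R" "b \<in> carrier R" "\<beta> \<in> carrier R"
  shows "unip a \<alpha> b \<beta> \<otimes>\<^bsub>mat_monoid 4 R\<^esub> diag \<mu> \<nu> w v \<otimes>\<^bsub>mat_monoid 4 R\<^esub> flip = cell a \<alpha> b \<beta> \<mu> \<nu> w v"
  unfolding flip_def diag_def unip_def cell_def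
  apply (subst mat4_mult) using \<alpha> apply simp using \<alpha> apply simp
  apply (subst mat4_mult) using \<alpha> apply simp using \<alpha> apply simp
  by (rule mat4_eqI; ((simp add: \<alpha>; fail) | (rule ring_eqI, (rule reify | simp add: \<alpha>)+)))

text \<open>The Bruhat decomposition of \<open>t u t\<close>. Its corner entry forces \<open>\<mu> \<nu>\<close> to be the lower left entry of
  \<open>u\<close>, which is the hypothesis on \<open>\<beta>\<close>; the hypothesis on \<open>b\<^sup>2\<close> is the image of that equation under the
  automorphism. The remaining parameters are then determined by comparing the first and last rows
  and columns.\<close>

lemma flip_unip_flip:
  assumes c: "\<one> \<oplus> \<one> = \<zero>" and wm: "w \<otimes> \<mu> = \<one>" and vn: "v \<otimes> \<nu> = \<one>"
    and \<alpha>: "\<mu> \<in> carrier R" "\<nu> \<in> carrier R" "w \<in> carrier R" "v \<in> carrier R"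
      "a \<in> carrier R" "\<alpha> \<in> carrier R" "b \<in> carrier R"
    and \<beta>: "\<beta> = \<mu> \<otimes> \<nu> \<oplus> a [^] (2::nat) \<otimes> \<alpha> \<oplus> a \<otimes> b"
    and b: "b [^] (2::nat) = \<nu> \<otimes> \<mu> [^] (2::nat) \<oplus> \<alpha> \<otimes> \<mu> \<otimes> \<nu> \<oplus> a \<otimes> \<alpha> \<otimes> b"
    and a2: "a2 = (b \<oplus> a \<otimes> \<alpha>) \<otimes> w \<otimes> v" and \<alpha>2: "\<alpha>2 = (\<beta> \<oplus> \<alpha> \<otimes> a [^] (2::nat)) \<otimes> v \<otimes> w [^] (2::nat)"
  shows "flip \<otimes>\<^bsub>mat_monoid 4 R\<^esub> unip a \<alpha> b \<beta> \<otimes>\<^bsub>mat_monoid 4 R\<^esub> flip =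
    cell (b \<otimes> w \<otimes> v) (\<beta> \<otimes> v \<otimes> w [^] (2::nat)) (a \<otimes> w \<otimes> v) (\<alpha> \<otimes> v \<otimes> w [^] (2::nat)) \<mu> \<nu> w v
    \<otimes>\<^bsub>mat_monoid 4 R\<^esub> unip a2 \<alpha>2 (a \<otimes> w \<otimes> v \<oplus> a2 \<otimes> \<alpha>2) (\<alpha> \<otimes> v \<otimes> w [^] (2::nat) \<oplus> \<alpha>2 \<otimes> a2 [^] (2::nat))"
proof -
  \<comment> \<open>These consequences of the hypothesis on \<open>b\<^sup>2\<close> bring the entries of the two factors on the right
    into a form of small degree, before they are multiplied.\<close>
  have g: "b \<otimes> a2 = \<mu> \<oplus> \<alpha>"
    unfolding a2 by (rule ring_eqI4[OF c b wm vn], (rule reify | simp add: \<alpha>)+)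
  have e: "\<alpha>2 = w \<oplus> a \<otimes> b \<otimes> w \<otimes> w \<otimes> v"
    unfolding \<alpha>2 \<beta> by (rule ring_eqI4[OF c b wm vn], (rule reify | simp add: \<alpha>)+)
  have f: "a2 \<otimes> \<alpha>2 = b \<otimes> w \<otimes> w \<otimes> v \<oplus> a \<otimes> w \<otimes> v"
    unfolding e a2 by (rule ring_eqI4[OF c b wm vn], (rule reify | simp add: \<alpha>)+)
  have \<alpha>2c: "a2 \<in> carrier R" "\<alpha>2 \<in> carrier R"
    unfolding e a2 by (simp_all add: \<alpha>)
  have C: "cell (b \<otimes> w \<otimes> v) (\<beta> \<otimes> v \<otimes> w [^] (2::nat)) (a \<otimes> w \<otimes> v) (\<alpha> \<otimes> v \<otimes> w [^] (2::nat)) \<mu> \<nu> w v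
    = mat_of_rows 4 [[\<zero>, \<zero>, \<zero>, \<mu> \<otimes> \<nu>], [\<zero>, \<zero>, \<mu>, b], [\<zero>, w, \<beta> \<otimes> w \<otimes> v, a],
      [w \<otimes> v, b \<otimes> w \<otimes> w \<otimes> v, a2, \<one>]]"
    unfolding cell_def a2 \<beta>
    by (rule mat4_eqI; ((simp add: \<alpha>; fail) | (rule ring_eqI4[OF c b wm vn], (rule reify | simp add: \<alpha>)+)))
  have U: "unip a2 \<alpha>2 (a \<otimes> w \<otimes> v \<oplus> a2 \<otimes> \<alpha>2) (\<alpha> \<otimes> v \<otimes> w [^] (2::nat) \<oplus> \<alpha>2 \<otimes> a2 [^] (2::nat))
    = mat_of_rows 4 [[\<one>, \<zero>, \<zero>, \<zero>], [a2, \<one>, \<zero>, \<zero>], [b \<otimes> w \<otimes> w \<otimes> v, \<alpha>2, \<one>, \<zero>],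
      [w \<otimes> v, a \<otimes> w \<otimes> v, a2, \<one>]]"
    unfolding unip_def
    by (rule mat4_eqI; ((simp add: \<alpha> \<alpha>2c; fail) | (rule ring_eqI4[OF c f g wm], (rule reify | simp add: \<alpha> \<alpha>2c)+)))
  have \<beta>c: "\<beta> \<in> carrier R" unfolding \<beta> by (simp add: \<alpha>)
  show ?thesis
    unfolding C U unfolding flip_def unip_def
    apply (subst mat4_mult) using \<alpha> \<beta>c apply simp using \<alpha> \<beta>c apply simp
    apply (subst mat4_mult) using \<alpha> \<beta>c apply simp using \<alpha> \<beta>c apply simp
    apply (subst mat4_mult) using \<alpha> \<alpha>2c \<beta>c apply simp using \<alpha> \<alpha>2c \<beta>c apply simp
    unfolding e a2 \<beta>
    by (rule mat4_eqI; ((simp add: \<alpha>; fail) | (rule ring_eqI4[OF c b wm vn], (rule reify | simp add: \<alpha>)+)))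
qed

end

section \<open>The Suzuki groups\<close>

locale suzuki_field = finite_field R for R (structure) +
  fixes n :: nat
  assumes n_pos: "n \<ge> 1" and order_eq: "order R = 2 ^ (2 * n + 1)"
begin

lemma char_two: "\<one> \<oplus> \<one> = \<zero>"
  using char_two_if_even order_eq by simp

lemma double_zero:
  assumes "x \<in> carrier R"
  shows "x \<oplus> x = \<zero>"
  using assms by - (rule ring_eqI1[OF char_two], (rule reify | simp)+)

lemma mult_swap:
  assumes "a \<in> carrier R" "b \<in> carrier R" "c \<in> carrier R" "d \<in> carrier R"
  shows "(a \<otimes> b) \<otimes> (c \<otimes> d) = (a \<otimes> c) \<otimes> (b \<otimes> d)"
  using assms by - (rule ring_eqI, (rule reify | simp)+)

lemma neg_self [simp]: "x \<in> carrier R \<Longrightarrow> \<ominus> x = x"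
  using double_zero by (metis minus_equality)

lemma add_cancel_self: "x \<in> carrier R \<Longrightarrow> y \<in> carrier R \<Longrightarrow> x \<oplus> y = \<zero> \<longleftrightarrow> x = y"
  using double_zero by (metis minus_equality neg_self)

lemma pow_order: "x \<in> carrier R \<Longrightarrow> x [^] q = x"
proof -
  assume x: "x \<in> carrier R"
  have q: "q = Suc (q - 1)" using q_gt_1 by simp
  show ?thesis
  proof (cases "x = \<zero>")
    case True
    thus ?thesis using q_gt_1 by (simp add: nat_pow_zero)
  next
    case False
    hence "x \<in> Units R" using x field_Units by simp
    moreover have "finite (Units R)" using field_Units by simp
    moreover have "card (Units R) = q - 1" using field_Units card_nonzero by simp
    ultimately have "x [^] (q - 1) = \<one>" using units_power_order_eq_one by metis
    thus ?thesis using x by (subst q) simp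
  qed
qed

lemma pow_two_power_add:
  assumes "x \<in> carrier R" "y \<in> carrier R"
  shows "(x \<oplus> y) [^] (2 ^ m :: nat) = x [^] (2 ^ m :: nat) \<oplus> y [^] (2 ^ m :: nat)"
proof (induction m)
  case 0
  show ?case using assms by simp
next
  case (Suc m)
  have sq: "(u \<oplus> v) [^] (2::nat) = u [^] (2::nat) \<oplus> v [^] (2::nat)" if "u \<in> carrier R" "v \<in> carrier R" for u v
    using that by - (rule ring_eqI1[OF char_two], (rule reify | simp)+)
  have p: "(2::nat) ^ Suc m = 2 ^ m * 2" by simp
  have "(x \<oplus> y) [^] (2 ^ Suc m :: nat) = ((x \<oplus> y) [^] (2 ^ m :: nat)) [^] (2::nat)"
    unfolding p using assms by (simp add: nat_pow_pow)
  also have "\<dots> = (x [^] (2 ^ m :: nat)) [^] (2::nat) \<oplus> (y [^] (2 ^ m :: nat)) [^] (2::nat)"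
    unfolding Suc.IH using assms sq by simp
  also have "\<dots> = x [^] (2 ^ Suc m :: nat) \<oplus> y [^] (2 ^ Suc m :: nat)"
    unfolding p using assms by (simp add: nat_pow_pow)
  finally show ?case .
qed

abbreviation \<theta> :: "'a \<Rightarrow> 'a" where "\<theta> \<equiv> suz_aut n R"

lemma \<theta>_closed [simp]: "x \<in> carrier R \<Longrightarrow> \<theta> x \<in> carrier R"
  by (simp add: suz_aut_def)

lemma \<theta>_add: "x \<in> carrier R \<Longrightarrow> y \<in> carrier R \<Longrightarrow> \<theta> (x \<oplus> y) = \<theta> x \<oplus> \<theta> y"
  unfolding suz_aut_def by (rule pow_two_power_add)

lemma \<theta>_mult: "x \<in> carrier R \<Longrightarrow> y \<in> carrier R \<Longrightarrow> \<theta> (x \<otimes> y) = \<theta> x \<otimes> \<theta> y"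
  unfolding suz_aut_def by (rule nat_pow_distrib)

lemma \<theta>_one [simp]: "\<theta> \<one> = \<one>" and \<theta>_zero [simp]: "\<theta> \<zero> = \<zero>"
  unfolding suz_aut_def by (simp_all add: nat_pow_zero)

lemma \<theta>_\<theta>: "x \<in> carrier R \<Longrightarrow> \<theta> (\<theta> x) = x \<otimes> x"
proof -
  assume x: "x \<in> carrier R"
  have "(2::nat) ^ (n + 1) * 2 ^ (n + 1) = 2 ^ ((n + 1) + (n + 1))" by (rule power_add[symmetric])
  also have "(n + 1) + (n + 1) = (2 * n + 1) + 1" by simp
  also have "(2::nat) ^ ((2 * n + 1) + 1) = q * 2" unfolding order_eq by simp
  finally have "(2::nat) ^ (n + 1) * 2 ^ (n + 1) = q * 2" .
  hence "\<theta> (\<theta> x) = (x [^] q) [^] (2::nat)"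
    unfolding suz_aut_def using x by (simp only: nat_pow_pow)
  thus ?thesis using x by (simp add: pow_order pow_two)
qed

lemma \<theta>_sq: "x \<in> carrier R \<Longrightarrow> \<theta> (x [^] (2::nat)) = (\<theta> x) [^] (2::nat)"
  by (simp add: pow_two \<theta>_mult)

lemma sq_inj: "x \<in> carrier R \<Longrightarrow> y \<in> carrier R \<Longrightarrow> x \<otimes> x = y \<otimes> y \<Longrightarrow> x = y"
proof -
  assume xy: "x \<in> carrier R" "y \<in> carrier R" "x \<otimes> x = y \<otimes> y"
  have "(x \<oplus> y) \<otimes> (x \<oplus> y) = x \<otimes> x \<oplus> y \<otimes> y" using xy(1,2) by - (rule ring_eqI1[OF char_two], (rule reify | simp)+)
  also have "\<dots> = \<zero>" using xy double_zero by simp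
  finally have "x \<oplus> y = \<zero>" using xy integral_iff by simp
  thus ?thesis using xy add_cancel_self by simp
qed

lemma \<theta>_inj: "x \<in> carrier R \<Longrightarrow> y \<in> carrier R \<Longrightarrow> \<theta> x = \<theta> y \<longleftrightarrow> x = y"
  using \<theta>_\<theta> sq_inj by metis

lemma \<theta>_zero_iff: "x \<in> carrier R \<Longrightarrow> \<theta> x = \<zero> \<longleftrightarrow> x = \<zero>"
  using \<theta>_inj[of x \<zero>] by simp

lemma \<theta>_surj_pow:
  assumes "x \<in> carrier R"
  shows "\<theta> (x [^] (2 ^ n :: nat)) = x"
proof -
  have "(2::nat) ^ n * 2 ^ (n + 1) = 2 ^ (n + (n + 1))" by (rule power_add[symmetric])
  also have "n + (n + 1) = 2 * n + 1" by simp
  finally have "(2::nat) ^ n * 2 ^ (n + 1) = q" unfolding order_eq .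
  thus ?thesis unfolding suz_aut_def using assms by (simp only: nat_pow_pow pow_order)
qed

lemma nonzero_inv:
  assumes "x \<in> carrier R" "x \<noteq> \<zero>"
  shows "inv x \<in> carrier R" "inv x \<noteq> \<zero>" "inv x \<otimes> x = \<one>" "x \<otimes> inv x = \<one>"
proof -
  have u: "x \<in> Units R" using assms field_Units by simp
  thus "inv x \<in> carrier R" "inv x \<otimes> x = \<one>" "x \<otimes> inv x = \<one>" by auto
  thus "inv x \<noteq> \<zero>" using assms by (metis l_null zero_not_one)
qed

lemma inv_eqI: "x \<in> carrier R \<Longrightarrow> y \<in> carrier R \<Longrightarrow> y \<otimes> x = \<one> \<Longrightarrow> inv x = y"
  by (metis comm_inv_char m_comm)

lemma inv_mult:
  assumes "x \<in> carrier R" "x \<noteq> \<zero>" "y \<in> carrier R" "y \<noteq> \<zero>"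
  shows "inv (x \<otimes> y) = inv x \<otimes> inv y"
proof -
  note x = nonzero_inv[OF assms(1,2)] and y = nonzero_inv[OF assms(3,4)]
  have "(inv x \<otimes> inv y) \<otimes> (x \<otimes> y) = \<one>"
    unfolding mult_swap[OF x(1) y(1) assms(1,3)] using x y by simp
  thus ?thesis using assms x y by (intro inv_eqI) auto
qed

lemma \<theta>_inv: "x \<in> carrier R \<Longrightarrow> x \<noteq> \<zero> \<Longrightarrow> \<theta> (inv x) = inv (\<theta> x)"
  using nonzero_inv[of x] by (metis \<theta>_closed \<theta>_mult \<theta>_one inv_eqI)

text \<open>Applying \<open>\<theta>\<close> to \<open>z \<theta>(z) = 1\<close> gives \<open>\<theta>(z) z\<^sup>2 = 1\<close>, and the quotient of the two equations is \<open>z = 1\<close>.\<close>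

lemma norm_one:
  assumes "z \<in> carrier R" "z \<otimes> \<theta> z = \<one>"
  shows "z = \<one>"
proof -
  have z0: "z \<noteq> \<zero>" using assms by auto
  have "\<theta> z \<otimes> (z \<otimes> z) = \<one>"
    using assms(1) arg_cong[OF assms(2), of \<theta>] by (simp add: \<theta>_mult \<theta>_\<theta>)
  moreover have "\<theta> z \<otimes> (z \<otimes> z) = z \<otimes> (z \<otimes> \<theta> z)" using assms(1) by (simp add: m_ac)
  ultimately show ?thesis using assms by simp
qed

text \<open>The map \<open>\<mu> \<mapsto> \<mu> \<theta>(\<mu>)\<close> is multiplicative with trivial kernel by \<open>norm_one\<close>, hence a bijection of the finite set
  of nonzero elements.\<close>

lemma norm_surj:
  assumes "f \<in> carrier R" "f \<noteq> \<zero>"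
  obtains \<mu> where "\<mu> \<in> carrier R" "\<mu> \<noteq> \<zero>" "\<mu> \<otimes> \<theta> \<mu> = f"
proof -
  let ?N = "\<lambda>\<mu>. \<mu> \<otimes> \<theta> \<mu>" and ?C = "carrier R - {\<zero>}"
  have inj: "inj_on ?N ?C"
  proof (rule inj_onI)
    fix x y assume a: "x \<in> ?C" "y \<in> ?C" "x \<otimes> \<theta> x = y \<otimes> \<theta> y"
    let ?z = "x \<otimes> inv y"
    have y: "y \<in> carrier R" "\<theta> y \<in> carrier R" "y \<noteq> \<zero>" "\<theta> y \<noteq> \<zero>"
      using a by (auto simp: \<theta>_zero_iff)
    note iy = nonzero_inv[OF y(1,3)] and it = nonzero_inv[OF y(2,4)]
    have x: "x \<in> carrier R" "\<theta> x \<in> carrier R" using a by auto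
    have "?z \<otimes> \<theta> ?z = (x \<otimes> inv y) \<otimes> (\<theta> x \<otimes> inv (\<theta> y))"
      using x y iy by (simp add: \<theta>_mult \<theta>_inv)
    also have "\<dots> = (y \<otimes> \<theta> y) \<otimes> (inv y \<otimes> inv (\<theta> y))"
      unfolding mult_swap[OF x(1) iy(1) x(2) it(1)] a(3) ..
    also have "\<dots> = (y \<otimes> inv y) \<otimes> (\<theta> y \<otimes> inv (\<theta> y))"
      by (rule mult_swap[OF y(1,2) iy(1) it(1)])
    also have "\<dots> = \<one>" using iy it by simp
    finally have "?z \<otimes> \<theta> ?z = \<one>" .
    hence "?z = \<one>" using norm_one[of ?z] x(1) iy(1) by simp
    hence "x \<otimes> inv y \<otimes> y = y" using y by simp
    thus "x = y" using x(1) y(1) iy by (simp add: m_assoc)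
  qed
  have "?N ` ?C \<subseteq> ?C" by (auto simp: integral_iff \<theta>_zero_iff)
  hence "?N ` ?C = ?C" by (intro endo_inj_surj inj) simp_all
  moreover have "f \<in> ?C" using assms by simp
  ultimately obtain \<mu> where "\<mu> \<in> ?C" "f = ?N \<mu>" by blast
  thus ?thesis using that[of \<mu>] by auto
qed

abbreviation M :: "(nat \<times> nat \<Rightarrow> 'a) monoid" where "M \<equiv> mat_monoid 4 R"

definition U :: "'a \<Rightarrow> 'a \<Rightarrow> nat \<times> nat \<Rightarrow> 'a" where
  "U a b = unip a (\<theta> a) b (\<theta> b)"

text \<open>The torus in the coordinate \<open>\<mu>\<close>, in which all entries are given by \<open>\<theta>\<close> without roots; the coordinate
  of the original definition is \<open>\<theta>(\<mu>)\<close>.\<close>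

definition D :: "'a \<Rightarrow> nat \<times> nat \<Rightarrow> 'a" where
  "D \<mu> = diag \<mu> (\<theta> \<mu>) (inv \<mu>) (inv (\<theta> \<mu>))"

lemma suz_unipotent_eq: "suz_unipotent n R a b = U a b"
  unfolding suz_unipotent_def U_def unip_def by simp

lemma suz_flip_eq: "suz_flip R = flip"
  unfolding suz_flip_def flip_def by simp

lemma D_eq_suz_torus:
  assumes "c \<in> carrier R" "c \<noteq> \<zero>"
  shows "suz_torus n R c = D (c [^] (2 ^ n :: nat))"
proof -
  let ?m = "c [^] (2 ^ n :: nat)"
  have m: "?m \<in> carrier R" "?m \<noteq> \<zero>"
    using assms \<theta>_surj_pow[OF assms(1)] \<theta>_zero by (simp, metis)
  have t: "\<theta> ?m = c" using \<theta>_surj_pow assms by simp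
  have "c [^] ((2::nat) ^ n + 1) = ?m \<otimes> c" using assms by simp
  moreover have "inv (?m \<otimes> c) = inv ?m \<otimes> inv c" using m assms by (intro inv_mult)
  ultimately show ?thesis
    unfolding suz_torus_def D_def diag_def t by simp
qed

lemma tori_eq: "{suz_torus n R c | c. c \<in> carrier R - {\<zero>}} = D ` (carrier R - {\<zero>})"
proof (intro equalityI subsetI)
  fix A assume "A \<in> {suz_torus n R c | c. c \<in> carrier R - {\<zero>}}"
  then obtain c where c: "c \<in> carrier R" "c \<noteq> \<zero>" "A = D (c [^] (2 ^ n :: nat))"
    using D_eq_suz_torus by auto
  moreover have "c [^] (2 ^ n :: nat) \<noteq> \<zero>" using c \<theta>_surj_pow \<theta>_zero by metis
  ultimately show "A \<in> D ` (carrier R - {\<zero>})" by simp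
next
  fix A assume "A \<in> D ` (carrier R - {\<zero>})"
  then obtain \<mu> where m: "\<mu> \<in> carrier R" "\<mu> \<noteq> \<zero>" "A = D \<mu>" by auto
  have "(\<theta> \<mu>) [^] (2 ^ n :: nat) = \<mu>"
    using \<theta>_surj_pow[of \<mu>] m unfolding suz_aut_def by (simp add: nat_pow_pow mult.commute)
  hence "A = suz_torus n R (\<theta> \<mu>)" using D_eq_suz_torus[of "\<theta> \<mu>"] m \<theta>_zero_iff by simp
  thus "A \<in> {suz_torus n R c | c. c \<in> carrier R - {\<zero>}}" using m \<theta>_zero_iff by auto
qed

lemma U_closed: "a \<in> carrier R \<Longrightarrow> b \<in> carrier R \<Longrightarrow> U a b \<in> carrier M"
  unfolding U_def unip_def by (intro mat4_closed) simp

lemma D_closed: "\<mu> \<in> carrier R \<Longrightarrow> \<mu> \<noteq> \<zero> \<Longrightarrow> D \<mu> \<in> carrier M"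
  using nonzero_inv[of \<mu>] nonzero_inv[of "\<theta> \<mu>"] \<theta>_zero_iff
  unfolding D_def diag_def by (intro mat4_closed) simp

lemma flip_closed: "flip \<in> carrier M"
  unfolding flip_def by (intro mat4_closed) simp

lemma U_mult:
  assumes "a \<in> carrier R" "b \<in> carrier R" "c \<in> carrier R" "d \<in> carrier R"
  shows "U a b \<otimes>\<^bsub>M\<^esub> U c d = U (a \<oplus> c) (b \<oplus> d \<oplus> \<theta> a \<otimes> c)"
  unfolding U_def using assms
  by (simp add: unip_mult[OF char_two] \<theta>_add \<theta>_mult \<theta>_\<theta> pow_two)

lemma D_mult:
  assumes "\<mu> \<in> carrier R" "\<mu> \<noteq> \<zero>" "\<nu> \<in> carrier R" "\<nu> \<noteq> \<zero>"
  shows "D \<mu> \<otimes>\<^bsub>M\<^esub> D \<nu> = D (\<mu> \<otimes> \<nu>)"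
proof -
  show ?thesis
    unfolding D_def using assms nonzero_inv[of \<mu>] nonzero_inv[of "\<theta> \<mu>"] nonzero_inv[of \<nu>] nonzero_inv[of "\<theta> \<nu>"]
    by (simp add: diag_mult \<theta>_mult \<theta>_zero_iff inv_mult)
qed

lemma one_M: "\<one>\<^bsub>M\<^esub> = U \<zero> \<zero>" "\<one>\<^bsub>M\<^esub> = D \<one>"
  unfolding mat_monoid_simps scalar_mat_4 U_def unip_def D_def diag_def by simp_all

lemma D_U:
  assumes "\<mu> \<in> carrier R" "\<mu> \<noteq> \<zero>" "a \<in> carrier R" "b \<in> carrier R"
  shows "D \<mu> \<otimes>\<^bsub>M\<^esub> U (\<theta> \<mu> \<otimes> a) (\<mu> \<otimes> \<mu> \<otimes> \<theta> \<mu> \<otimes> b) = U a b \<otimes>\<^bsub>M\<^esub> D \<mu>"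
proof -
  have t: "\<theta> \<mu> \<noteq> \<zero>" using assms \<theta>_zero_iff by simp
  have e: "\<theta> \<mu> \<otimes> \<theta> \<mu> \<otimes> (\<mu> \<otimes> \<mu>) \<otimes> \<theta> b = \<theta> \<mu> \<otimes> \<theta> \<mu> \<otimes> \<mu> \<otimes> \<mu> \<otimes> \<theta> b"
    using assms by (simp add: m_assoc)
  show ?thesis
    unfolding U_def D_def
    using unip_diag[of "inv \<mu>" \<mu> "inv (\<theta> \<mu>)" "\<theta> \<mu>" a "\<theta> a" b "\<theta> b"]
      assms t nonzero_inv[of \<mu>] nonzero_inv[of "\<theta> \<mu>"]
    by (simp add: \<theta>_mult \<theta>_\<theta> e)
qed

lemma flip_D_flip:
  assumes "\<mu> \<in> carrier R" "\<mu> \<noteq> \<zero>"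
  shows "flip \<otimes>\<^bsub>M\<^esub> D \<mu> \<otimes>\<^bsub>M\<^esub> flip = D (inv \<mu>)"
proof -
  have t: "\<theta> \<mu> \<noteq> \<zero>" using assms \<theta>_zero_iff by simp
  have "inv (inv \<mu>) = \<mu>" "inv (inv (\<theta> \<mu>)) = \<theta> \<mu>"
    using assms t nonzero_inv[of \<mu>] nonzero_inv[of "\<theta> \<mu>"] by (auto intro: inv_eqI)
  thus ?thesis
    unfolding D_def
    using flip_diag_flip[of "inv \<mu>" \<mu> "inv (\<theta> \<mu>)" "\<theta> \<mu>"]
      assms t nonzero_inv[of \<mu>] nonzero_inv[of "\<theta> \<mu>"] by (simp add: \<theta>_inv)
qed

abbreviation C :: "'a \<Rightarrow> 'a \<Rightarrow> 'a \<Rightarrow> nat \<times> nat \<Rightarrow> 'a" where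
  "C a b \<mu> \<equiv> cell a (\<theta> a) b (\<theta> b) \<mu> (\<theta> \<mu>) (inv \<mu>) (inv (\<theta> \<mu>))"

lemma C_eq:
  assumes "\<mu> \<in> carrier R" "\<mu> \<noteq> \<zero>" "a \<in> carrier R" "b \<in> carrier R"
  shows "U a b \<otimes>\<^bsub>M\<^esub> D \<mu> \<otimes>\<^bsub>M\<^esub> flip = C a b \<mu>"
  unfolding U_def D_def using assms nonzero_inv[of \<mu>] nonzero_inv[of "\<theta> \<mu>"] \<theta>_zero_iff
  by (intro cell_eq) auto

text \<open>The form vanishes only at the origin: this is the equation of the Suzuki-Tits ovoid. For \<open>a \<noteq> 0\<close>
  the substitution \<open>b = r a \<theta>(a)\<close> reduces it to \<open>1 + r + \<theta>(r) = 0\<close>. Applying \<open>\<theta>\<close> once more gives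
  \<open>r\<^sup>2 = r\<close>, but neither \<open>0\<close> nor \<open>1\<close> solves the equation.\<close>

lemma ovoid_form_nonzero:
  assumes "a \<in> carrier R" "b \<in> carrier R" "a [^] (2::nat) \<otimes> \<theta> a \<oplus> a \<otimes> b \<oplus> \<theta> b = \<zero>"
  shows "a = \<zero> \<and> b = \<zero>"
proof (cases "a = \<zero>")
  case True
  thus ?thesis using assms \<theta>_zero_iff by (simp add: nat_pow_zero)
next
  case False
  let ?i = "inv a"
  define r where "r = b \<otimes> ?i \<otimes> \<theta> ?i"
  note i = nonzero_inv[OF assms(1) False]
  have t: "\<theta> a \<otimes> \<theta> ?i = \<one>" using assms i \<theta>_mult[of a ?i] by simp
  have r: "r \<in> carrier R" using assms i unfolding r_def by simp
  have rb: "r \<otimes> a \<otimes> \<theta> a = b"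
  proof -
    have "r \<otimes> a \<otimes> \<theta> a = b \<otimes> (?i \<otimes> a) \<otimes> (\<theta> a \<otimes> \<theta> ?i)"
      unfolding r_def using assms i(1) by (simp add: m_ac)
    thus ?thesis using t i assms by simp
  qed
  have rt: "\<theta> r \<otimes> \<theta> a \<otimes> (a \<otimes> a) = \<theta> b"
    using arg_cong[OF rb, of \<theta>] assms r by (simp add: \<theta>_mult \<theta>_\<theta>)
  have "(a \<otimes> a \<otimes> \<theta> a) \<otimes> (\<one> \<oplus> r \<oplus> \<theta> r)
      = a \<otimes> a \<otimes> \<theta> a \<oplus> a \<otimes> (r \<otimes> a \<otimes> \<theta> a) \<oplus> \<theta> r \<otimes> \<theta> a \<otimes> (a \<otimes> a)"
    using assms(1) r \<theta>_closed[OF assms(1)] \<theta>_closed[OF r]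
    by (simp add: r_distr m_ac)
  also have "\<dots> = \<zero>" unfolding rb rt using assms by (simp add: pow_two)
  finally have e: "\<one> \<oplus> r \<oplus> \<theta> r = \<zero>"
    using False assms r \<theta>_zero_iff by (simp add: integral_iff)
  have tr: "\<theta> r = \<one> \<oplus> r" using e r add_cancel_self[of "\<one> \<oplus> r" "\<theta> r"] by simp
  have "r \<otimes> r = \<theta> (\<theta> r)" using r \<theta>_\<theta> by simp
  also have "\<dots> = \<theta> (\<one> \<oplus> r)" using tr by simp
  also have "\<dots> = \<one> \<oplus> (\<one> \<oplus> r)" using tr r by (simp add: \<theta>_add)
  also have "\<dots> = r" using r double_zero[of \<one>] by (simp add: a_assoc[symmetric])
  finally have "r \<otimes> (r \<oplus> \<one>) = \<zero>" using r double_zero by (simp add: r_distr)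
  hence "r = \<zero> \<or> r = \<one>" using r integral_iff add_cancel_self by simp
  thus ?thesis
  proof
    assume "r = \<zero>"
    thus ?thesis using tr by simp
  next
    assume "r = \<one>"
    thus ?thesis using tr double_zero[of \<one>] by simp
  qed
qed

text \<open>The torus part of the decomposition is found by solving \<open>\<mu> \<theta>(\<mu>) = f\<close>, where \<open>f \<noteq> 0\<close> is the value of the
  ovoid form.\<close>

lemma flip_U_flip:
  assumes "a \<in> carrier R" "b \<in> carrier R" "a \<noteq> \<zero> \<or> b \<noteq> \<zero>"
  obtains a1 b1 \<mu> a2 b2 where "a1 \<in> carrier R" "b1 \<in> carrier R" "\<mu> \<in> carrier R" "\<mu> \<noteq> \<zero>"
    "a2 \<in> carrier R" "b2 \<in> carrier R"
    "flip \<otimes>\<^bsub>M\<^esub> U a b \<otimes>\<^bsub>M\<^esub> flip = C a1 b1 \<mu> \<otimes>\<^bsub>M\<^esub> U a2 b2"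
proof -
  let ?f = "a [^] (2::nat) \<otimes> \<theta> a \<oplus> a \<otimes> b \<oplus> \<theta> b"
  have "?f \<in> carrier R" using assms(1,2) by simp
  moreover have "?f \<noteq> \<zero>" using ovoid_form_nonzero[OF assms(1,2)] assms(3) by blast
  ultimately obtain \<mu> where m: "\<mu> \<in> carrier R" "\<mu> \<noteq> \<zero>" "\<mu> \<otimes> \<theta> \<mu> = ?f" by (rule norm_surj)
  define \<nu> w v \<alpha> \<beta> where defs: "\<nu> = \<theta> \<mu>" "w = inv \<mu>" "v = inv (\<theta> \<mu>)" "\<alpha> = \<theta> a" "\<beta> = \<theta> b"
  have n0: "\<nu> \<in> carrier R" "\<nu> \<noteq> \<zero>" using m \<theta>_zero_iff unfolding defs by auto
  have cl: "w \<in> carrier R" "v \<in> carrier R" "\<alpha> \<in> carrier R" "\<beta> \<in> carrier R"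
    using assms m n0 nonzero_inv unfolding defs by auto
  have wm: "w \<otimes> \<mu> = \<one>" and vn: "v \<otimes> \<nu> = \<one>"
    using nonzero_inv m n0 unfolding defs by auto
  have f: "\<mu> \<otimes> \<nu> = a [^] (2::nat) \<otimes> \<alpha> \<oplus> a \<otimes> b \<oplus> \<beta>" using m unfolding defs by simp
  have "\<mu> \<otimes> \<nu> \<oplus> a [^] (2::nat) \<otimes> \<alpha> \<oplus> a \<otimes> b = \<beta>"
    unfolding f using assms(1,2) cl by - (rule ring_eqI1[OF char_two], (rule reify | simp)+)
  hence \<beta>: "\<beta> = \<mu> \<otimes> \<nu> \<oplus> a [^] (2::nat) \<otimes> \<alpha> \<oplus> a \<otimes> b" by simp
  have "\<theta> (\<mu> \<otimes> \<nu>) = \<theta> (a [^] (2::nat) \<otimes> \<alpha> \<oplus> a \<otimes> b \<oplus> \<beta>)" using f by simp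
  hence ft: "\<nu> \<otimes> \<mu> [^] (2::nat) = \<alpha> [^] (2::nat) \<otimes> a [^] (2::nat) \<oplus> \<alpha> \<otimes> \<beta> \<oplus> b [^] (2::nat)"
    using assms(1,2) m(1) unfolding defs by (simp add: \<theta>_mult \<theta>_add \<theta>_\<theta> \<theta>_sq flip: pow_two)
  have "\<nu> \<otimes> \<mu> [^] (2::nat) \<oplus> \<alpha> \<otimes> \<mu> \<otimes> \<nu> \<oplus> a \<otimes> \<alpha> \<otimes> b = b [^] (2::nat)"
    unfolding ft \<beta> using assms(1,2) cl m(1) n0 by - (rule ring_eqI1[OF char_two], (rule reify | simp)+)
  hence b: "b [^] (2::nat) = \<nu> \<otimes> \<mu> [^] (2::nat) \<oplus> \<alpha> \<otimes> \<mu> \<otimes> \<nu> \<oplus> a \<otimes> \<alpha> \<otimes> b" by simp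
  define a2 \<alpha>2 where a2: "a2 = (b \<oplus> a \<otimes> \<alpha>) \<otimes> w \<otimes> v"
    and \<alpha>2: "\<alpha>2 = (\<beta> \<oplus> \<alpha> \<otimes> a [^] (2::nat)) \<otimes> v \<otimes> w [^] (2::nat)"
  have \<theta>w: "\<theta> w = v" "\<theta> v = w [^] (2::nat)"
  proof -
    show "\<theta> w = v" using m unfolding defs by (simp add: \<theta>_inv)
    hence "\<theta> v = \<theta> (\<theta> w)" by simp
    thus "\<theta> v = w [^] (2::nat)" using cl by (simp add: \<theta>_\<theta> pow_two)
  qed
  have \<theta>\<alpha>: "\<theta> a = \<alpha>" "\<theta> b = \<beta>" "\<theta> \<alpha> = a [^] (2::nat)" "\<theta> \<beta> = b [^] (2::nat)"
    using assms unfolding defs by (simp_all add: \<theta>_\<theta> pow_two)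
  have a2c: "a2 \<in> carrier R" "\<alpha>2 \<in> carrier R" unfolding a2 \<alpha>2 using assms cl by auto
  have \<theta>a2: "\<theta> a2 = \<alpha>2"
    unfolding a2 \<alpha>2 using assms cl by (simp add: \<theta>_mult \<theta>_add \<theta>w \<theta>\<alpha>)
  have \<theta>\<alpha>2: "\<theta> \<alpha>2 = a2 [^] (2::nat)"
    using \<theta>_\<theta>[OF a2c(1)] unfolding \<theta>a2 pow_two[OF a2c(1)] .
  have id: "flip \<otimes>\<^bsub>M\<^esub> unip a \<alpha> b \<beta> \<otimes>\<^bsub>M\<^esub> flip =
    cell (b \<otimes> w \<otimes> v) (\<beta> \<otimes> v \<otimes> w [^] (2::nat)) (a \<otimes> w \<otimes> v) (\<alpha> \<otimes> v \<otimes> w [^] (2::nat)) \<mu> \<nu> w v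
    \<otimes>\<^bsub>M\<^esub> unip a2 \<alpha>2 (a \<otimes> w \<otimes> v \<oplus> a2 \<otimes> \<alpha>2) (\<alpha> \<otimes> v \<otimes> w [^] (2::nat) \<oplus> \<alpha>2 \<otimes> a2 [^] (2::nat))"
    by (rule flip_unip_flip[OF char_two wm vn m(1) n0(1) cl(1,2) assms(1) cl(3) assms(2) \<beta> b a2 \<alpha>2])
  let ?a1 = "b \<otimes> w \<otimes> v" and ?b1 = "a \<otimes> w \<otimes> v" and ?b2 = "a \<otimes> w \<otimes> v \<oplus> a2 \<otimes> \<alpha>2"
  have t1: "\<theta> ?a1 = \<beta> \<otimes> v \<otimes> w [^] (2::nat)" "\<theta> ?b1 = \<alpha> \<otimes> v \<otimes> w [^] (2::nat)"
    "\<theta> ?b2 = \<alpha> \<otimes> v \<otimes> w [^] (2::nat) \<oplus> \<alpha>2 \<otimes> a2 [^] (2::nat)"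
    using assms cl a2c by (simp_all add: \<theta>_mult \<theta>_add \<theta>w \<theta>\<alpha> \<theta>a2 \<theta>\<alpha>2)
  have "flip \<otimes>\<^bsub>M\<^esub> U a b \<otimes>\<^bsub>M\<^esub> flip = C ?a1 ?b1 \<mu> \<otimes>\<^bsub>M\<^esub> U a2 ?b2"
    unfolding U_def t1 \<theta>a2 using id unfolding defs by simp
  moreover have "?a1 \<in> carrier R" "?b1 \<in> carrier R" "?b2 \<in> carrier R" using assms cl a2c by auto
  ultimately show ?thesis using that m a2c by blast
qed

abbreviation S :: "(nat \<times> nat \<Rightarrow> 'a) monoid" where "S \<equiv> Sz n R"

definition QS :: "(nat \<times> nat \<Rightarrow> 'a) set" where
  "QS = {U a b | a b. a \<in> carrier R \<and> b \<in> carrier R}"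

definition KS :: "(nat \<times> nat \<Rightarrow> 'a) set" where
  "KS = D ` (carrier R - {\<zero>})"

lemma Sz_simps [simp]:
  "carrier S = generate (GL 4 R) (QS \<union> KS \<union> {flip})" "mult S = mult M" "\<one>\<^bsub>S\<^esub> = \<one>\<^bsub>M\<^esub>"
proof -
  have "QS = {suz_unipotent n R a b | a b. a \<in> carrier R \<and> b \<in> carrier R}"
    unfolding QS_def suz_unipotent_eq ..
  moreover have "KS = {suz_torus n R c | c. c \<in> carrier R - {\<zero>}}"
    unfolding KS_def tori_eq ..
  ultimately show "carrier S = generate (GL 4 R) (QS \<union> KS \<union> {flip})"
    unfolding Sz_def suz_flip_eq by simp
qed (simp_all add: Sz_def GL_simps mat_monoid_simps)

lemma U_inverse:
  assumes "a \<in> carrier R" "b \<in> carrier R"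
  shows "U a b \<otimes>\<^bsub>M\<^esub> U a (b \<oplus> \<theta> a \<otimes> a) = \<one>\<^bsub>M\<^esub>" "U a (b \<oplus> \<theta> a \<otimes> a) \<otimes>\<^bsub>M\<^esub> U a b = \<one>\<^bsub>M\<^esub>"
proof -
  have "b \<oplus> (b \<oplus> c) \<oplus> c = \<zero>" "b \<oplus> c \<oplus> b \<oplus> c = \<zero>" if "c \<in> carrier R" for c
    using assms(2) that by - ((rule ring_eqI1[OF char_two], (rule reify | simp)+)[1])+
  thus "U a b \<otimes>\<^bsub>M\<^esub> U a (b \<oplus> \<theta> a \<otimes> a) = \<one>\<^bsub>M\<^esub>" "U a (b \<oplus> \<theta> a \<otimes> a) \<otimes>\<^bsub>M\<^esub> U a b = \<one>\<^bsub>M\<^esub>"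
    using assms by (simp_all add: U_mult one_M(1) double_zero)
qed

lemma D_inverse:
  assumes "\<mu> \<in> carrier R" "\<mu> \<noteq> \<zero>"
  shows "D \<mu> \<otimes>\<^bsub>M\<^esub> D (inv \<mu>) = \<one>\<^bsub>M\<^esub>" "D (inv \<mu>) \<otimes>\<^bsub>M\<^esub> D \<mu> = \<one>\<^bsub>M\<^esub>"
  using assms nonzero_inv[OF assms] by (simp_all add: D_mult one_M(2))

lemma flip_inverse: "flip \<otimes>\<^bsub>M\<^esub> flip = \<one>\<^bsub>M\<^esub>"
  using flip_flip by (simp add: mat_monoid_simps)

lemma gens_subset: "QS \<union> KS \<union> {flip} \<subseteq> carrier (GL 4 R)"
proof -
  have unit: "x \<in> Units M" if "x \<in> carrier M" "y \<in> carrier M" "x \<otimes>\<^bsub>M\<^esub> y = \<one>\<^bsub>M\<^esub>" "y \<otimes>\<^bsub>M\<^esub> x = \<one>\<^bsub>M\<^esub>" for x y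
    using that unfolding Units_def by auto
  have "U a b \<in> Units M" if "a \<in> carrier R" "b \<in> carrier R" for a b
    using that by (intro unit[OF U_closed U_closed U_inverse]) simp_all
  moreover have "D \<mu> \<in> Units M" if "\<mu> \<in> carrier R" "\<mu> \<noteq> \<zero>" for \<mu>
    using that nonzero_inv[OF that] by (intro unit[OF D_closed D_closed D_inverse]) simp_all
  moreover have "flip \<in> Units M"
    by (rule unit[OF flip_closed flip_closed flip_inverse flip_inverse])
  ultimately show ?thesis unfolding QS_def KS_def GL_simps by blast
qed

lemma subgroup_Sz: "subgroup (generate (GL 4 R) (QS \<union> KS \<union> {flip})) (GL 4 R)"
  using group.generate_is_subgroup[OF group_GL gens_subset] .

lemma Sz_eq: "S = (GL 4 R)\<lparr>carrier := generate (GL 4 R) (QS \<union> KS \<union> {flip})\<rparr>"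
  using Sz_simps(1) unfolding Sz_def by simp

lemma group_Sz: "group S"
  unfolding Sz_eq using subgroup.subgroup_is_group[OF subgroup_Sz group_GL] .

lemma generators_in_Sz:
  "a \<in> carrier R \<Longrightarrow> b \<in> carrier R \<Longrightarrow> U a b \<in> carrier S"
  "\<mu> \<in> carrier R \<Longrightarrow> \<mu> \<noteq> \<zero> \<Longrightarrow> D \<mu> \<in> carrier S"
  "flip \<in> carrier S"
  by (auto simp: QS_def KS_def intro!: generate.incl)

lemma Sz_subset_M: "carrier S \<subseteq> carrier M"
  using subgroup.subset[OF subgroup_Sz] carrier_GL_subset unfolding Sz_simps(1) by blast

lemma finite_Sz: "finite (carrier S)"
proof -
  have "finite (carrier M)" unfolding mat_monoid_simps by (intro finite_PiE) auto
  thus ?thesis using Sz_subset_M finite_subset by blast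
qed

lemma U_eq_iff: "U a b = U c d \<longleftrightarrow> a = c \<and> b = d"
proof
  assume "U a b = U c d"
  hence "U a b (1, 0) = U c d (1, 0)" "U a b (2, 0) = U c d (2, 0)" by simp_all
  thus "a = c \<and> b = d" unfolding U_def unip_def by simp
qed simp

lemma D_eq_iff: "D \<mu> = D \<nu> \<longleftrightarrow> \<mu> = \<nu>"
proof
  assume "D \<mu> = D \<nu>"
  hence "D \<mu> (1, 1) = D \<nu> (1, 1)" by simp
  thus "\<mu> = \<nu>" unfolding D_def diag_def by simp
qed simp

lemma U_inv: "a \<in> carrier R \<Longrightarrow> b \<in> carrier R \<Longrightarrow> inv\<^bsub>S\<^esub> (U a b) = U a (b \<oplus> \<theta> a \<otimes> a)"
  using U_inverse generators_in_Sz by (intro group.inv_equality[OF group_Sz]) (simp_all del: Sz_simps(1) add: Sz_simps(2,3))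

lemma D_inv: "\<mu> \<in> carrier R \<Longrightarrow> \<mu> \<noteq> \<zero> \<Longrightarrow> inv\<^bsub>S\<^esub> (D \<mu>) = D (inv \<mu>)"
  using D_inverse generators_in_Sz nonzero_inv by (intro group.inv_equality[OF group_Sz]) (simp_all del: Sz_simps(1) add: Sz_simps(2,3))

lemma conjugate_D_U:
  assumes "\<mu> \<in> carrier R" "\<mu> \<noteq> \<zero>" "a \<in> carrier R" "b \<in> carrier R"
  shows "group.conjugate S (D \<mu>) (U (\<theta> \<mu> \<otimes> a) (\<mu> \<otimes> \<mu> \<otimes> \<theta> \<mu> \<otimes> b)) = U a b"
proof -
  interpret S: group S by (rule group_Sz)
  have c: "\<theta> \<mu> \<otimes> a \<in> carrier R" "\<mu> \<otimes> \<mu> \<otimes> \<theta> \<mu> \<otimes> b \<in> carrier R" using assms by auto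
  show ?thesis
    using D_U[OF assms] S.conjugate_eq_iff[OF generators_in_Sz(2)[OF assms(1,2)] generators_in_Sz(1)[OF c] generators_in_Sz(1)[OF assms(3,4)]]
    by (simp only: Sz_simps(2))
qed

lemma card_QS: "card QS = q * q"
proof -
  have "QS = (\<lambda>(a, b). U a b) ` (carrier R \<times> carrier R)" unfolding QS_def by auto
  moreover have "inj_on (\<lambda>(a, b). U a b) (carrier R \<times> carrier R)"
    by (auto intro!: inj_onI simp: U_eq_iff)
  ultimately show ?thesis by (simp add: card_image card_cartesian_product order_def)
qed

lemma card_KS: "card KS = q - 1"
  unfolding KS_def using card_nonzero by (subst card_image) (auto intro!: inj_onI simp: D_eq_iff)

lemma cell_corner: "C a b \<mu> (0, 3) = \<mu> \<otimes> \<theta> \<mu>"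
  unfolding cell_def by simp

sublocale S: group S by (rule group_Sz)

lemma split_bn: "split_bn_group S QS KS flip"
proof (intro split_bn_group.intro split_bn_group_axioms.intro group_Sz)
  note [simp del] = Sz_simps(1)
  show "finite (carrier S)" by (rule finite_Sz)
  show "subgroup QS S"
  proof (rule S.subgroupI)
    show "QS \<subseteq> carrier S" using generators_in_Sz unfolding QS_def by auto
    show "QS \<noteq> {}" unfolding QS_def by blast
    show "inv\<^bsub>S\<^esub> x \<in> QS" if "x \<in> QS" for x
    proof -
      obtain a b where x: "x = U a b" "a \<in> carrier R" "b \<in> carrier R" using \<open>x \<in> QS\<close> unfolding QS_def by blast
      have "b \<oplus> \<theta> a \<otimes> a \<in> carrier R" using x by simp
      hence "U a (b \<oplus> \<theta> a \<otimes> a) \<in> QS" using x unfolding QS_def by blast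
      thus ?thesis using U_inv x by simp
    qed
    show "x \<otimes>\<^bsub>S\<^esub> y \<in> QS" if "x \<in> QS" "y \<in> QS" for x y
    proof -
      obtain a b where x: "x = U a b" "a \<in> carrier R" "b \<in> carrier R" using \<open>x \<in> QS\<close> unfolding QS_def by blast
      obtain c d where y: "y = U c d" "c \<in> carrier R" "d \<in> carrier R" using \<open>y \<in> QS\<close> unfolding QS_def by blast
      have "a \<oplus> c \<in> carrier R" "b \<oplus> d \<oplus> \<theta> a \<otimes> c \<in> carrier R" using x y by auto
      hence "U (a \<oplus> c) (b \<oplus> d \<oplus> \<theta> a \<otimes> c) \<in> QS" unfolding QS_def by blast
      thus ?thesis using U_mult x y by simp
    qed
  qed
  show "subgroup KS S"
  proof (rule S.subgroupI)
    show "KS \<subseteq> carrier S" using generators_in_Sz unfolding KS_def by auto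
    show "KS \<noteq> {}" unfolding KS_def using one_closed by force
    show "inv\<^bsub>S\<^esub> x \<in> KS" if "x \<in> KS" for x
      using that D_inv nonzero_inv unfolding KS_def by auto
    show "x \<otimes>\<^bsub>S\<^esub> y \<in> KS" if "x \<in> KS" "y \<in> KS" for x y
      using that D_mult unfolding KS_def by (auto simp: integral_iff)
  qed
  show "QS \<noteq> {\<one>\<^bsub>S\<^esub>}"
  proof
    assume "QS = {\<one>\<^bsub>S\<^esub>}"
    moreover have "U \<one> \<zero> \<in> QS" unfolding QS_def by blast
    ultimately have "U \<one> \<zero> = U \<zero> \<zero>" by (simp add: one_M(1))
    thus False by (simp add: U_eq_iff)
  qed
  show "QS \<inter> KS = {\<one>\<^bsub>S\<^esub>}"
  proof (intro equalityI subsetI)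
    fix x assume "x \<in> QS \<inter> KS"
    then obtain a b \<mu> where x: "x = U a b" "x = D \<mu>" unfolding QS_def KS_def by blast
    hence "U a b (1, 0) = D \<mu> (1, 0)" "U a b (2, 0) = D \<mu> (2, 0)" by simp_all
    hence "a = \<zero>" "b = \<zero>" unfolding U_def D_def unip_def diag_def by simp_all
    thus "x \<in> {\<one>\<^bsub>S\<^esub>}" using x one_M(1) by simp
  next
    fix x assume "x \<in> {\<one>\<^bsub>S\<^esub>}"
    hence x: "x = U \<zero> \<zero>" "x = D \<one>" using one_M by auto
    have "x \<in> QS" unfolding QS_def x(1) by blast
    moreover have "x \<in> KS" unfolding KS_def x(2) by simp
    ultimately show "x \<in> QS \<inter> KS" by blast
  qed
  show "k \<otimes>\<^bsub>S\<^esub> l = l \<otimes>\<^bsub>S\<^esub> k" if "k \<in> KS" "l \<in> KS" for k l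
    using that D_mult m_comm unfolding KS_def by auto
  show "S.conjugate k u \<in> QS" if "k \<in> KS" "u \<in> QS" for k u
  proof -
    obtain \<mu> where k: "k = D \<mu>" "\<mu> \<in> carrier R" "\<mu> \<noteq> \<zero>" using \<open>k \<in> KS\<close> unfolding KS_def by blast
    obtain a b where u: "u = U a b" "a \<in> carrier R" "b \<in> carrier R" using \<open>u \<in> QS\<close> unfolding QS_def by blast
    let ?x = "\<theta> \<mu>" and ?y = "\<mu> \<otimes> \<mu> \<otimes> \<theta> \<mu>"
    have xy: "?x \<in> carrier R" "?x \<noteq> \<zero>" "?y \<in> carrier R" "?y \<noteq> \<zero>"
      using k by (auto simp: \<theta>_zero_iff integral_iff)
    note ix = nonzero_inv[OF xy(1,2)] and iy = nonzero_inv[OF xy(3,4)]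
    have "?x \<otimes> (inv ?x \<otimes> a) = a" using xy(1) ix u by (metis l_one m_assoc)
    moreover have "?y \<otimes> (inv ?y \<otimes> b) = b" using xy(3) iy u by (metis l_one m_assoc)
    ultimately have "S.conjugate k u = U (inv ?x \<otimes> a) (inv ?y \<otimes> b)"
      using conjugate_D_U[of \<mu> "inv ?x \<otimes> a" "inv ?y \<otimes> b"] k u ix(1) iy(1) by simp
    moreover have "inv ?x \<otimes> a \<in> carrier R" "inv ?y \<otimes> b \<in> carrier R" using ix(1) iy(1) u by auto
    ultimately show ?thesis unfolding QS_def by blast
  qed
  show "k = \<one>\<^bsub>S\<^esub> \<or> u = \<one>\<^bsub>S\<^esub>" if "k \<in> KS" "u \<in> QS" "S.conjugate k u = u" for k u
  proof -
    obtain \<mu> where k: "k = D \<mu>" "\<mu> \<in> carrier R" "\<mu> \<noteq> \<zero>" using \<open>k \<in> KS\<close> unfolding KS_def by blast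
    obtain a b where u: "u = U a b" "a \<in> carrier R" "b \<in> carrier R" using \<open>u \<in> QS\<close> unfolding QS_def by blast
    have c: "\<theta> \<mu> \<otimes> a \<in> carrier R" "\<mu> \<otimes> \<mu> \<otimes> \<theta> \<mu> \<otimes> b \<in> carrier R" using k u by auto
    have "S.conjugate k (U (\<theta> \<mu> \<otimes> a) (\<mu> \<otimes> \<mu> \<otimes> \<theta> \<mu> \<otimes> b)) = S.conjugate k u"
      using conjugate_D_U[of \<mu> a b] k u that(3) by simp
    hence "U (\<theta> \<mu> \<otimes> a) (\<mu> \<otimes> \<mu> \<otimes> \<theta> \<mu> \<otimes> b) = U a b"
      unfolding k(1) u(1)
      using S.conjugate_inj[OF generators_in_Sz(2)[OF k(2,3)] generators_in_Sz(1)[OF c] generators_in_Sz(1)[OF u(2,3)]] by blast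
    hence e: "\<theta> \<mu> \<otimes> a = a" "\<mu> \<otimes> \<mu> \<otimes> \<theta> \<mu> \<otimes> b = b" by (simp_all add: U_eq_iff)
    show ?thesis
    proof (cases "\<mu> = \<one>")
      case True
      thus ?thesis using k one_M(2) by simp
    next
      case False
      have "\<theta> \<mu> \<noteq> \<one>" using False k \<theta>_inj[of \<mu> \<one>] by simp
      hence "a = \<zero>" using e(1) k u by (metis \<theta>_closed l_one m_rcancel one_closed)
      moreover have "\<mu> \<otimes> \<mu> \<otimes> \<theta> \<mu> \<noteq> \<one>"
      proof
        assume "\<mu> \<otimes> \<mu> \<otimes> \<theta> \<mu> = \<one>"
        hence "\<theta> (\<mu> \<otimes> \<theta> \<mu>) = \<theta> \<one>" using k by (simp add: \<theta>_mult \<theta>_\<theta> m_comm)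
        hence "\<mu> \<otimes> \<theta> \<mu> = \<one>" using k \<theta>_inj[of "\<mu> \<otimes> \<theta> \<mu>" \<one>] by simp
        thus False using norm_one False k by blast
      qed
      hence "b = \<zero>" using e(2) k u by (metis \<theta>_closed l_one m_rcancel one_closed m_closed)
      ultimately show ?thesis using u one_M(1) by simp
    qed
  qed
  show "k = \<one>\<^bsub>S\<^esub>" if "k \<in> KS" "k \<otimes>\<^bsub>S\<^esub> k = \<one>\<^bsub>S\<^esub>" for k
  proof -
    obtain \<mu> where k: "k = D \<mu>" "\<mu> \<in> carrier R" "\<mu> \<noteq> \<zero>" using \<open>k \<in> KS\<close> unfolding KS_def by blast
    hence "\<mu> \<otimes> \<mu> = \<one> \<otimes> \<one>" using that(2) by (simp add: D_mult one_M(2) D_eq_iff)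
    hence "\<mu> = \<one>" using k sq_inj[of \<mu> \<one>] by simp
    thus ?thesis using k one_M(2) by simp
  qed
  show "flip \<in> carrier S" by (rule generators_in_Sz(3))
  show "flip \<otimes>\<^bsub>S\<^esub> flip = \<one>\<^bsub>S\<^esub>" using flip_inverse by simp
  show "flip \<otimes>\<^bsub>S\<^esub> k \<otimes>\<^bsub>S\<^esub> flip = inv\<^bsub>S\<^esub> k" if "k \<in> KS" for k
    using that D_inv flip_D_flip unfolding KS_def by auto
  show "flip \<noteq> u \<otimes>\<^bsub>S\<^esub> k" if "u \<in> QS" "k \<in> KS" for u k
  proof
    assume e: "flip = u \<otimes>\<^bsub>S\<^esub> k"
    obtain \<mu> where k: "k = D \<mu>" "\<mu> \<in> carrier R" "\<mu> \<noteq> \<zero>" using \<open>k \<in> KS\<close> unfolding KS_def by blast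
    obtain a b where u: "u = U a b" "a \<in> carrier R" "b \<in> carrier R" using \<open>u \<in> QS\<close> unfolding QS_def by blast
    have "C a b \<mu> = \<one>\<^bsub>M\<^esub>" using C_eq[of \<mu> a b] e k u flip_inverse by simp
    hence "\<mu> \<otimes> \<theta> \<mu> = \<one>\<^bsub>M\<^esub> (0, 3)" using cell_corner[of a b \<mu>] by simp
    hence "\<mu> \<otimes> \<theta> \<mu> = \<zero>" unfolding mat_monoid_simps scalar_mat_4 by simp
    thus False using k by (simp add: integral_iff \<theta>_zero_iff)
  qed
  show "\<exists>v\<in>QS. \<exists>k\<in>KS. \<exists>w\<in>QS. flip \<otimes>\<^bsub>S\<^esub> u \<otimes>\<^bsub>S\<^esub> flip = v \<otimes>\<^bsub>S\<^esub> k \<otimes>\<^bsub>S\<^esub> flip \<otimes>\<^bsub>S\<^esub> w"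
    if "u \<in> QS" "u \<noteq> \<one>\<^bsub>S\<^esub>" for u
  proof -
    obtain a b where u: "u = U a b" "a \<in> carrier R" "b \<in> carrier R" using \<open>u \<in> QS\<close> unfolding QS_def by blast
    have "a \<noteq> \<zero> \<or> b \<noteq> \<zero>" using u that(2) one_M(1) by auto
    then obtain a1 b1 \<mu> a2 b2 where *: "a1 \<in> carrier R" "b1 \<in> carrier R" "\<mu> \<in> carrier R" "\<mu> \<noteq> \<zero>"
      "a2 \<in> carrier R" "b2 \<in> carrier R"
      "flip \<otimes>\<^bsub>M\<^esub> U a b \<otimes>\<^bsub>M\<^esub> flip = C a1 b1 \<mu> \<otimes>\<^bsub>M\<^esub> U a2 b2" by (rule flip_U_flip[OF u(2,3)])
    have "flip \<otimes>\<^bsub>S\<^esub> u \<otimes>\<^bsub>S\<^esub> flip = U a1 b1 \<otimes>\<^bsub>S\<^esub> D \<mu> \<otimes>\<^bsub>S\<^esub> flip \<otimes>\<^bsub>S\<^esub> U a2 b2"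
      using * u C_eq[of \<mu> a1 b1] by simp
    moreover have "U a1 b1 \<in> QS" "U a2 b2 \<in> QS" "D \<mu> \<in> KS" using * unfolding QS_def KS_def by auto
    ultimately show ?thesis by blast
  qed
  show "carrier S = generate S (QS \<union> KS \<union> {flip})"
    unfolding Sz_simps(1) unfolding Sz_eq
    by (rule group.generate_consistent[OF group_GL _ subgroup_Sz, symmetric])
       (auto intro: generate.incl)
qed

end

section \<open>Cyclic vectors and abelian centralizers in the Suzuki groups\<close>

context ring
begin

text \<open>Linear combinations of \<open>n\<close> matrices of size \<open>n\<close>. Vectors are represented as matrices with equal
  columns, so that the action on vectors is the multiplication of the matrix monoid itself.\<close>

definition lincomb :: "nat \<Rightarrow> (nat \<Rightarrow> 'a) \<Rightarrow> (nat \<Rightarrow> nat \<times> nat \<Rightarrow> 'a) \<Rightarrow> nat \<times> nat \<Rightarrow> 'a" where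
  "lincomb n c A = (\<lambda>(i, j)\<in>{..<n} \<times> {..<n}. \<Oplus>m\<in>{..<n}. c m \<otimes> A m (i, j))"

lemma lincomb_closed:
  assumes "c \<in> {..<n} \<rightarrow> carrier R" "\<And>m. m < n \<Longrightarrow> A m \<in> carrier (mat_monoid n R)"
  shows "lincomb n c A \<in> carrier (mat_monoid n R)"
proof -
  have "(\<Oplus>m\<in>{..<n}. c m \<otimes> A m (i, j)) \<in> carrier R" if "i < n" "j < n" for i j
    using that assms by (intro finsum_closed) (auto simp: Pi_def mat_entry_closed[of _ n R])
  thus ?thesis unfolding lincomb_def mat_monoid_simps by auto
qed

lemma lincomb_cong:
  assumes "c \<in> {..<n} \<rightarrow> carrier R" "\<And>m. m < n \<Longrightarrow> A m = B m" "\<And>m. m < n \<Longrightarrow> B m \<in> carrier (mat_monoid n R)"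
  shows "lincomb n c A = lincomb n c B"
  unfolding lincomb_def using assms
  by (intro restrict_ext) (auto intro!: finsum_cong' simp: Pi_def mat_entry_closed[of _ n R])

end

context cring
begin

lemma mat_mult_lincomb:
  assumes X: "X \<in> carrier (mat_monoid n R)"
    and c: "c \<in> {..<n} \<rightarrow> carrier R" and A: "\<And>m. m < n \<Longrightarrow> A m \<in> carrier (mat_monoid n R)"
  shows "X \<otimes>\<^bsub>mat_monoid n R\<^esub> lincomb n c A = lincomb n c (\<lambda>m. X \<otimes>\<^bsub>mat_monoid n R\<^esub> A m)"
proof (rule mat_monoid_eqI[of _ n R])
  fix i j assume ij: "i < n" "j < n"
  have cl: "X (i, k) \<in> carrier R" "A m (k, j) \<in> carrier R" "c m \<in> carrier R"
    if "k < n" "m < n" for k m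
    using that ij X c A by (auto simp: Pi_def mat_entry_closed[of _ n R])
  have "(X \<otimes>\<^bsub>mat_monoid n R\<^esub> lincomb n c A) (i, j)
      = (\<Oplus>k\<in>{..<n}. X (i, k) \<otimes> (\<Oplus>m\<in>{..<n}. c m \<otimes> A m (k, j)))"
    unfolding mat_monoid_mult_entry[OF ij] using cl ij
    by (intro finsum_cong') (auto simp: lincomb_def intro!: finsum_closed m_closed)
  also have "\<dots> = (\<Oplus>k\<in>{..<n}. \<Oplus>m\<in>{..<n}. c m \<otimes> (X (i, k) \<otimes> A m (k, j)))"
  proof (rule finsum_cong')
    fix k assume k: "k \<in> {..<n}"
    have "X (i, k) \<otimes> (\<Oplus>m\<in>{..<n}. c m \<otimes> A m (k, j)) = (\<Oplus>m\<in>{..<n}. X (i, k) \<otimes> (c m \<otimes> A m (k, j)))"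
      using cl k by (intro finsum_rdistr) auto
    also have "\<dots> = (\<Oplus>m\<in>{..<n}. c m \<otimes> (X (i, k) \<otimes> A m (k, j)))"
      using cl k by (intro finsum_cong') (auto simp: m_lcomm)
    finally show "X (i, k) \<otimes> (\<Oplus>m\<in>{..<n}. c m \<otimes> A m (k, j))
      = (\<Oplus>m\<in>{..<n}. c m \<otimes> (X (i, k) \<otimes> A m (k, j)))" .
  qed (use cl in \<open>auto intro!: finsum_closed m_closed\<close>)
  also have "\<dots> = (\<Oplus>m\<in>{..<n}. \<Oplus>k\<in>{..<n}. c m \<otimes> (X (i, k) \<otimes> A m (k, j)))"
    using cl by (intro finsum_swap) auto
  also have "\<dots> = (\<Oplus>m\<in>{..<n}. c m \<otimes> (X \<otimes>\<^bsub>mat_monoid n R\<^esub> A m) (i, j))"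
    using cl ij by (intro finsum_cong')
      (auto simp: mat_monoid_mult_entry finsum_rdistr intro!: finsum_closed m_closed)
  also have "\<dots> = lincomb n c (\<lambda>m. X \<otimes>\<^bsub>mat_monoid n R\<^esub> A m) (i, j)"
    using ij by (simp add: lincomb_def)
  finally show "(X \<otimes>\<^bsub>mat_monoid n R\<^esub> lincomb n c A) (i, j)
    = lincomb n c (\<lambda>m. X \<otimes>\<^bsub>mat_monoid n R\<^esub> A m) (i, j)" .
qed (use X c A in \<open>auto intro!: mat_mult_closed lincomb_closed\<close>)

lemma lincomb_swap:
  assumes c: "c \<in> {..<n} \<rightarrow> carrier R" and d: "d \<in> {..<n} \<rightarrow> carrier R"
    and A: "\<And>l m. l < n \<Longrightarrow> m < n \<Longrightarrow> A l m \<in> carrier (mat_monoid n R)"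
  shows "lincomb n c (\<lambda>l. lincomb n d (A l)) = lincomb n d (\<lambda>m. lincomb n c (\<lambda>l. A l m))"
proof (rule mat_monoid_eqI[of _ n R])
  fix i j assume ij: "i < n" "j < n"
  have cl: "A l m (i, j) \<in> carrier R" "c l \<in> carrier R" "d m \<in> carrier R" if "l < n" "m < n" for l m
    using that ij c d A by (auto simp: Pi_def mat_entry_closed[of _ n R])
  have "lincomb n c (\<lambda>l. lincomb n d (A l)) (i, j)
      = (\<Oplus>l\<in>{..<n}. \<Oplus>m\<in>{..<n}. c l \<otimes> (d m \<otimes> A l m (i, j)))"
    using ij cl by (simp add: lincomb_def)
      (intro finsum_cong' finsum_rdistr, auto intro!: finsum_closed m_closed)
  also have "\<dots> = (\<Oplus>m\<in>{..<n}. \<Oplus>l\<in>{..<n}. c l \<otimes> (d m \<otimes> A l m (i, j)))"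
    using cl by (intro finsum_swap) auto
  also have "\<dots> = (\<Oplus>m\<in>{..<n}. d m \<otimes> (\<Oplus>l\<in>{..<n}. c l \<otimes> A l m (i, j)))"
  proof (rule finsum_cong')
    fix m assume m: "m \<in> {..<n}"
    have "(\<Oplus>l\<in>{..<n}. c l \<otimes> (d m \<otimes> A l m (i, j))) = (\<Oplus>l\<in>{..<n}. d m \<otimes> (c l \<otimes> A l m (i, j)))"
      using cl m by (intro finsum_cong') (auto simp: m_lcomm)
    also have "\<dots> = d m \<otimes> (\<Oplus>l\<in>{..<n}. c l \<otimes> A l m (i, j))"
      using cl m by (intro finsum_rdistr[symmetric]) auto
    finally show "(\<Oplus>l\<in>{..<n}. c l \<otimes> (d m \<otimes> A l m (i, j))) = d m \<otimes> (\<Oplus>l\<in>{..<n}. c l \<otimes> A l m (i, j))" .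
  qed (use cl in \<open>auto intro!: finsum_closed m_closed\<close>)
  also have "\<dots> = lincomb n d (\<lambda>m. lincomb n c (\<lambda>l. A l m)) (i, j)"
    using ij by (simp add: lincomb_def)
  finally show "lincomb n c (\<lambda>l. lincomb n d (A l)) (i, j) = lincomb n d (\<lambda>m. lincomb n c (\<lambda>l. A l m)) (i, j)" .
qed (use c d A in \<open>auto intro!: lincomb_closed\<close>)

text \<open>\<open>Y\<close> and \<open>Z\<close> agree on \<open>E\<close> with polynomials in \<open>X\<close>, and since they commute with \<open>X\<close> both products \<open>Y Z E\<close> and
  \<open>Z Y E\<close> come out as the product of these polynomials applied to \<open>E\<close>.\<close>

lemma cyclic_commute:
  fixes n :: nat
  defines "M \<equiv> mat_monoid n R"
  assumes X: "X \<in> carrier M" and Y: "Y \<in> carrier M" and Z: "Z \<in> carrier M" and E: "E \<in> carrier M"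
    and XY: "X \<otimes>\<^bsub>M\<^esub> Y = Y \<otimes>\<^bsub>M\<^esub> X" and XZ: "X \<otimes>\<^bsub>M\<^esub> Z = Z \<otimes>\<^bsub>M\<^esub> X"
    and c: "c \<in> {..<n} \<rightarrow> carrier R" and d: "d \<in> {..<n} \<rightarrow> carrier R"
    and YE: "Y \<otimes>\<^bsub>M\<^esub> E = lincomb n c (\<lambda>m. X [^]\<^bsub>M\<^esub> m \<otimes>\<^bsub>M\<^esub> E)"
    and ZE: "Z \<otimes>\<^bsub>M\<^esub> E = lincomb n d (\<lambda>m. X [^]\<^bsub>M\<^esub> m \<otimes>\<^bsub>M\<^esub> E)"
  shows "Y \<otimes>\<^bsub>M\<^esub> Z \<otimes>\<^bsub>M\<^esub> E = Z \<otimes>\<^bsub>M\<^esub> Y \<otimes>\<^bsub>M\<^esub> E"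
proof -
  interpret M: monoid M unfolding M_def by (rule mat_monoid_is_monoid)
  have comm: "W \<otimes>\<^bsub>M\<^esub> X [^]\<^bsub>M\<^esub> m = X [^]\<^bsub>M\<^esub> m \<otimes>\<^bsub>M\<^esub> W" if "W \<in> carrier M" "X \<otimes>\<^bsub>M\<^esub> W = W \<otimes>\<^bsub>M\<^esub> X" for W and m :: nat
    using that X by (induction m) (simp_all, metis M.m_assoc M.nat_pow_closed)
  have step: "V \<otimes>\<^bsub>M\<^esub> W \<otimes>\<^bsub>M\<^esub> E = lincomb n d (\<lambda>m. lincomb n c (\<lambda>l. X [^]\<^bsub>M\<^esub> (m + l) \<otimes>\<^bsub>M\<^esub> E))"
    if V: "V \<in> carrier M" "X \<otimes>\<^bsub>M\<^esub> V = V \<otimes>\<^bsub>M\<^esub> X" and W: "W \<in> carrier M" "X \<otimes>\<^bsub>M\<^esub> W = W \<otimes>\<^bsub>M\<^esub> X"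
      and c: "c \<in> {..<n} \<rightarrow> carrier R" and d: "d \<in> {..<n} \<rightarrow> carrier R"
      and VE: "V \<otimes>\<^bsub>M\<^esub> E = lincomb n c (\<lambda>m. X [^]\<^bsub>M\<^esub> m \<otimes>\<^bsub>M\<^esub> E)"
      and WE: "W \<otimes>\<^bsub>M\<^esub> E = lincomb n d (\<lambda>m. X [^]\<^bsub>M\<^esub> m \<otimes>\<^bsub>M\<^esub> E)" for V W c d
  proof -
    have P: "X [^]\<^bsub>M\<^esub> m \<otimes>\<^bsub>M\<^esub> E \<in> carrier M" for m :: nat using X E by simp
    have "V \<otimes>\<^bsub>M\<^esub> W \<otimes>\<^bsub>M\<^esub> E = V \<otimes>\<^bsub>M\<^esub> lincomb n d (\<lambda>m. X [^]\<^bsub>M\<^esub> m \<otimes>\<^bsub>M\<^esub> E)"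
      using V W E by (simp add: M.m_assoc WE)
    also have "\<dots> = lincomb n d (\<lambda>m. V \<otimes>\<^bsub>M\<^esub> (X [^]\<^bsub>M\<^esub> m \<otimes>\<^bsub>M\<^esub> E))"
      using V d P unfolding M_def by (intro mat_mult_lincomb) auto
    also have "\<dots> = lincomb n d (\<lambda>m. lincomb n c (\<lambda>l. X [^]\<^bsub>M\<^esub> (m + l) \<otimes>\<^bsub>M\<^esub> E))"
    proof (rule lincomb_cong[OF d])
      fix m :: nat
      have "V \<otimes>\<^bsub>M\<^esub> (X [^]\<^bsub>M\<^esub> m \<otimes>\<^bsub>M\<^esub> E) = X [^]\<^bsub>M\<^esub> m \<otimes>\<^bsub>M\<^esub> (V \<otimes>\<^bsub>M\<^esub> E)"
        using V X E comm[OF V] by (metis M.m_assoc M.nat_pow_closed)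
      also have "\<dots> = lincomb n c (\<lambda>l. X [^]\<^bsub>M\<^esub> m \<otimes>\<^bsub>M\<^esub> (X [^]\<^bsub>M\<^esub> l \<otimes>\<^bsub>M\<^esub> E))"
        unfolding VE using X c P unfolding M_def by (intro mat_mult_lincomb) (auto simp flip: M_def)
      also have "\<dots> = lincomb n c (\<lambda>l. X [^]\<^bsub>M\<^esub> (m + l) \<otimes>\<^bsub>M\<^esub> E)"
        using c P X E unfolding M_def
        by (intro lincomb_cong) (auto simp flip: M_def simp: M.nat_pow_mult[symmetric] M.m_assoc)
      finally show "V \<otimes>\<^bsub>M\<^esub> (X [^]\<^bsub>M\<^esub> m \<otimes>\<^bsub>M\<^esub> E) = lincomb n c (\<lambda>l. X [^]\<^bsub>M\<^esub> (m + l) \<otimes>\<^bsub>M\<^esub> E)" .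
      show "lincomb n c (\<lambda>l. X [^]\<^bsub>M\<^esub> (m + l) \<otimes>\<^bsub>M\<^esub> E) \<in> carrier (mat_monoid n R)"
        using c P unfolding M_def by (intro lincomb_closed) auto
    qed
    finally show ?thesis .
  qed
  have "Y \<otimes>\<^bsub>M\<^esub> Z \<otimes>\<^bsub>M\<^esub> E = lincomb n d (\<lambda>m. lincomb n c (\<lambda>l. X [^]\<^bsub>M\<^esub> (m + l) \<otimes>\<^bsub>M\<^esub> E))"
    by (rule step[OF Y XY Z XZ c d YE ZE])
  also have "\<dots> = lincomb n c (\<lambda>l. lincomb n d (\<lambda>m. X [^]\<^bsub>M\<^esub> (m + l) \<otimes>\<^bsub>M\<^esub> E))"
    using c d X E unfolding M_def by (intro lincomb_swap) (auto simp flip: M_def)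
  also have "\<dots> = lincomb n c (\<lambda>l. lincomb n d (\<lambda>m. X [^]\<^bsub>M\<^esub> (l + m) \<otimes>\<^bsub>M\<^esub> E))"
    by (simp add: add.commute)
  also have "\<dots> = Z \<otimes>\<^bsub>M\<^esub> Y \<otimes>\<^bsub>M\<^esub> E"
    by (rule step[OF Z XZ Y XY d c ZE YE, symmetric])
  finally show ?thesis .
qed

end

definition colmat :: "'a \<Rightarrow> 'a \<Rightarrow> 'a \<Rightarrow> 'a \<Rightarrow> nat \<times> nat \<Rightarrow> 'a" where
  "colmat x0 x1 x2 x3 = mat_of_rows 4
    [[x0, x0, x0, x0], [x1, x1, x1, x1], [x2, x2, x2, x2], [x3, x3, x3, x3]]"

definition rowmat :: "'a \<Rightarrow> 'a \<Rightarrow> 'a \<Rightarrow> 'a \<Rightarrow> nat \<times> nat \<Rightarrow> 'a" where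
  "rowmat x0 x1 x2 x3 = mat_of_rows 4
    [[x0, x1, x2, x3], [x0, x1, x2, x3], [x0, x1, x2, x3], [x0, x1, x2, x3]]"

lemma monoid_pow_cong:
  assumes "mult G = mult H" "\<one>\<^bsub>G\<^esub> = \<one>\<^bsub>H\<^esub>"
  shows "x [^]\<^bsub>G\<^esub> (n::nat) = x [^]\<^bsub>H\<^esub> n"
  using assms by (induction n) (simp_all add: nat_pow_def)

context field
begin

lemma cell_colmat:
  assumes \<alpha>: "\<mu> \<in> carrier R" "\<nu> \<in> carrier R" "w \<in> carrier R" "v \<in> carrier R"
    "a \<in> carrier R" "\<alpha> \<in> carrier R" "b \<in> carrier R" "\<beta> \<in> carrier R"
    "x0 \<in> carrier R" "x1 \<in> carrier R" "x2 \<in> carrier R" "x3 \<in> carrier R"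
  shows "cell a \<alpha> b \<beta> \<mu> \<nu> w v \<otimes>\<^bsub>mat_monoid 4 R\<^esub> colmat x0 x1 x2 x3 =
    colmat (\<mu> \<otimes> \<nu> \<otimes> x3) (\<mu> \<otimes> x2 \<oplus> a \<otimes> (\<mu> \<otimes> \<nu>) \<otimes> x3)
      (w \<otimes> x1 \<oplus> \<alpha> \<otimes> \<mu> \<otimes> x2 \<oplus> b \<otimes> (\<mu> \<otimes> \<nu>) \<otimes> x3)
      (w \<otimes> v \<otimes> x0 \<oplus> a \<otimes> w \<otimes> x1 \<oplus> (a \<otimes> \<alpha> \<oplus> b) \<otimes> \<mu> \<otimes> x2
        \<oplus> (a [^] (2::nat) \<otimes> \<alpha> \<oplus> a \<otimes> b \<oplus> \<beta>) \<otimes> (\<mu> \<otimes> \<nu>) \<otimes> x3)"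
  unfolding cell_def colmat_def
  by (subst mat4_mult) (use \<alpha> in simp_all)

lemma rowmat_cell:
  assumes \<alpha>: "\<mu> \<in> carrier R" "\<nu> \<in> carrier R" "w \<in> carrier R" "v \<in> carrier R"
    "a \<in> carrier R" "\<alpha> \<in> carrier R" "b \<in> carrier R" "\<beta> \<in> carrier R"
    "x0 \<in> carrier R" "x1 \<in> carrier R" "x2 \<in> carrier R"
  shows "rowmat x0 x1 x2 \<zero> \<otimes>\<^bsub>mat_monoid 4 R\<^esub> cell a \<alpha> b \<beta> \<mu> \<nu> w v =
    rowmat \<zero> (x2 \<otimes> w) (x1 \<otimes> \<mu> \<oplus> x2 \<otimes> (\<alpha> \<otimes> \<mu>))
      (x0 \<otimes> (\<mu> \<otimes> \<nu>) \<oplus> x1 \<otimes> (a \<otimes> (\<mu> \<otimes> \<nu>)) \<oplus> x2 \<otimes> (b \<otimes> (\<mu> \<otimes> \<nu>)))"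
  unfolding cell_def rowmat_def
  by (subst mat4_mult) (use \<alpha> in simp_all)

lemma scalar_rowmat:
  assumes "c \<in> carrier R" "x0 \<in> carrier R" "x1 \<in> carrier R" "x2 \<in> carrier R" "x3 \<in> carrier R"
  shows "scalar_mat 4 R c \<otimes>\<^bsub>mat_monoid 4 R\<^esub> rowmat x0 x1 x2 x3
    = rowmat (c \<otimes> x0) (c \<otimes> x1) (c \<otimes> x2) (c \<otimes> x3)"
  unfolding scalar_mat_4 rowmat_def
  by (subst mat4_mult) (use assms in simp_all)

lemma scalar_scalar:
  assumes "c \<in> carrier R" "d \<in> carrier R"
  shows "scalar_mat 4 R c \<otimes>\<^bsub>mat_monoid 4 R\<^esub> scalar_mat 4 R d = scalar_mat 4 R (c \<otimes> d)"
  unfolding scalar_mat_4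
  by (subst mat4_mult) (use assms in simp_all)

lemma colmat_closed:
  "x0 \<in> carrier R \<Longrightarrow> x1 \<in> carrier R \<Longrightarrow> x2 \<in> carrier R \<Longrightarrow> x3 \<in> carrier R \<Longrightarrow>
    colmat x0 x1 x2 x3 \<in> carrier (mat_monoid 4 R)"
  "x0 \<in> carrier R \<Longrightarrow> x1 \<in> carrier R \<Longrightarrow> x2 \<in> carrier R \<Longrightarrow> x3 \<in> carrier R \<Longrightarrow>
    rowmat x0 x1 x2 x3 \<in> carrier (mat_monoid 4 R)"
  unfolding colmat_def rowmat_def by (intro mat4_closed; simp)+

text \<open>The vectors \<open>e\<close>, \<open>X e\<close>, \<open>X\<^sup>2 e\<close>, \<open>X\<^sup>3 e\<close> for the last basis vector \<open>e\<close> and a cell matrix \<open>X\<close> are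
  \<open>(0, 0, 0, 1)\<close>, \<open>(m0, a m0, b m0, f)\<close>, \<open>(g0, g1, g2, g3)\<close>, \<open>(h0, h1, h2, h3)\<close>. The row
  \<open>(?p0, ?p1, b, 0)\<close> annihilates the first three and takes \<open>X\<^sup>3 e\<close> to a multiple of the form that is
  assumed to be nonzero, so \<open>d3 = 0\<close>; the other coefficients then follow by elimination.\<close>

lemma krylov_independent:
  assumes c: "\<one> \<oplus> \<one> = \<zero>" and wm: "w \<otimes> \<mu> = \<one>"
    and R: "\<mu> \<in> carrier R" "m0 \<in> carrier R" "w \<in> carrier R" "a \<in> carrier R" "\<alpha> \<in> carrier R"
      "b \<in> carrier R" "f \<in> carrier R" "g3 \<in> carrier R" "h3 \<in> carrier R"
      "d0 \<in> carrier R" "d1 \<in> carrier R" "d2 \<in> carrier R" "d3 \<in> carrier R"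
    and g: "g0 = m0 \<otimes> f" "g1 = \<mu> \<otimes> (b \<otimes> m0) \<oplus> a \<otimes> m0 \<otimes> f"
      "g2 = w \<otimes> (a \<otimes> m0) \<oplus> \<alpha> \<otimes> \<mu> \<otimes> (b \<otimes> m0) \<oplus> b \<otimes> m0 \<otimes> f"
    and h: "h0 = m0 \<otimes> g3" "h1 = \<mu> \<otimes> g2 \<oplus> a \<otimes> m0 \<otimes> g3"
      "h2 = w \<otimes> g1 \<oplus> \<alpha> \<otimes> \<mu> \<otimes> g2 \<oplus> b \<otimes> m0 \<otimes> g3"
    and e0: "d1 \<otimes> m0 \<oplus> d2 \<otimes> g0 \<oplus> d3 \<otimes> h0 = \<zero>"
    and e1: "d1 \<otimes> (a \<otimes> m0) \<oplus> d2 \<otimes> g1 \<oplus> d3 \<otimes> h1 = \<zero>"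
    and e2: "d1 \<otimes> (b \<otimes> m0) \<oplus> d2 \<otimes> g2 \<oplus> d3 \<otimes> h2 = \<zero>"
    and e3: "d0 \<oplus> d1 \<otimes> f \<oplus> d2 \<otimes> g3 \<oplus> d3 \<otimes> h3 = \<zero>"
    and nz: "m0 \<noteq> \<zero>" "a \<noteq> \<zero> \<or> b \<noteq> \<zero>" "b \<otimes> b \<oplus> a \<otimes> \<alpha> \<otimes> b \<oplus> a \<otimes> a \<otimes> w \<otimes> w \<noteq> \<zero>"
  shows "d0 = \<zero> \<and> d1 = \<zero> \<and> d2 = \<zero> \<and> d3 = \<zero>"
proof -
  let ?p1 = "\<alpha> \<otimes> b \<oplus> a \<otimes> w \<otimes> w"
  let ?p0 = "a \<otimes> ?p1 \<oplus> b \<otimes> b"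
  have \<mu>0: "\<mu> \<noteq> \<zero>" and w0: "w \<noteq> \<zero>" using wm R by auto
  note cl = R(1-9)
  have gc: "g0 \<in> carrier R" "g1 \<in> carrier R" "g2 \<in> carrier R" using R unfolding g by auto
  have hc: "h0 \<in> carrier R" "h1 \<in> carrier R" "h2 \<in> carrier R" using R gc unfolding h by auto
  have "?p0 \<otimes> (d1 \<otimes> m0 \<oplus> d2 \<otimes> g0 \<oplus> d3 \<otimes> h0) \<oplus> ?p1 \<otimes> (d1 \<otimes> (a \<otimes> m0) \<oplus> d2 \<otimes> g1 \<oplus> d3 \<otimes> h1)
      \<oplus> b \<otimes> (d1 \<otimes> (b \<otimes> m0) \<oplus> d2 \<otimes> g2 \<oplus> d3 \<otimes> h2)
    = d3 \<otimes> (m0 \<otimes> (b \<otimes> b \<oplus> a \<otimes> \<alpha> \<otimes> b \<oplus> a \<otimes> a \<otimes> w \<otimes> w))"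
    unfolding h g using R by - (rule ring_eqI2[OF c wm], (rule reify | simp)+)
  hence "d3 \<otimes> (m0 \<otimes> (b \<otimes> b \<oplus> a \<otimes> \<alpha> \<otimes> b \<oplus> a \<otimes> a \<otimes> w \<otimes> w)) = \<zero>"
    unfolding e0 e1 e2 using R by simp
  hence d3: "d3 = \<zero>" using nz R integral_iff by simp
  have e0': "d1 \<otimes> m0 \<oplus> d2 \<otimes> g0 = \<zero>" and e1': "d1 \<otimes> (a \<otimes> m0) \<oplus> d2 \<otimes> g1 = \<zero>"
    and e2': "d1 \<otimes> (b \<otimes> m0) \<oplus> d2 \<otimes> g2 = \<zero>"
    using e0 e1 e2 d3 R gc hc by simp_all
  have "(d1 \<otimes> (a \<otimes> m0) \<oplus> d2 \<otimes> g1) \<oplus> a \<otimes> (d1 \<otimes> m0 \<oplus> d2 \<otimes> g0) = d2 \<otimes> (\<mu> \<otimes> (b \<otimes> m0))"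
    unfolding g using R by - (rule ring_eqI1[OF c], (rule reify | simp)+)
  hence 1: "d2 \<otimes> (\<mu> \<otimes> (b \<otimes> m0)) = \<zero>" unfolding e0' e1' using R by simp
  have "(d1 \<otimes> (b \<otimes> m0) \<oplus> d2 \<otimes> g2) \<oplus> b \<otimes> (d1 \<otimes> m0 \<oplus> d2 \<otimes> g0)
      = d2 \<otimes> (w \<otimes> (a \<otimes> m0) \<oplus> \<alpha> \<otimes> \<mu> \<otimes> (b \<otimes> m0))"
    unfolding g using R by - (rule ring_eqI1[OF c], (rule reify | simp)+)
  hence 2: "d2 \<otimes> (w \<otimes> (a \<otimes> m0) \<oplus> \<alpha> \<otimes> \<mu> \<otimes> (b \<otimes> m0)) = \<zero>" unfolding e0' e2' using R by simp
  have d2: "d2 = \<zero>"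
  proof (cases "b = \<zero>")
    case True
    thus ?thesis using 2 nz w0 R integral_iff by simp
  next
    case False
    thus ?thesis using 1 nz \<mu>0 R integral_iff by simp
  qed
  have d1: "d1 = \<zero>" using e0' d2 nz R gc integral_iff by simp
  have "d0 = \<zero>" using e3 d1 d2 d3 R by simp
  thus ?thesis using d1 d2 d3 by simp
qed

end

context suzuki_field
begin

abbreviation E :: "nat \<times> nat \<Rightarrow> 'a" where "E \<equiv> colmat \<zero> \<zero> \<zero> \<one>"

lemma colmat_entry:
  assumes "j < 4"
  shows "colmat x0 x1 x2 x3 (0, j) = x0" "colmat x0 x1 x2 x3 (1, j) = x1"
    "colmat x0 x1 x2 x3 (Suc 0, j) = x1" "colmat x0 x1 x2 x3 (2, j) = x2"
    "colmat x0 x1 x2 x3 (3, j) = x3"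
  using assms unfolding colmat_def using less_4_cases[of j] by auto

lemma mult_E_entry:
  assumes "A \<in> carrier M" "i < 4" "j < 4"
  shows "(A \<otimes>\<^bsub>M\<^esub> E) (i, j) = A (i, 3)"
proof -
  have cl: "A (i, k) \<in> carrier R" if "k < 4" for k
    using assms that mat_entry_closed[of A 4 R i k] by simp
  have "(A \<otimes>\<^bsub>M\<^esub> E) (i, j) = A (i, 0) \<otimes> E (0, j) \<oplus> A (i, 1) \<otimes> E (1, j) \<oplus> A (i, 2) \<otimes> E (2, j) \<oplus> A (i, 3) \<otimes> E (3, j)"
    unfolding mat_monoid_mult_entry[OF assms(2,3)]
    using cl by (intro finsum_lessThan_4) (simp_all add: colmat_entry[OF assms(3)])
  thus ?thesis using cl by (simp add: colmat_entry[OF assms(3)])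
qed

text \<open>On the finite set of coefficient vectors the evaluation map is injective by \<open>krylov_independent\<close>,
  hence onto.\<close>

lemma krylov_spans:
  assumes \<mu>: "\<mu> \<in> carrier R" "\<mu> \<noteq> \<zero>" and ab: "a \<in> carrier R" "b \<in> carrier R" "a \<noteq> \<zero> \<or> b \<noteq> \<zero>"
    and nz: "b \<otimes> b \<oplus> a \<otimes> \<theta> a \<otimes> b \<oplus> a \<otimes> a \<otimes> inv \<mu> \<otimes> inv \<mu> \<noteq> \<zero>"
    and Y: "Y \<in> carrier M"
  shows "\<exists>c\<in>{..<4} \<rightarrow> carrier R. Y \<otimes>\<^bsub>M\<^esub> E = lincomb 4 c (\<lambda>m. C a b \<mu> [^]\<^bsub>M\<^esub> m \<otimes>\<^bsub>M\<^esub> E)"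
proof -
  interpret M: monoid M by (rule mat_monoid_is_monoid)
  have t: "\<theta> \<mu> \<in> carrier R" "\<theta> \<mu> \<noteq> \<zero>" using \<mu> \<theta>_zero_iff by auto
  note i = nonzero_inv[OF \<mu>] and it = nonzero_inv[OF t]
  let ?X = "C a b \<mu>"
  have Xc: "?X \<in> carrier M" unfolding cell_def using \<mu> ab t i it by (intro mat4_closed) simp
  define m0 where "m0 = \<mu> \<otimes> \<theta> \<mu>"
  have m0: "m0 \<in> carrier R" "m0 \<noteq> \<zero>" using \<mu> t unfolding m0_def by (auto simp: integral_iff)
  define f where "f = (a [^] (2::nat) \<otimes> \<theta> a \<oplus> a \<otimes> b \<oplus> \<theta> b) \<otimes> m0"
  have fc: "f \<in> carrier R" unfolding f_def using ab m0 by simp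
  have X: "?X \<otimes>\<^bsub>M\<^esub> colmat x0 x1 x2 x3 =
    colmat (m0 \<otimes> x3) (\<mu> \<otimes> x2 \<oplus> a \<otimes> m0 \<otimes> x3)
      (inv \<mu> \<otimes> x1 \<oplus> \<theta> a \<otimes> \<mu> \<otimes> x2 \<oplus> b \<otimes> m0 \<otimes> x3)
      (inv \<mu> \<otimes> inv (\<theta> \<mu>) \<otimes> x0 \<oplus> a \<otimes> inv \<mu> \<otimes> x1 \<oplus> (a \<otimes> \<theta> a \<oplus> b) \<otimes> \<mu> \<otimes> x2 \<oplus> f \<otimes> x3)"
    if "x0 \<in> carrier R" "x1 \<in> carrier R" "x2 \<in> carrier R" "x3 \<in> carrier R" for x0 x1 x2 x3
    unfolding m0_def f_def using cell_colmat[of \<mu> "\<theta> \<mu>" "inv \<mu>" "inv (\<theta> \<mu>)" a "\<theta> a" b "\<theta> b"] \<mu> ab t i it that by simp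
  define g0 g1 g2 where g: "g0 = m0 \<otimes> f" "g1 = \<mu> \<otimes> (b \<otimes> m0) \<oplus> a \<otimes> m0 \<otimes> f"
      "g2 = inv \<mu> \<otimes> (a \<otimes> m0) \<oplus> \<theta> a \<otimes> \<mu> \<otimes> (b \<otimes> m0) \<oplus> b \<otimes> m0 \<otimes> f"
  define g3 where "g3 = inv \<mu> \<otimes> inv (\<theta> \<mu>) \<otimes> m0 \<oplus> a \<otimes> inv \<mu> \<otimes> (a \<otimes> m0) \<oplus> (a \<otimes> \<theta> a \<oplus> b) \<otimes> \<mu> \<otimes> (b \<otimes> m0) \<oplus> f \<otimes> f"
  have gc: "g0 \<in> carrier R" "g1 \<in> carrier R" "g2 \<in> carrier R" "g3 \<in> carrier R"
    unfolding g g3_def using \<mu> ab i it m0 fc by auto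
  define h0 h1 h2 where h: "h0 = m0 \<otimes> g3" "h1 = \<mu> \<otimes> g2 \<oplus> a \<otimes> m0 \<otimes> g3"
      "h2 = inv \<mu> \<otimes> g1 \<oplus> \<theta> a \<otimes> \<mu> \<otimes> g2 \<oplus> b \<otimes> m0 \<otimes> g3"
  define h3 where "h3 = inv \<mu> \<otimes> inv (\<theta> \<mu>) \<otimes> g0 \<oplus> a \<otimes> inv \<mu> \<otimes> g1 \<oplus> (a \<otimes> \<theta> a \<oplus> b) \<otimes> \<mu> \<otimes> g2 \<oplus> f \<otimes> g3"
  have hc: "h0 \<in> carrier R" "h1 \<in> carrier R" "h2 \<in> carrier R" "h3 \<in> carrier R"
    unfolding h h3_def using \<mu> ab i it m0 fc gc by auto
  define V where "V m = ?X [^]\<^bsub>M\<^esub> m \<otimes>\<^bsub>M\<^esub> E" for m :: nat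
  have Ec: "E \<in> carrier M" by (intro colmat_closed) simp_all
  have VS: "V (Suc m) = ?X \<otimes>\<^bsub>M\<^esub> V m" for m
    unfolding V_def M.nat_pow_Suc2[OF Xc] using Xc Ec by (simp add: M.m_assoc)
  have V0: "V 0 = colmat \<zero> \<zero> \<zero> \<one>" unfolding V_def using Ec by simp
  have "V (Suc 0) = colmat m0 (a \<otimes> m0) (b \<otimes> m0) f"
    unfolding VS V0 using \<mu> ab i it m0 fc by (subst X) simp_all
  hence V1: "V 1 = colmat m0 (a \<otimes> m0) (b \<otimes> m0) f" by simp
  have "V (Suc 1) = colmat g0 g1 g2 g3"
    unfolding VS V1 g g3_def using ab m0 fc by (subst X) simp_all
  hence V2: "V 2 = colmat g0 g1 g2 g3" by (simp add: numeral_2_eq_2)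
  have "V (Suc 2) = colmat h0 h1 h2 h3"
    unfolding VS V2 h h3_def using gc by (subst X) simp_all
  hence V3: "V 3 = colmat h0 h1 h2 h3" by (simp add: numeral_3_eq_3 numeral_2_eq_2)
  have Vc: "V m \<in> carrier M" for m unfolding V_def using Xc Ec by simp
  have Ve: "V m (i, j) \<in> carrier R" if "i < 4" "j < 4" for m i j
    using that Vc mat_entry_closed[of "V m" 4 R i j] by simp
  let ?F = "{..<4::nat} \<rightarrow>\<^sub>E carrier R"
  define K where "K c = (\<lambda>i\<in>{..<4::nat}. \<Oplus>m\<in>{..<4}. c m \<otimes> V m (i, 0))" for c
  have Kent: "K c i = c 0 \<otimes> V 0 (i, 0) \<oplus> c 1 \<otimes> V 1 (i, 0) \<oplus> c 2 \<otimes> V 2 (i, 0) \<oplus> c 3 \<otimes> V 3 (i, 0)"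
    if "c \<in> ?F" "i < 4" for c i
  proof -
    have "K c i = (\<Oplus>m\<in>{..<4}. c m \<otimes> V m (i, 0))" unfolding K_def using that by simp
    also have "\<dots> = c 0 \<otimes> V 0 (i, 0) \<oplus> c 1 \<otimes> V 1 (i, 0) \<oplus> c 2 \<otimes> V 2 (i, 0) \<oplus> c 3 \<otimes> V 3 (i, 0)"
      using that Ve by (intro finsum_lessThan_4 m_closed) (auto simp: PiE_def Pi_def)
    finally show ?thesis .
  qed
  have "inj_on K ?F"
  proof (rule inj_onI)
    fix c c' assume c: "c \<in> ?F" "c' \<in> ?F" "K c = K c'"
    have cc: "c m \<in> carrier R" "c' m \<in> carrier R" if "m < 4" for m using c that by auto
    define d where "d m = c m \<oplus> c' m" for m
    have dc: "d m \<in> carrier R" if "m < 4" for m unfolding d_def using cc that by simp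
    have e: "d 0 \<otimes> V 0 (i, 0) \<oplus> d 1 \<otimes> V 1 (i, 0) \<oplus> d 2 \<otimes> V 2 (i, 0) \<oplus> d 3 \<otimes> V 3 (i, 0) = \<zero>"
      if i: "i < 4" for i
    proof -
      have gen: "(p0 \<oplus> q0) \<otimes> x0 \<oplus> (p1 \<oplus> q1) \<otimes> x1 \<oplus> (p2 \<oplus> q2) \<otimes> x2 \<oplus> (p3 \<oplus> q3) \<otimes> x3
        = (p0 \<otimes> x0 \<oplus> p1 \<otimes> x1 \<oplus> p2 \<otimes> x2 \<oplus> p3 \<otimes> x3) \<oplus> (q0 \<otimes> x0 \<oplus> q1 \<otimes> x1 \<oplus> q2 \<otimes> x2 \<oplus> q3 \<otimes> x3)"
        if "p0 \<in> carrier R" "p1 \<in> carrier R" "p2 \<in> carrier R" "p3 \<in> carrier R"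
          "q0 \<in> carrier R" "q1 \<in> carrier R" "q2 \<in> carrier R" "q3 \<in> carrier R"
          "x0 \<in> carrier R" "x1 \<in> carrier R" "x2 \<in> carrier R" "x3 \<in> carrier R"
        for p0 p1 p2 p3 q0 q1 q2 q3 x0 x1 x2 x3
        using that by - (rule ring_eqI, (rule reify | simp)+)
      have "d 0 \<otimes> V 0 (i, 0) \<oplus> d 1 \<otimes> V 1 (i, 0) \<oplus> d 2 \<otimes> V 2 (i, 0) \<oplus> d 3 \<otimes> V 3 (i, 0) = K c i \<oplus> K c' i"
        unfolding d_def Kent[OF c(1) i] Kent[OF c(2) i]
        using cc Ve[OF i] by (intro gen) simp_all
      also have "\<dots> = K c i \<oplus> K c i" using c(3) by simp
      also have "\<dots> = \<zero>" unfolding Kent[OF c(1) i] using cc Ve[OF i] by (intro double_zero) simp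
      finally show ?thesis .
    qed
    have z: "d 0 = \<zero> \<and> d 1 = \<zero> \<and> d 2 = \<zero> \<and> d 3 = \<zero>"
    proof (rule krylov_independent[OF char_two i(3) \<mu>(1) m0(1) i(1) ab(1) \<theta>_closed[OF ab(1)] ab(2) fc gc(4) hc(4)
          dc dc dc dc g h _ _ _ _ m0(2) ab(3) nz])
      show "d 1 \<otimes> m0 \<oplus> d 2 \<otimes> g0 \<oplus> d 3 \<otimes> h0 = \<zero>"
        using e[of 0] dc m0 gc hc unfolding V0 V1 V2 V3 by (simp add: colmat_entry)
      show "d 1 \<otimes> (a \<otimes> m0) \<oplus> d 2 \<otimes> g1 \<oplus> d 3 \<otimes> h1 = \<zero>"
        using e[of 1] dc m0 ab gc hc unfolding V0 V1 V2 V3 by (simp add: colmat_entry)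
      show "d 1 \<otimes> (b \<otimes> m0) \<oplus> d 2 \<otimes> g2 \<oplus> d 3 \<otimes> h2 = \<zero>"
        using e[of 2] dc m0 ab gc hc unfolding V0 V1 V2 V3 by (simp add: colmat_entry)
      show "d 0 \<oplus> d 1 \<otimes> f \<oplus> d 2 \<otimes> g3 \<oplus> d 3 \<otimes> h3 = \<zero>"
        using e[of 3] dc fc gc hc unfolding V0 V1 V2 V3 by (simp add: colmat_entry)
    qed simp_all
    show "c = c'"
    proof (rule PiE_ext[OF c(1,2)])
      fix m :: nat assume "m \<in> {..<4}"
      hence m: "m < 4" by simp
      hence "d m = \<zero>" using z less_4_cases by blast
      thus "c m = c' m" unfolding d_def using cc[OF m] add_cancel_self by simp
    qed
  qed
  moreover have "K ` ?F \<subseteq> ?F"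
    unfolding K_def using Ve by (auto intro!: finsum_closed m_closed)
  moreover have "finite ?F" by (intro finite_PiE) auto
  ultimately have surj: "K ` ?F = ?F" by (intro endo_inj_surj)
  have "(\<lambda>i\<in>{..<4}. (Y \<otimes>\<^bsub>M\<^esub> E) (i, 0)) \<in> ?F"
    using mat_entry_closed[OF mat_mult_closed[OF Y Ec]] by auto
  hence "(\<lambda>i\<in>{..<4}. (Y \<otimes>\<^bsub>M\<^esub> E) (i, 0)) \<in> K ` ?F" by (simp only: surj)
  then obtain c where c: "c \<in> ?F" "K c = (\<lambda>i\<in>{..<4}. (Y \<otimes>\<^bsub>M\<^esub> E) (i, 0))" by auto
  have cP: "c \<in> {..<4} \<rightarrow> carrier R" using c(1) by auto
  have "Y \<otimes>\<^bsub>M\<^esub> E = lincomb 4 c V"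
  proof (rule mat_monoid_eqI[of _ 4 R])
    show "Y \<otimes>\<^bsub>M\<^esub> E \<in> carrier M" using Y Ec by simp
    show "lincomb 4 c V \<in> carrier M" using cP Vc by (rule lincomb_closed)
    fix i j :: nat assume ij: "i < 4" "j < 4"
    have Vcol: "V m (i, j) = V m (i, 0)" for m
      unfolding V_def using mult_E_entry[of "?X [^]\<^bsub>M\<^esub> m" i] ij Xc by simp
    have "(Y \<otimes>\<^bsub>M\<^esub> E) (i, j) = (Y \<otimes>\<^bsub>M\<^esub> E) (i, 0)"
      using mult_E_entry[OF Y ij(1)] ij by simp
    also have "\<dots> = K c i" unfolding c(2) using ij by simp
    also have "\<dots> = lincomb 4 c V (i, j)"
      unfolding K_def lincomb_def using ij by (simp add: Vcol)
    finally show "(Y \<otimes>\<^bsub>M\<^esub> E) (i, j) = lincomb 4 c V (i, j)" .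
  qed
  thus ?thesis using cP unfolding V_def by blast
qed

text \<open>If the form vanishes, the row \<open>(0, ?p1, b, 0)\<close> is an eigenvector of \<open>X\<close> with eigenvalue
  \<open>\<nu> = a w / b\<close>. From \<open>X ^ (q\<^sup>2 + 1) = 1\<close> and \<open>\<nu> ^ (q\<^sup>2) = \<nu>\<close> one gets \<open>\<nu>\<^sup>2 = 1\<close>, so \<open>\<nu> = 1\<close> and \<open>a w = b\<close>; then
  the vanishing form reduces to \<open>a \<theta>(a) b = 0\<close>, which is impossible.\<close>

lemma degenerate_order:
  assumes \<mu>: "\<mu> \<in> carrier R" "\<mu> \<noteq> \<zero>" and ab: "a \<in> carrier R" "b \<in> carrier R" "a \<noteq> \<zero> \<or> b \<noteq> \<zero>"
    and z: "b \<otimes> b \<oplus> a \<otimes> \<theta> a \<otimes> b \<oplus> a \<otimes> a \<otimes> inv \<mu> \<otimes> inv \<mu> = \<zero>"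
  shows "C a b \<mu> [^]\<^bsub>M\<^esub> (q * q + 1) \<noteq> \<one>\<^bsub>M\<^esub>"
proof
  assume X1: "C a b \<mu> [^]\<^bsub>M\<^esub> (q * q + 1) = \<one>\<^bsub>M\<^esub>"
  interpret M: monoid M by (rule mat_monoid_is_monoid)
  have t: "\<theta> \<mu> \<in> carrier R" "\<theta> \<mu> \<noteq> \<zero>" using \<mu> \<theta>_zero_iff by auto
  note it = nonzero_inv[OF t]
  define w \<alpha> where defs: "w = inv \<mu>" "\<alpha> = \<theta> a"
  have w: "w \<in> carrier R" "w \<noteq> \<zero>" and wm: "w \<otimes> \<mu> = \<one>" and \<alpha>: "\<alpha> \<in> carrier R"
    using nonzero_inv[OF \<mu>] ab unfolding defs by auto
  have z: "b \<otimes> b \<oplus> a \<otimes> \<alpha> \<otimes> b \<oplus> a \<otimes> a \<otimes> w \<otimes> w = \<zero>" using z unfolding defs .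
  have b0: "b \<noteq> \<zero>"
  proof
    assume "b = \<zero>"
    hence "a \<otimes> a \<otimes> w \<otimes> w = \<zero>" using z ab \<alpha> w by simp
    thus False using ab w \<open>b = \<zero>\<close> by (simp add: integral_iff)
  qed
  obtain e where e: "e \<in> carrier R" "e \<otimes> b = \<one>" using inverse_exists ab b0 by blast
  let ?X = "C a b \<mu>"
  have Xc: "?X \<in> carrier M" unfolding cell_def using \<mu> ab t w it unfolding defs by (intro mat4_closed) simp
  define \<nu> where "\<nu> = a \<otimes> w \<otimes> e"
  have \<nu>c: "\<nu> \<in> carrier R" unfolding \<nu>_def using ab w e by simp
  let ?p1 = "\<alpha> \<otimes> b \<oplus> a \<otimes> w \<otimes> w"
  let ?P = "rowmat \<zero> ?p1 b \<zero>"
  let ?S = "scalar_mat 4 R \<nu>"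
  have sum: "a \<otimes> ?p1 = b \<otimes> b"
  proof -
    have "a \<otimes> ?p1 = (b \<otimes> b \<oplus> a \<otimes> \<alpha> \<otimes> b \<oplus> a \<otimes> a \<otimes> w \<otimes> w) \<oplus> b \<otimes> b"
      using ab(1,2) \<alpha> w(1) by - (rule ring_eqI1[OF char_two], (rule reify | simp)+)
    thus ?thesis unfolding z using ab by simp
  qed
  have Pc: "?P \<in> carrier M" using ab w \<alpha> by (intro colmat_closed) auto
  have Sc: "?S \<in> carrier M" using \<nu>c by (rule scalar_mat_closed)
  have PX: "?P \<otimes>\<^bsub>M\<^esub> ?X = ?S \<otimes>\<^bsub>M\<^esub> ?P"
  proof -
    have "?P \<otimes>\<^bsub>M\<^esub> ?X = rowmat \<zero> (b \<otimes> w) (?p1 \<otimes> \<mu> \<oplus> b \<otimes> (\<alpha> \<otimes> \<mu>))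
      (\<zero> \<otimes> (\<mu> \<otimes> \<theta> \<mu>) \<oplus> ?p1 \<otimes> (a \<otimes> (\<mu> \<otimes> \<theta> \<mu>)) \<oplus> b \<otimes> (b \<otimes> (\<mu> \<otimes> \<theta> \<mu>)))"
      using rowmat_cell[of \<mu> "\<theta> \<mu>" "inv \<mu>" "inv (\<theta> \<mu>)" a "\<theta> a" b "\<theta> b" \<zero> ?p1 b]
        \<mu> ab t w \<alpha> it unfolding defs by simp
    also have "?p1 \<otimes> \<mu> \<oplus> b \<otimes> (\<alpha> \<otimes> \<mu>) = a \<otimes> w"
      using \<mu>(1) ab(1,2) w(1) \<alpha> by - (rule ring_eqI2[OF char_two wm], (rule reify | simp)+)
    also have "\<zero> \<otimes> (\<mu> \<otimes> \<theta> \<mu>) \<oplus> ?p1 \<otimes> (a \<otimes> (\<mu> \<otimes> \<theta> \<mu>)) \<oplus> b \<otimes> (b \<otimes> (\<mu> \<otimes> \<theta> \<mu>)) = \<zero>"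
    proof -
      have m: "\<mu> \<otimes> \<theta> \<mu> \<in> carrier R" (is "?m \<in> _") using \<mu> by simp
      have "?p1 \<otimes> (a \<otimes> ?m) = (a \<otimes> ?p1) \<otimes> ?m" using ab w \<alpha> m by (simp add: m_ac)
      also have "\<dots> = b \<otimes> (b \<otimes> ?m)" unfolding sum using ab m by (simp add: m_assoc)
      finally show ?thesis using ab m double_zero by simp
    qed
    also have "rowmat \<zero> (b \<otimes> w) (a \<otimes> w) \<zero> = rowmat (\<nu> \<otimes> \<zero>) (\<nu> \<otimes> ?p1) (\<nu> \<otimes> b) (\<nu> \<otimes> \<zero>)"
    proof -
      have "\<nu> \<otimes> ?p1 = (a \<otimes> ?p1) \<otimes> (w \<otimes> e)" unfolding \<nu>_def using ab w \<alpha> e by (simp add: m_ac)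
      also have "\<dots> = b \<otimes> w" unfolding sum using ab(1,2) w(1) e(1) by - (rule ring_eqI1[OF e(2)], (rule reify | simp)+)
      finally have "\<nu> \<otimes> ?p1 = b \<otimes> w" .
      moreover have "\<nu> \<otimes> b = a \<otimes> w" unfolding \<nu>_def using ab(1,2) w(1) e(1) by - (rule ring_eqI1[OF e(2)], (rule reify | simp)+)
      ultimately show ?thesis using \<nu>c by simp
    qed
    also have "\<dots> = ?S \<otimes>\<^bsub>M\<^esub> ?P" using \<nu>c ab w \<alpha> by (subst scalar_rowmat) auto
    finally show ?thesis .
  qed
  have pow: "?P \<otimes>\<^bsub>M\<^esub> ?X [^]\<^bsub>M\<^esub> m = scalar_mat 4 R (\<nu> [^] m) \<otimes>\<^bsub>M\<^esub> ?P" for m :: nat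
  proof (induction m)
    case 0
    show ?case using Pc by (simp flip: mat_monoid_simps(2))
  next
    case (Suc m)
    have c: "scalar_mat 4 R (\<nu> [^] m) \<in> carrier M" using \<nu>c by (intro scalar_mat_closed) simp
    have "?P \<otimes>\<^bsub>M\<^esub> ?X [^]\<^bsub>M\<^esub> Suc m = (?P \<otimes>\<^bsub>M\<^esub> ?X [^]\<^bsub>M\<^esub> m) \<otimes>\<^bsub>M\<^esub> ?X"
      using Pc Xc by (simp add: M.m_assoc)
    also have "\<dots> = scalar_mat 4 R (\<nu> [^] m) \<otimes>\<^bsub>M\<^esub> (?P \<otimes>\<^bsub>M\<^esub> ?X)"
      unfolding Suc.IH using c Pc Xc by (simp add: M.m_assoc)
    also have "\<dots> = (scalar_mat 4 R (\<nu> [^] m) \<otimes>\<^bsub>M\<^esub> ?S) \<otimes>\<^bsub>M\<^esub> ?P"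
      unfolding PX using c Sc Pc by (simp add: M.m_assoc)
    also have "\<dots> = scalar_mat 4 R (\<nu> [^] Suc m) \<otimes>\<^bsub>M\<^esub> ?P"
      using \<nu>c by (simp add: scalar_scalar)
    finally show ?case .
  qed
  have "?P = scalar_mat 4 R (\<nu> [^] (q * q + 1)) \<otimes>\<^bsub>M\<^esub> ?P"
    using pow[of "q * q + 1"] Pc unfolding X1 by simp
  also have "\<dots> = rowmat (\<nu> [^] (q * q + 1) \<otimes> \<zero>) (\<nu> [^] (q * q + 1) \<otimes> ?p1) (\<nu> [^] (q * q + 1) \<otimes> b) (\<nu> [^] (q * q + 1) \<otimes> \<zero>)"
    using \<nu>c ab w \<alpha> by (subst scalar_rowmat) auto
  finally have "?P (0, 2) = rowmat (\<nu> [^] (q * q + 1) \<otimes> \<zero>) (\<nu> [^] (q * q + 1) \<otimes> ?p1) (\<nu> [^] (q * q + 1) \<otimes> b) (\<nu> [^] (q * q + 1) \<otimes> \<zero>) (0, 2)"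
    by simp
  hence "b = \<nu> [^] (q * q + 1) \<otimes> b" unfolding rowmat_def by simp
  hence "\<nu> [^] (q * q + 1) = \<one>"
    using ab b0 \<nu>c by (metis l_one m_rcancel nat_pow_closed one_closed)
  moreover have "\<nu> [^] (q * q) = \<nu>"
    using \<nu>c nat_pow_pow[of \<nu> q q] pow_order by simp
  ultimately have "\<nu> \<otimes> \<nu> = \<one> \<otimes> \<one>" using \<nu>c by simp
  hence \<nu>1: "\<nu> = \<one>" using sq_inj \<nu>c by blast
  have awb: "a \<otimes> w = b"
  proof -
    have "a \<otimes> w = \<nu> \<otimes> b" unfolding \<nu>_def using ab(1,2) w(1) e(1) by - (rule ring_eqI1[OF e(2)], (rule reify | simp)+)
    thus ?thesis using \<nu>1 ab by simp
  qed
  have "a \<otimes> a \<otimes> w \<otimes> w = (a \<otimes> w) \<otimes> (a \<otimes> w)" using ab w by (simp add: m_ac)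
  hence "b \<otimes> b \<oplus> a \<otimes> \<alpha> \<otimes> b \<oplus> b \<otimes> b = \<zero>" using z awb by simp
  moreover have "b \<otimes> b \<oplus> a \<otimes> \<alpha> \<otimes> b \<oplus> b \<otimes> b = a \<otimes> \<alpha> \<otimes> b"
    using ab(1,2) \<alpha> by - (rule ring_eqI1[OF char_two], (rule reify | simp)+)
  ultimately have "a \<otimes> \<alpha> \<otimes> b = \<zero>" by simp
  hence "a = \<zero>" using ab \<alpha> b0 \<theta>_zero_iff unfolding defs by (auto simp: integral_iff)
  thus False using awb b0 w by simp
qed

interpretation G: split_bn_group S QS KS flip by (rule split_bn)

lemma C_in_Sz:
  assumes "\<mu> \<in> carrier R" "\<mu> \<noteq> \<zero>" "a \<in> carrier R" "b \<in> carrier R"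
  shows "C a b \<mu> \<in> carrier S" "C a b \<mu> = U a b \<otimes>\<^bsub>S\<^esub> D \<mu> \<otimes>\<^bsub>S\<^esub> flip"
proof -
  note [simp del] = Sz_simps(1)
  show "C a b \<mu> = U a b \<otimes>\<^bsub>S\<^esub> D \<mu> \<otimes>\<^bsub>S\<^esub> flip" using C_eq[OF assms] by simp
  thus "C a b \<mu> \<in> carrier S" using generators_in_Sz assms by (metis S.m_closed)
qed

lemma U_E: "a \<in> carrier R \<Longrightarrow> b \<in> carrier R \<Longrightarrow> U a b \<otimes>\<^bsub>M\<^esub> E = E"
  unfolding U_def unip_def colmat_def
  by (subst mat4_mult) simp_all

text \<open>Outside \<open>B\<close> the first coordinate of the image of the last basis vector is the nonzero corner entry
  \<open>\<mu> \<theta>(\<mu>)\<close> of a cell matrix.\<close>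

lemma fixes_E_in_B:
  assumes h: "h \<in> carrier S" "h \<otimes>\<^bsub>M\<^esub> E = E"
  shows "h \<in> G.B"
proof (rule ccontr)
  interpret M: monoid M by (rule mat_monoid_is_monoid)
  assume "h \<notin> G.B"
  then obtain b0 v where v: "b0 \<in> G.B" "v \<in> QS" "h = b0 \<otimes>\<^bsub>S\<^esub> flip \<otimes>\<^bsub>S\<^esub> v"
    by (rule G.not_in_B_cases[OF h(1)])
  then obtain u k where uk: "u \<in> QS" "k \<in> KS" "b0 = u \<otimes>\<^bsub>S\<^esub> k" unfolding G.B_def by blast
  obtain a b where u: "u = U a b" "a \<in> carrier R" "b \<in> carrier R" using uk unfolding QS_def by blast
  obtain \<mu> where k: "k = D \<mu>" "\<mu> \<in> carrier R" "\<mu> \<noteq> \<zero>" using uk unfolding KS_def by blast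
  obtain c d where w: "v = U c d" "c \<in> carrier R" "d \<in> carrier R" using v unfolding QS_def by blast
  have C: "C a b \<mu> \<in> carrier M" by (rule subsetD[OF Sz_subset_M C_in_Sz(1)[OF k(2,3) u(2,3)]])
  have Ec: "E \<in> carrier M" by (intro colmat_closed) simp_all
  have "h = C a b \<mu> \<otimes>\<^bsub>M\<^esub> U c d" using v(3) uk(3) C_in_Sz(2)[OF k(2,3) u(2,3)] u(1) k(1) w(1)
    unfolding Sz_simps(2) by simp
  hence "E = C a b \<mu> \<otimes>\<^bsub>M\<^esub> E"
    using h(2) C w Ec U_closed U_E by (simp add: M.m_assoc)
  hence "E (0, 0) = (C a b \<mu> \<otimes>\<^bsub>M\<^esub> E) (0, 0)" by (rule arg_cong)
  also have "\<dots> = \<mu> \<otimes> \<theta> \<mu>" using mult_E_entry[OF C, of 0 0] cell_corner by simp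
  finally have "\<mu> \<otimes> \<theta> \<mu> = \<zero>" by (simp add: colmat_entry)
  thus False using k by (simp add: integral_iff \<theta>_zero_iff)
qed

text \<open>An element outside \<open>B\<close> is conjugate, under the unipotent factor on its right, to a cell matrix
  \<open>X\<close>. Then \<open>y z\<close> and \<open>z y\<close> agree on the cyclic vector, so \<open>(z y)\<inverse> y z\<close> lies in \<open>B\<close> and centralizes
  \<open>X\<close>; since nontrivial elements of this centralizer have no fixed points, it is the identity.\<close>

lemma fpf_abelian:
  assumes x: "G.fpf x" and y: "y \<in> S.centralizer_of x" and z: "z \<in> S.centralizer_of x"
  shows "y \<otimes>\<^bsub>S\<^esub> z = z \<otimes>\<^bsub>S\<^esub> y"
proof -
  note [simp del] = Sz_simps(1)
  interpret M: monoid M by (rule mat_monoid_is_monoid)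
  have xS: "x \<in> carrier S" using x unfolding G.fpf_def by simp
  have "x \<notin> G.B"
  proof
    assume "x \<in> G.B"
    hence "x \<in> S.conjugate \<one>\<^bsub>S\<^esub> ` G.B" using xS S.conjugate_by_one by (metis imageI)
    thus False using x unfolding G.fpf_def by (metis S.one_closed)
  qed
  then obtain b0 v where v: "b0 \<in> G.B" "v \<in> QS" "x = b0 \<otimes>\<^bsub>S\<^esub> flip \<otimes>\<^bsub>S\<^esub> v"
    by (rule G.not_in_B_cases[OF xS])
  then obtain u k where uk: "u \<in> QS" "k \<in> KS" "b0 = u \<otimes>\<^bsub>S\<^esub> k" unfolding G.B_def by blast
  have vS: "v \<in> carrier S" using v G.Q_closed by blast
  have vu: "v \<otimes>\<^bsub>S\<^esub> u \<in> QS" using v uk G.Q_ops(3) by blast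
  then obtain a b where ab: "v \<otimes>\<^bsub>S\<^esub> u = U a b" "a \<in> carrier R" "b \<in> carrier R" unfolding QS_def by blast
  obtain \<mu> where k: "k = D \<mu>" "\<mu> \<in> carrier R" "\<mu> \<noteq> \<zero>" using uk unfolding KS_def by blast
  let ?X = "C a b \<mu>"
  have XS: "?X \<in> carrier S" by (rule C_in_Sz(1)[OF k(2,3) ab(2,3)])
  have uS: "u \<in> carrier S" and kS: "k \<in> carrier S" using uk G.Q_closed G.K_closed by auto
  have X: "S.conjugate v x = ?X"
  proof -
    have "S.conjugate v x = (v \<otimes>\<^bsub>S\<^esub> u) \<otimes>\<^bsub>S\<^esub> k \<otimes>\<^bsub>S\<^esub> flip"
      unfolding v(3) uk(3) using vS uS kS G.t_closed
      by (simp add: S.word_simps del: Sz_simps)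
    thus ?thesis using ab k C_in_Sz(2)[of \<mu> a b] by simp
  qed
  have N: "?X [^]\<^bsub>M\<^esub> (q * q + 1) = \<one>\<^bsub>M\<^esub>"
  proof -
    have "S.conjugate v x [^]\<^bsub>S\<^esub> (card QS + 1) = \<one>\<^bsub>S\<^esub>"
      using S.conjugate_pow[OF vS xS, of "card QS + 1"] G.fpf_pow_card_Q[OF x] vS
      by (simp del: Sz_simps)
    hence "?X [^]\<^bsub>S\<^esub> (q * q + 1) = \<one>\<^bsub>S\<^esub>" unfolding X card_QS .
    thus ?thesis using monoid_pow_cong[of S M ?X "q * q + 1"] by simp
  qed
  have free: "W = \<one>\<^bsub>S\<^esub>" if W: "W \<in> G.B" "?X \<otimes>\<^bsub>S\<^esub> W = W \<otimes>\<^bsub>S\<^esub> ?X" for W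
  proof (rule ccontr)
    assume W1: "W \<noteq> \<one>\<^bsub>S\<^esub>"
    have WS: "W \<in> carrier S" using W G.B_closed by blast
    let ?w = "S.conjugate (inv\<^bsub>S\<^esub> v) W"
    have "S.conjugate (inv\<^bsub>S\<^esub> v) ?X \<otimes>\<^bsub>S\<^esub> ?w = ?w \<otimes>\<^bsub>S\<^esub> S.conjugate (inv\<^bsub>S\<^esub> v) ?X"
      using W vS XS WS by (intro S.commute_conjugate) auto
    moreover have "S.conjugate (inv\<^bsub>S\<^esub> v) ?X = x"
      unfolding X[symmetric] using vS xS by (rule S.conjugate_inv_cancel(2))
    ultimately have "?w \<in> S.centralizer_of x"
      unfolding S.centralizer_of_def using vS WS by (simp del: Sz_simps)
    moreover have "?w \<noteq> \<one>\<^bsub>S\<^esub>"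
      using W1 S.conjugate_inj[of "inv\<^bsub>S\<^esub> v" W "\<one>\<^bsub>S\<^esub>"] vS WS by (simp del: Sz_simps)
    ultimately have "G.fpf ?w" using G.commute_fpf[OF x] by blast
    moreover have "inv\<^bsub>S\<^esub> v \<in> carrier S" using vS by (rule S.inv_closed)
    ultimately show False using W unfolding G.fpf_def by blast
  qed
  \<comment> \<open>Otherwise \<open>X\<close> is an involution, whose power to the odd exponent \<open>q\<^sup>2 + 1\<close> is not the identity.\<close>
  have abnz: "a \<noteq> \<zero> \<or> b \<noteq> \<zero>"
  proof (rule ccontr)
    assume "\<not> (a \<noteq> \<zero> \<or> b \<noteq> \<zero>)"
    hence "?X = D \<mu> \<otimes>\<^bsub>M\<^esub> flip"
      using C_eq[of \<mu> a b] k D_closed by (simp flip: one_M(1))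
    hence "?X \<otimes>\<^bsub>M\<^esub> ?X = D \<mu> \<otimes>\<^bsub>M\<^esub> (flip \<otimes>\<^bsub>M\<^esub> D \<mu> \<otimes>\<^bsub>M\<^esub> flip)"
      using k D_closed flip_closed by (simp add: M.m_assoc)
    hence XX: "?X \<otimes>\<^bsub>M\<^esub> ?X = \<one>\<^bsub>M\<^esub>"
      using flip_D_flip D_inverse k by simp
    have XM: "?X \<in> carrier M" by (rule subsetD[OF Sz_subset_M XS])
    have "even (q * q)" unfolding order_eq by simp
    then obtain m where m: "q * q = 2 * m" by (rule evenE)
    have "?X [^]\<^bsub>M\<^esub> (q * q) = (?X [^]\<^bsub>M\<^esub> (2::nat)) [^]\<^bsub>M\<^esub> m"
      unfolding m using XM by (rule M.nat_pow_pow[symmetric])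
    also have "\<dots> = \<one>\<^bsub>M\<^esub>" unfolding M.pow_two[OF XM] XX by simp
    finally have "?X = \<one>\<^bsub>M\<^esub>" using N XM by simp
    hence "\<mu> \<otimes> \<theta> \<mu> = \<one>\<^bsub>M\<^esub> (0, 3)" using cell_corner[of a b \<mu>] by simp
    hence "\<mu> \<otimes> \<theta> \<mu> = \<zero>" unfolding mat_monoid_simps scalar_mat_4 by simp
    thus False using k by (simp add: integral_iff \<theta>_zero_iff)
  qed
  have nz: "b \<otimes> b \<oplus> a \<otimes> \<theta> a \<otimes> b \<oplus> a \<otimes> a \<otimes> inv \<mu> \<otimes> inv \<mu> \<noteq> \<zero>"
    using degenerate_order[OF k(2,3) ab(2,3) abnz] N by blast
  have XM: "?X \<in> carrier M" by (rule subsetD[OF Sz_subset_M XS])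
  have Ec: "E \<in> carrier M" by (intro colmat_closed) simp_all
  have comm: "Y \<otimes>\<^bsub>S\<^esub> Z = Z \<otimes>\<^bsub>S\<^esub> Y"
    if Y: "Y \<in> carrier S" "?X \<otimes>\<^bsub>S\<^esub> Y = Y \<otimes>\<^bsub>S\<^esub> ?X" and Z: "Z \<in> carrier S" "?X \<otimes>\<^bsub>S\<^esub> Z = Z \<otimes>\<^bsub>S\<^esub> ?X" for Y Z
  proof -
    have YM: "Y \<in> carrier M" and ZM: "Z \<in> carrier M" using Y Z Sz_subset_M by auto
    obtain c where c: "c \<in> {..<4} \<rightarrow> carrier R" "Y \<otimes>\<^bsub>M\<^esub> E = lincomb 4 c (\<lambda>m. ?X [^]\<^bsub>M\<^esub> m \<otimes>\<^bsub>M\<^esub> E)"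
      using krylov_spans[OF k(2,3) ab(2,3) abnz nz YM] by blast
    obtain d where d: "d \<in> {..<4} \<rightarrow> carrier R" "Z \<otimes>\<^bsub>M\<^esub> E = lincomb 4 d (\<lambda>m. ?X [^]\<^bsub>M\<^esub> m \<otimes>\<^bsub>M\<^esub> E)"
      using krylov_spans[OF k(2,3) ab(2,3) abnz nz ZM] by blast
    have YZ: "Y \<otimes>\<^bsub>M\<^esub> Z \<otimes>\<^bsub>M\<^esub> E = Z \<otimes>\<^bsub>M\<^esub> Y \<otimes>\<^bsub>M\<^esub> E"
      using cyclic_commute[OF XM YM ZM Ec _ _ c(1) d(1) c(2) d(2)] Y(2) Z(2) by simp
    let ?i = "inv\<^bsub>S\<^esub> (Z \<otimes>\<^bsub>S\<^esub> Y)"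
    let ?h = "?i \<otimes>\<^bsub>S\<^esub> (Y \<otimes>\<^bsub>S\<^esub> Z)"
    have ZY: "Z \<otimes>\<^bsub>S\<^esub> Y \<in> carrier S" "Y \<otimes>\<^bsub>S\<^esub> Z \<in> carrier S" using Y(1) Z(1) by (simp_all del: Sz_simps)
    have iS: "?i \<in> carrier S" using ZY(1) by (rule S.inv_closed)
    have iM: "?i \<in> carrier M" using iS Sz_subset_M by blast
    have hS: "?h \<in> carrier S" using iS ZY by (simp del: Sz_simps)
    have iZY: "?i \<otimes>\<^bsub>M\<^esub> (Z \<otimes>\<^bsub>M\<^esub> Y) = \<one>\<^bsub>M\<^esub>"
      using S.l_inv[OF ZY(1)] by simp
    have "?h \<otimes>\<^bsub>M\<^esub> E = ?i \<otimes>\<^bsub>M\<^esub> (Y \<otimes>\<^bsub>M\<^esub> Z \<otimes>\<^bsub>M\<^esub> E)"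
      using iM YM ZM Ec by (simp add: M.m_assoc)
    also have "\<dots> = (?i \<otimes>\<^bsub>M\<^esub> (Z \<otimes>\<^bsub>M\<^esub> Y)) \<otimes>\<^bsub>M\<^esub> E"
      unfolding YZ using iM YM ZM Ec by (simp add: M.m_assoc)
    also have "\<dots> = E" unfolding iZY using Ec by simp
    finally have "?h \<in> G.B" using fixes_E_in_B hS by blast
    moreover have "?X \<otimes>\<^bsub>S\<^esub> ?h = ?h \<otimes>\<^bsub>S\<^esub> ?X"
    proof -
      have sub: "subgroup (S.centralizer_of ?X) S" using XS by (rule S.subgroup_centralizer_of)
      have "Y \<in> S.centralizer_of ?X" "Z \<in> S.centralizer_of ?X"
        unfolding S.centralizer_of_def using Y Z by auto
      hence "?h \<in> S.centralizer_of ?X"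
        using sub by (metis subgroup.m_closed subgroup.m_inv_closed)
      thus ?thesis unfolding S.centralizer_of_def by blast
    qed
    ultimately have "?h = \<one>\<^bsub>S\<^esub>" by (rule free)
    hence "(Z \<otimes>\<^bsub>S\<^esub> Y) \<otimes>\<^bsub>S\<^esub> ?h = Z \<otimes>\<^bsub>S\<^esub> Y" using ZY by (simp del: Sz_simps)
    moreover have "(Z \<otimes>\<^bsub>S\<^esub> Y) \<otimes>\<^bsub>S\<^esub> ?h = Y \<otimes>\<^bsub>S\<^esub> Z" using ZY by (rule S.inv_cancel_left(2))
    ultimately show ?thesis by simp
  qed
  have yz: "y \<in> carrier S" "x \<otimes>\<^bsub>S\<^esub> y = y \<otimes>\<^bsub>S\<^esub> x" "z \<in> carrier S" "x \<otimes>\<^bsub>S\<^esub> z = z \<otimes>\<^bsub>S\<^esub> x"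
    using y z unfolding S.centralizer_of_def by auto
  have "S.conjugate v y \<otimes>\<^bsub>S\<^esub> S.conjugate v z = S.conjugate v z \<otimes>\<^bsub>S\<^esub> S.conjugate v y"
  proof (rule comm)
    show "?X \<otimes>\<^bsub>S\<^esub> S.conjugate v y = S.conjugate v y \<otimes>\<^bsub>S\<^esub> ?X"
      unfolding X[symmetric] using vS xS yz by (intro S.commute_conjugate)
    show "?X \<otimes>\<^bsub>S\<^esub> S.conjugate v z = S.conjugate v z \<otimes>\<^bsub>S\<^esub> ?X"
      unfolding X[symmetric] using vS xS yz by (intro S.commute_conjugate)
  qed (use vS yz S.conjugate_closed in blast)+
  hence "S.conjugate v (y \<otimes>\<^bsub>S\<^esub> z) = S.conjugate v (z \<otimes>\<^bsub>S\<^esub> y)"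
    using S.conjugate_mult vS yz by metis
  thus ?thesis using S.conjugate_inj[OF vS] yz S.m_closed by blast
qed

lemma partition_Sz: "has_nontrivial_partition S"
  using G.nontrivial_partition fpf_abelian by blast

lemma order_Sz: "order S = q * q * (q - 1) * (q * q + 1)"
  using G.order_eq card_QS card_KS by simp

text \<open>The conjugates of \<open>Q\<close> consist of solutions of \<open>x ^ 4 = 1\<close>: squares of elements of \<open>Q\<close> have first
  parameter zero, and those are involutions.\<close>

lemma breadth_Sz: "(real q)\<^sup>2 ^ 2 / 2\<^sup>2 \<le> global_breadth S"
proof -
  have sub: "{x \<in> carrier S. G.conj_to_Q x} \<subseteq> root_set 4 S"
  proof
    fix x assume x: "x \<in> {x \<in> carrier S. G.conj_to_Q x}"
    then obtain g u where g: "g \<in> carrier S" "u \<in> QS" "x = S.conjugate g u"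
      unfolding G.conj_to_Q_def by blast
    obtain a b where u: "u = U a b" "a \<in> carrier R" "b \<in> carrier R" using g unfolding QS_def by blast
    have uS: "u \<in> carrier S" using g G.Q_closed by blast
    have 2: "u [^]\<^bsub>S\<^esub> (2::nat) = U \<zero> (\<theta> a \<otimes> a)"
      unfolding S.pow_two[OF uS] unfolding u(1) using u U_mult[of a b a b] double_zero by simp
    have "u [^]\<^bsub>S\<^esub> (4::nat) = (u [^]\<^bsub>S\<^esub> (2::nat)) [^]\<^bsub>S\<^esub> (2::nat)"
      using S.nat_pow_pow[OF uS, of 2 2] by simp
    also have "\<dots> = U \<zero> (\<theta> a \<otimes> a) \<otimes>\<^bsub>S\<^esub> U \<zero> (\<theta> a \<otimes> a)"
      unfolding 2 using u generators_in_Sz(1)[of \<zero> "\<theta> a \<otimes> a"] by (intro S.pow_two) simp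
    also have "\<dots> = \<one>\<^bsub>S\<^esub>"
      using u U_mult[of \<zero> "\<theta> a \<otimes> a" \<zero> "\<theta> a \<otimes> a"] double_zero one_M(1) by simp
    finally have "u [^]\<^bsub>S\<^esub> (4::nat) = \<one>\<^bsub>S\<^esub>" .
    hence "x [^]\<^bsub>S\<^esub> (4::nat) = \<one>\<^bsub>S\<^esub>"
      using S.conjugate_pow[OF g(1) uS, of 4] g(1,3) S.conjugate_one by metis
    thus "x \<in> root_set 4 S" using x unfolding root_set_def by blast
  qed
  have "4 dvd order S"
  proof -
    have "2 dvd q" unfolding order_eq by simp
    hence "2 * 2 dvd q * q" by (rule mult_dvd_mono) (simp add: order_eq)
    thus ?thesis unfolding order_Sz by (simp add: dvd_mult2)
  qed
  hence "real ((card QS)\<^sup>2) / real 4 \<le> global_breadth S"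
    by (rule global_breadth_ge_card[OF group_Sz finite_Sz _ sub G.card_conj_to_Q])
  thus ?thesis unfolding card_QS by (simp add: Power.monoid_mult_class.power2_eq_square)
qed

text \<open>The order is below \<open>(q\<^sup>2) ^ 3\<close> and the breadth at least \<open>(q\<^sup>2)\<^sup>2 / 2\<^sup>2\<close>, which gives the constant \<open>2 ^ 3\<close>.\<close>

theorem Sz_large_breadth:
  shows "real (order S) \<le> 8 * global_breadth S * sqrt (global_breadth S)" and "in_class_H S"
proof -
  have q8: "q \<ge> 8"
  proof -
    have "(2::nat) ^ 3 \<le> 2 ^ (2 * n + 1)" using n_pos by (intro power_increasing) auto
    thus ?thesis unfolding order_eq by simp
  qed
  have ord: "real (order S) \<le> real q ^ 5"
  proof -
    have "(q - 1) * (q * q + 1) \<le> q * q * q"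
    proof -
      obtain m where "q = Suc m" using q8 by (cases q) auto
      thus ?thesis by (simp add: algebra_simps)
    qed
    hence "q * q * ((q - 1) * (q * q + 1)) \<le> q * q * (q * q * q)" by (rule mult_left_mono) simp
    moreover have "order S = q * q * ((q - 1) * (q * q + 1))"
      unfolding order_Sz by (simp only: mult.assoc)
    moreover have "q * q * (q * q * q) = q ^ 5" by (simp add: eval_nat_numeral)
    ultimately have "order S \<le> q ^ 5" by simp
    thus ?thesis by (metis of_nat_le_iff of_nat_power)
  qed
  have "real q ^ 5 \<le> real q ^ 6" using q8 by (intro power_increasing) auto
  hence "real (order S) \<le> real q ^ 6" using ord by linarith
  also have "real q ^ 6 = ((real q)\<^sup>2) ^ 3" by (simp add: power_mult[symmetric])
  finally have "real (order S) \<le> ((real q)\<^sup>2) ^ 3" .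
  hence "real (order S) \<le> 2 ^ 3 * global_breadth S * sqrt (global_breadth S)"
    by (intro order_le_power_three_halves[OF _ _ breadth_Sz]) auto
  thus "real (order S) \<le> 8 * global_breadth S * sqrt (global_breadth S)" by simp
  let ?b = "(real q)\<^sup>2 ^ 2 / 2\<^sup>2"
  have "16 \<le> real q ^ 3"
  proof -
    have "(8::real) ^ 3 \<le> real q ^ 3" using q8 by (intro power_mono) auto
    thus ?thesis by simp
  qed
  hence "16 * real q ^ 5 \<le> real q ^ 3 * real q ^ 5" by (intro mult_right_mono) auto
  moreover have "?b * ?b = real q ^ 3 * real q ^ 5 / 16"
    by (simp add: power_mult[symmetric] power_add[symmetric])
  ultimately have "real q ^ 5 \<le> ?b * ?b" by linarith
  also have "\<dots> \<le> ?b * (?b + 1)" by (intro mult_left_mono) simp_all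
  finally have "real (order S) \<le> ?b * (?b + 1)" using ord by linarith
  thus "in_class_H S"
    by (rule in_class_HI[OF group_Sz finite_Sz _ breadth_Sz, rotated]) simp
qed

end

section \<open>The symmetric group of degree four\<close>

text \<open>A permutation is represented by the list of its values, so that statements about all of \<open>S\<^sub>4\<close> become
  evaluable statements about lists.\<close>

definition perm_of :: "nat list \<Rightarrow> nat \<Rightarrow> nat" where
  "perm_of l i = (if i \<in> {1..4} then l ! (i - 1) else i)"

definition comp_list :: "nat list \<Rightarrow> nat list \<Rightarrow> nat list" where
  "comp_list l m = map (\<lambda>x. l ! (x - 1)) m"

definition perm_lists :: "nat list list" where
  "perm_lists = filter distinct (List.n_lists 4 [1, 2, 3, 4])"

text \<open>The powers of a permutation of order at most four; for smaller orders some of them are repeated.\<close>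

definition cyclic_list :: "nat list \<Rightarrow> nat list list" where
  "cyclic_list l = [[1, 2, 3, 4], l, comp_list l l, comp_list l (comp_list l l)]"

text \<open>Three subgroups generated by 4-cycles, which contain the products of two disjoint transpositions, four
  generated by 3-cycles, and six generated by transpositions.\<close>

definition max_cyclic_lists :: "nat list list list" where
  "max_cyclic_lists = map cyclic_list
    [[2, 3, 4, 1], [3, 4, 2, 1], [2, 4, 1, 3],
     [2, 3, 1, 4], [2, 4, 3, 1], [3, 2, 4, 1], [1, 3, 4, 2],
     [2, 1, 3, 4], [3, 2, 1, 4], [4, 2, 3, 1], [1, 3, 2, 4], [1, 4, 3, 2], [1, 2, 4, 3]]"

lemma in_perm_lists:
  "l \<in> set perm_lists \<longleftrightarrow> length l = 4 \<and> set l \<subseteq> {1..4} \<and> distinct l"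
proof -
  have "{1, 2, 3, 4::nat} = {1..4}" by auto
  thus ?thesis unfolding perm_lists_def by (auto simp: set_n_lists)
qed

lemma perm_of_permutes:
  assumes "l \<in> set perm_lists"
  shows "perm_of l permutes {1..4}"
proof -
  have l: "length l = 4" "set l \<subseteq> {1..4}" "distinct l" using assms in_perm_lists by auto
  have "inj_on (perm_of l) {1..4}"
    unfolding perm_of_def inj_on_def using l by (auto simp: nth_eq_iff_index_eq)
  moreover have sub: "perm_of l ` {1..4} \<subseteq> {1..4}"
  proof
    fix y assume "y \<in> perm_of l ` {1..4}"
    then obtain i where "i \<in> {1..4}" "y = l ! (i - 1)" unfolding perm_of_def by auto
    moreover have "i - 1 < length l" using l \<open>i \<in> {1..4}\<close> by auto
    ultimately show "y \<in> {1..4}" using l(2) nth_mem by blast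
  qed
  ultimately have "bij_betw (perm_of l) {1..4} {1..4}"
    unfolding bij_betw_def using endo_inj_surj[OF _ sub] by simp
  thus ?thesis by (rule bij_imp_permutes) (auto simp: perm_of_def)
qed

lemma carrier_sym_group_4: "carrier (sym_group 4) = perm_of ` set perm_lists"
proof
  show "perm_of ` set perm_lists \<subseteq> carrier (sym_group 4)"
    using perm_of_permutes by (auto simp: sym_group_carrier)
  show "carrier (sym_group 4) \<subseteq> perm_of ` set perm_lists"
  proof
    fix p assume "p \<in> carrier (sym_group 4)"
    hence p: "p permutes {1..4}" by (simp add: sym_group_carrier)
    let ?l = "map p [1, 2, 3, 4]"
    have "distinct ?l" using permutes_inj[OF p] by (simp add: inj_eq)
    moreover have "set ?l \<subseteq> {1..4}" using permutes_in_image[OF p] by auto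
    ultimately have "?l \<in> set perm_lists" unfolding in_perm_lists by simp
    moreover have "p = perm_of ?l"
    proof
      fix i show "p i = perm_of ?l i"
      proof (cases "i \<in> {1..4}")
        case True
        hence "i = 1 \<or> i = 2 \<or> i = 3 \<or> i = 4" by auto
        thus ?thesis unfolding perm_of_def by auto
      next
        case False
        thus ?thesis unfolding perm_of_def using permutes_not_in[OF p False] by (simp only: if_False)
      qed
    qed
    ultimately show "p \<in> perm_of ` set perm_lists" by blast
  qed
qed

lemma perm_of_inj:
  assumes "l \<in> set perm_lists" "m \<in> set perm_lists" "perm_of l = perm_of m"
  shows "l = m"
proof (rule nth_equalityI)
  show "length l = length m" using assms in_perm_lists by simp
  fix i assume "i < length l"
  hence "i < 4" using assms in_perm_lists by simp
  thus "l ! i = m ! i" using fun_cong[OF assms(3), of "i + 1"] unfolding perm_of_def by simp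
qed

lemma perm_of_comp:
  assumes "l \<in> set perm_lists" "m \<in> set perm_lists"
  shows "perm_of l \<circ> perm_of m = perm_of (comp_list l m)"
proof
  fix i
  have m: "length m = 4" "set m \<subseteq> {1..4}" using assms in_perm_lists by auto
  show "(perm_of l \<circ> perm_of m) i = perm_of (comp_list l m) i"
  proof (cases "i \<in> {1..4}")
    case True
    hence "i - 1 < length m" using m by auto
    moreover hence "m ! (i - 1) \<in> {1..4}" using m nth_mem by blast
    ultimately show ?thesis using True unfolding perm_of_def comp_list_def by simp
  qed (auto simp: perm_of_def)
qed

lemma perm_of_id: "perm_of [1, 2, 3, 4] = id"
proof
  fix i :: nat
  show "perm_of [1, 2, 3, 4] i = id i"
  proof (cases "i \<in> {1..4}")
    case True
    hence "i = 1 \<or> i = 2 \<or> i = 3 \<or> i = 4" by auto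
    thus ?thesis unfolding perm_of_def by auto
  qed (auto simp: perm_of_def)
qed

lemma max_cyclic_lists_check:
  "\<forall>H\<in>set max_cyclic_lists. \<forall>x\<in>set H. x \<in> set perm_lists \<and>
    (\<forall>y\<in>set H. comp_list x y \<in> set H) \<and> (\<exists>y\<in>set H. comp_list y x = [1, 2, 3, 4])"
  "\<forall>l\<in>set perm_lists. l \<noteq> [1, 2, 3, 4] \<longrightarrow> length (filter (\<lambda>H. l \<in> set H) max_cyclic_lists) = 1"
  "\<forall>H\<in>set max_cyclic_lists. \<exists>x\<in>set H. x \<noteq> [1, 2, 3, 4]"
  by code_simp+

lemma involutions_check:
  "length (filter (\<lambda>l. comp_list l l = [1, 2, 3, 4]) perm_lists) = 10" "distinct perm_lists"
  by code_simp+

lemma id_in_perm_lists: "[1, 2, 3, 4] \<in> set perm_lists"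
  unfolding in_perm_lists by auto

lemma sym_group_4_partition: "has_nontrivial_partition (sym_group 4)"
proof -
  interpret G: group "sym_group 4" by (rule sym_group_is_group)
  have fin: "finite (carrier (sym_group 4))" unfolding carrier_sym_group_4 by simp
  define P where "P = (\<lambda>H. perm_of ` set H) ` set max_cyclic_lists"
  have mem: "perm_of l \<in> perm_of ` set H \<longleftrightarrow> l \<in> set H"
    if "H \<in> set max_cyclic_lists" "l \<in> set perm_lists" for H l
    using that max_cyclic_lists_check(1) perm_of_inj by blast
  have "group_partition (sym_group 4) P"
    unfolding group_partition_def
  proof (intro conjI ballI)
    have "perm_of [2, 1, 3, 4] \<in> carrier (sym_group 4)"
      unfolding carrier_sym_group_4 in_perm_lists by (intro imageI) (auto simp: in_perm_lists)
    moreover have "perm_of [2, 1, 3, 4] \<noteq> id"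
      using perm_of_inj[of "[2, 1, 3, 4]" "[1, 2, 3, 4]"] perm_of_id by (auto simp: in_perm_lists)
    ultimately show "carrier (sym_group 4) \<noteq> {\<one>\<^bsub>sym_group 4\<^esub>}" unfolding sym_group_one by blast
    fix K assume "K \<in> P"
    then obtain H where H: "H \<in> set max_cyclic_lists" "K = perm_of ` set H" unfolding P_def by blast
    obtain x0 where x0: "x0 \<in> set H" "x0 \<noteq> [1, 2, 3, 4]" using max_cyclic_lists_check(3) H by blast
    hence x0L: "x0 \<in> set perm_lists" using max_cyclic_lists_check(1) H by blast
    have "perm_of x0 \<noteq> id" using perm_of_inj[OF x0L id_in_perm_lists] x0 perm_of_id by auto
    thus "K \<noteq> {\<one>\<^bsub>sym_group 4\<^esub>}" unfolding H sym_group_one using x0 by blast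
    show "subgroup K (sym_group 4)"
    proof (rule G.subgroupI)
      show sub: "K \<subseteq> carrier (sym_group 4)"
        unfolding H carrier_sym_group_4 using max_cyclic_lists_check(1) H by blast
      show "K \<noteq> {}" unfolding H using x0(1) by auto
      fix p assume "p \<in> K"
      then obtain x where x: "x \<in> set H" "p = perm_of x" unfolding H by blast
      have xL: "x \<in> set perm_lists" using max_cyclic_lists_check(1) H x by blast
      obtain y where y: "y \<in> set H" "comp_list y x = [1, 2, 3, 4]"
        using max_cyclic_lists_check(1) H x by blast
      have yL: "y \<in> set perm_lists" using max_cyclic_lists_check(1) H y by blast
      have "perm_of y \<otimes>\<^bsub>sym_group 4\<^esub> p = \<one>\<^bsub>sym_group 4\<^esub>"
        unfolding x(2) sym_group_mult sym_group_one perm_of_comp[OF yL xL] y(2) by (rule perm_of_id)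
      moreover have "perm_of y \<in> carrier (sym_group 4)" "p \<in> carrier (sym_group 4)"
        unfolding carrier_sym_group_4 x(2) using xL yL by blast+
      ultimately have "inv\<^bsub>sym_group 4\<^esub> p = perm_of y" by (intro G.inv_equality)
      thus "inv\<^bsub>sym_group 4\<^esub> p \<in> K" unfolding H using y by blast
      fix r assume "r \<in> K"
      then obtain z where z: "z \<in> set H" "r = perm_of z" unfolding H by blast
      have zL: "z \<in> set perm_lists" using max_cyclic_lists_check(1) H z by blast
      have "p \<otimes>\<^bsub>sym_group 4\<^esub> r = perm_of (comp_list x z)"
        unfolding x(2) z(2) sym_group_mult using perm_of_comp[OF xL zL] .
      moreover have "comp_list x z \<in> set H" using max_cyclic_lists_check(1) H x z by blast
      ultimately show "p \<otimes>\<^bsub>sym_group 4\<^esub> r \<in> K" unfolding H by blast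
    qed
  next
    fix p assume "p \<in> carrier (sym_group 4) - {\<one>\<^bsub>sym_group 4\<^esub>}"
    then obtain l where l: "l \<in> set perm_lists" "p = perm_of l" "p \<noteq> id"
      unfolding carrier_sym_group_4 sym_group_one by blast
    have "l \<noteq> [1, 2, 3, 4]" using l perm_of_id by blast
    hence "length (filter (\<lambda>H. l \<in> set H) max_cyclic_lists) = 1"
      using max_cyclic_lists_check(2) l(1) by blast
    then obtain H where H: "filter (\<lambda>H. l \<in> set H) max_cyclic_lists = [H]"
      by (metis One_nat_def length_0_conv length_Suc_conv)
    have Hm: "H \<in> set max_cyclic_lists" "l \<in> set H"
      using arg_cong[OF H, of set] by auto
    show "\<exists>!K. K \<in> P \<and> p \<in> K"
    proof (rule ex1I[of _ "perm_of ` set H"])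
      show "perm_of ` set H \<in> P \<and> p \<in> perm_of ` set H" unfolding P_def l(2) using Hm by blast
      fix K assume K: "K \<in> P \<and> p \<in> K"
      then obtain H' where H': "H' \<in> set max_cyclic_lists" "K = perm_of ` set H'" unfolding P_def by blast
      have "perm_of l \<in> perm_of ` set H'" using K unfolding H'(2) l(2) by (rule conjunct2)
      hence "l \<in> set H'" unfolding mem[OF H'(1) l(1)] .
      hence "H' \<in> set (filter (\<lambda>H. l \<in> set H) max_cyclic_lists)" using H'(1) by simp
      thus "K = perm_of ` set H" unfolding H H'(2) by simp
    qed
  qed
  moreover have "card P \<noteq> 1"
  proof
    assume "card P = 1"
    then obtain K where K: "P = {K}" by (auto simp: card_1_singleton_iff)
    let ?x = "[2, 1, 3, 4] :: nat list" and ?y = "[3, 2, 1, 4] :: nat list"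
    have c: "cyclic_list ?x \<in> set max_cyclic_lists" "cyclic_list ?y \<in> set max_cyclic_lists"
      unfolding max_cyclic_lists_def by simp_all
    have "perm_of ` set (cyclic_list ?x) \<in> P" "perm_of ` set (cyclic_list ?y) \<in> P"
      unfolding P_def by (intro imageI c)+
    hence eq: "perm_of ` set (cyclic_list ?x) = perm_of ` set (cyclic_list ?y)"
      unfolding K singleton_iff by (rule trans[OF _ sym])
    have "?x \<in> set (cyclic_list ?x)" by (simp add: cyclic_list_def)
    hence "perm_of ?x \<in> perm_of ` set (cyclic_list ?y)" unfolding eq[symmetric] by (rule imageI)
    hence "?x \<in> set (cyclic_list ?y)" using mem[OF c(2), of ?x] by (auto simp: in_perm_lists)
    thus False by (simp add: cyclic_list_def comp_list_def)
  qed
  ultimately show ?thesis unfolding has_nontrivial_partition_def using fin G.is_group by blast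
qed

lemma sym_group_4_in_class_H: "in_class_H (sym_group 4)"
proof -
  interpret G: group "sym_group 4" by (rule sym_group_is_group)
  have fin: "finite (carrier (sym_group 4))" unfolding carrier_sym_group_4 by simp
  have "{p. p permutes {1..4::nat}} = carrier (sym_group 4)" by (auto simp: sym_group_carrier)
  hence ord: "order (sym_group 4) = 24"
    unfolding order_def using card_permutations[of "{1..4::nat}" 4] by (simp add: fact_numeral)
  let ?I = "filter (\<lambda>l. comp_list l l = [1, 2, 3, 4]) perm_lists"
  have sub: "perm_of ` set ?I \<subseteq> root_set 2 (sym_group 4)"
  proof
    fix p assume "p \<in> perm_of ` set ?I"
    then obtain l where l: "l \<in> set perm_lists" "comp_list l l = [1, 2, 3, 4]" "p = perm_of l" by auto
    have pc: "p \<in> carrier (sym_group 4)" unfolding carrier_sym_group_4 using l by blast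
    hence "p [^]\<^bsub>sym_group 4\<^esub> (2::nat) = p \<otimes>\<^bsub>sym_group 4\<^esub> p" by (simp add: numeral_2_eq_2)
    also have "\<dots> = \<one>\<^bsub>sym_group 4\<^esub>"
      unfolding sym_group_mult sym_group_one l(3) perm_of_comp[OF l(1) l(1)] l(2) by (rule perm_of_id)
    finally show "p \<in> root_set 2 (sym_group 4)" using pc unfolding root_set_def by blast
  qed
  have card: "card (perm_of ` set ?I) = 10"
  proof -
    have "inj_on perm_of (set ?I)" using perm_of_inj by (auto intro!: inj_onI)
    hence "card (perm_of ` set ?I) = card (set ?I)" by (rule card_image)
    also have "\<dots> = length ?I" using involutions_check(2) by (intro distinct_card) simp
    finally show ?thesis using involutions_check(1) by simp
  qed
  have "2 dvd order (sym_group 4)" by (simp add: ord)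
  hence "real 10 / real 2 \<le> global_breadth (sym_group 4)"
    by (rule global_breadth_ge_card[OF G.is_group fin _ sub eq_refl[OF card[symmetric]]])
  thus ?thesis by (intro in_class_HI[OF G.is_group fin, of 5]) (simp_all add: ord)
qed

section \<open>Groups with nontrivial partitions in the class of large breadth\<close>

theorem theorem1p4:
  shows
    "(has_nontrivial_partition (sym_group 4) \<and> in_class_H (sym_group 4))
     \<and>
     ((\<exists>c::real. c \<ge> 2 * sqrt 2 \<and>
        (\<forall>(q::nat) (F :: nat ring).
           ((\<exists>n\<ge>2. q = 3 ^ n) \<or> (primepow q \<and> q \<ge> 5)) \<and> is_GF q F \<longrightarrow>
           real (order (PSL2 F)) \<le> c * global_breadth (PSL2 F) * sqrt (global_breadth (PSL2 F))))
      \<and>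
      (\<forall>(q::nat) (F :: nat ring). primepow q \<and> q \<ge> 4 \<and> is_GF q F \<longrightarrow>
           has_nontrivial_partition (PSL2 F) \<and> in_class_H (PSL2 F)))
     \<and>
     ((\<exists>c::real. c \<ge> 2 * sqrt 2 \<and>
        (\<forall>(n::nat) (q::nat) (F :: nat ring).
           n \<ge> 1 \<and> q = 2 ^ (2 * n + 1) \<and> is_GF q F \<longrightarrow>
           real (order (Sz n F)) \<le> c * global_breadth (Sz n F) * sqrt (global_breadth (Sz n F))))
      \<and>
      (\<forall>(n::nat) (q::nat) (F :: nat ring).
           n \<ge> 1 \<and> q = 2 ^ (2 * n + 1) \<and> q \<ge> 8 \<and> is_GF q F \<longrightarrow>
           has_nontrivial_partition (Sz n F) \<and> in_class_H (Sz n F)))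
     \<and>
     ((\<exists>c::real. c \<ge> 2 * sqrt 2 \<and>
        (\<forall>(q::nat) (F :: nat ring). primepow q \<and> q \<ge> 4 \<and> is_GF q F \<longrightarrow>
           real (order (PGL2 F)) \<le> c * global_breadth (PGL2 F) * sqrt (global_breadth (PGL2 F))))
      \<and>
      (\<forall>(q::nat) (F :: nat ring). primepow q \<and> q \<ge> 4 \<and> is_GF q F \<longrightarrow>
           has_nontrivial_partition (PGL2 F) \<and> in_class_H (PGL2 F)))"
proof -
  have field: "finite_field F \<and> order F = q" if "is_GF q F" for q and F :: "nat ring"
    using that unfolding is_GF_def by (auto intro: finite_field.intro finite_field_axioms.intro)
  have c: "2 * sqrt 2 \<le> 27" "2 * sqrt 2 \<le> 8" "2 * sqrt 2 \<le> 2 * sqrt 2"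
    using real_sqrt_le_mono[of 2 4] by simp_all
  have S4: "has_nontrivial_partition (sym_group 4) \<and> in_class_H (sym_group 4)"
    using sym_group_4_partition sym_group_4_in_class_H by blast
  have PSL_bound: "real (order (PSL2 F)) \<le> 27 * global_breadth (PSL2 F) * sqrt (global_breadth (PSL2 F))"
    if "(\<exists>n\<ge>2. q = 3 ^ n) \<or> (primepow q \<and> q \<ge> 5)" "is_GF q F" for q and F :: "nat ring"
  proof -
    have "q \<ge> 5"
      using that(1)
    proof
      assume "\<exists>n\<ge>2. q = 3 ^ n"
      then obtain n where "n \<ge> 2" "q = 3 ^ n" by blast
      thus "q \<ge> 5" using power_increasing[of 2 n "3::nat"] by simp
    qed simp
    thus ?thesis using field[OF that(2)] finite_field.PSL2_bound by metis
  qed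
  have PSL: "has_nontrivial_partition (PSL2 F) \<and> in_class_H (PSL2 F)"
    if "primepow q \<and> q \<ge> 4 \<and> is_GF q F" for q and F :: "nat ring"
    using that field finite_field.partition_PSL2 finite_field.PSL2_in_class_H by metis
  have suzuki: "suzuki_field F n" if "n \<ge> 1 \<and> q = 2 ^ (2 * n + 1) \<and> is_GF q F" for n q and F :: "nat ring"
    using that field by (auto intro!: suzuki_field.intro suzuki_field_axioms.intro)
  have Sz_bound: "real (order (Sz n F)) \<le> 8 * global_breadth (Sz n F) * sqrt (global_breadth (Sz n F))"
    if "n \<ge> 1 \<and> q = 2 ^ (2 * n + 1) \<and> is_GF q F" for n q and F :: "nat ring"
    by (rule suzuki_field.Sz_large_breadth(1)[OF suzuki[OF that]])
  have Sz: "has_nontrivial_partition (Sz n F) \<and> in_class_H (Sz n F)"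
    if "n \<ge> 1 \<and> q = 2 ^ (2 * n + 1) \<and> q \<ge> 8 \<and> is_GF q F" for n q and F :: "nat ring"
    using suzuki_field.partition_Sz suzuki_field.Sz_large_breadth(2) suzuki that by blast
  have PGL_bound: "real (order (PGL2 F)) \<le> 2 * sqrt 2 * global_breadth (PGL2 F) * sqrt (global_breadth (PGL2 F))"
    if "primepow q \<and> q \<ge> 4 \<and> is_GF q F" for q and F :: "nat ring"
    using that field finite_field.PGL2_large_breadth(1) by blast
  have PGL: "has_nontrivial_partition (PGL2 F) \<and> in_class_H (PGL2 F)"
    if "primepow q \<and> q \<ge> 4 \<and> is_GF q F" for q and F :: "nat ring"
    using that field finite_field.partition_PGL2 finite_field.PGL2_large_breadth(2) by metis
  show ?thesis
    apply (intro conjI S4[THEN conjunct1] S4[THEN conjunct2])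
         apply (rule exI[of _ 27], use c(1) PSL_bound in blast)
        apply (use PSL in blast)
       apply (rule exI[of _ 8], use c(2) Sz_bound in blast)
      apply (use Sz in blast)
     apply (rule exI[of _ "2 * sqrt 2"], use c(3) PGL_bound in blast)
    apply (use PGL in blast)
    done
qed

end
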